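(* Let $\Omega\subset\mathbb{R}^2$ be a bounded open set with Lipschitz boundary and let $f:S^1\times S^1\to\mathbb{R}$ be a bounded function with $f(u,v)=f(v,u)$ and $f(u,v)=f(u,-v)=f(-u,v)$ for all $u,v\in S^1$. Let $F_\varepsilon:L^\infty(\Omega;\mathbb{M}^{2\times2}_{sym})\to\mathbb{R}\cup\{\infty\}$ be defined by $$F_\varepsilon(Q)=\sum_{|i-j|=1}\varepsilon^2f(u_i,u_j)\quad\text{if }Q\in C_\varepsilon(\Omega;S^1_\otimes),\ Q(\varepsilon i)=u_i\otimes u_i\ (u_i\in S^1,\ i\in\mathbb{Z}_\varepsilon(\Omega)),$$ and $F_\varepsilon(Q)=+\infty$ otherwise. Define $\widehat f:K\to\mathbb{R}$ by $$\widehat f(Q)=\begin{cases}f(u,v)&\text{if }Q=\frac{u\otimes u+v\otimes v}{2}\ne\frac12I,\ u,v\in S^1,\\ \inf\{f(u,v):u,v\in S^1,\ \frac{u\otimes u+v\otimes v}2=\frac12I\}&\text{if }Q=\frac12I.\end{cases}$$ Then, as $\varepsilon\to0$, $F_\varepsilon$ $\Gamma$-converges with respect to the weak$^*$ topology of $L^\infty(\Omega;\mathbb{M}^{2\times2}_{sym})$ to the functional $F$ defined by $$F(Q)=4\int_\Omega\widehat f^{**}(Q(x))\,dx\ \text{ if }Q\in L^\infty(\Omega;K),\qquad F(Q)=+\infty\ \text{ otherwise.}$$ In particular $f_{\rm hom}=4\widehat f^{**}$ on $K$, where $f_{\rm hom}$ is the homogenized energy density recalled in the context.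
   Context: $\mathbb{M}^{2\times2}_{sym}$ is the space of symmetric $2\times2$ real matrices with the Frobenius norm, $I$ the identity, $K=\{Q\in\mathbb{M}^{2\times2}_{sym}:Q\ge0,\ \mathrm{tr}\,Q=1\}$, $S^1_\otimes=\{v\otimes v:v\in S^1\}$. $\mathbb{Z}_\varepsilon(A)=\{i\in\mathbb{Z}^2:\varepsilon i\in A\}$, $W=[-\frac12,\frac12)^2$, and $C_\varepsilon(\Omega;S^1_\otimes)=\{Q:\Omega\to S^1_\otimes:\ Q(x)=Q(\varepsilon i)\text{ if }x\in\varepsilon\{i+W\},\ i\in\mathbb{Z}_\varepsilon(\Omega)\}$. The sum over $|i-j|=1$ runs over all ordered pairs $(i,j)\in\mathbb{Z}_\varepsilon(\Omega)^2$ with $|i-j|=1$ (each bond is counted twice). Every $Q\in K$ has the form $\frac12(u\otimes u+v\otimes v)$ with $u,v\in S^1$, and for $Q\ne\frac12I$ the pair $\{u\otimes u,v\otimes v\}$ is unique, so $\widehat f$ is well defined. $\widehat f$ is extended by $+\infty$ outside $K$, and $\widehat f^{**}$ denotes its lower semicontinuous convex envelope. The density $f_{\rm hom}$ is, for $\bar Q\in K$, $$f_{\rm hom}(\bar Q)=\lim_{\rho\to0}\lim_{h\to+\infty}\frac1{h^2}\inf\Bigl\{\sum_{|\xi|=1}\ \sum_{\beta\in\mathbb{Z}^2\cap hW,\ \beta+\xi\in hW}f(u_\beta,u_{\beta+\xi})\Bigr\},$$ with $\xi\in\mathbb{Z}^2$ and the infimum over all $u:\mathbb{Z}^2\cap hW\to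 S^1$ such that the average of $u_\beta\otimes u_\beta$ over $\beta\in\mathbb{Z}^2\cap hW$ lies in the closed ball $\overline B(\bar Q,\rho)$. *)

theory Defs
  imports "HOL-Analysis.Analysis"
begin

type_synonym vec2 = "real ^ 2"
type_synonym mat2 = "real ^ 2 ^ 2"

text \<open>The norm and the inner product of the type \<^typ>\<open>mat2\<close> are the Frobenius ones.\<close>

definition sym_mats :: "mat2 set" where
  "sym_mats = {Q. transpose Q = Q}"

definition tensor :: "vec2 \<Rightarrow> vec2 \<Rightarrow> mat2" where
  "tensor u v = (\<chi> i j. u $ i * v $ j)"

abbreviation S1 :: "vec2 set" where
  "S1 \<equiv> sphere 0 1"

definition S1_tensor :: "mat2 set" where
  "S1_tensor = {tensor v v |v. v \<in> S1}"

definition K_set :: "mat2 set" where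
  "K_set = {Q \<in> sym_mats. (\<forall>x. 0 \<le> x \<bullet> (Q *v x)) \<and> trace Q = 1}"

text \<open>Near each boundary point, the set is the strict supergraph of a Lipschitz function in
  the coordinates given by some orthonormal frame \<open>e1, e2\<close>.\<close>

definition lipschitz_boundary :: "vec2 set \<Rightarrow> bool" where
  "lipschitz_boundary \<Omega> \<longleftrightarrow>
    (\<forall>p \<in> frontier \<Omega>. \<exists>r e1 e2 \<gamma> L. r > 0 \<and>
       norm e1 = 1 \<and> norm e2 = 1 \<and> e1 \<bullet> e2 = 0 \<and> L-lipschitz_on UNIV (\<gamma> :: real \<Rightarrow> real) \<and>
       \<Omega> \<inter> ball p r = {x \<in> ball p r. (x - p) \<bullet> e2 > \<gamma> ((x - p) \<bullet> e1)})"

text \<open>Elements of \<open>L\<^sup>\<infinity>(\<Omega>; sym_mats)\<close> are represented by functions that are not identified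
  when they agree almost everywhere. The functionals below do not distinguish such functions,
  and neither do the open sets of the weak* topology.\<close>

definition Linf :: "vec2 set \<Rightarrow> (vec2 \<Rightarrow> mat2) set" where
  "Linf \<Omega> = {Q \<in> borel_measurable (lebesgue_on \<Omega>).
     (AE x in lebesgue_on \<Omega>. Q x \<in> sym_mats) \<and>
     (\<exists>C. AE x in lebesgue_on \<Omega>. norm (Q x) \<le> C)}"

definition L1 :: "vec2 set \<Rightarrow> (vec2 \<Rightarrow> mat2) set" where
  "L1 \<Omega> = {\<phi>. integrable (lebesgue_on \<Omega>) \<phi> \<and> (AE x in lebesgue_on \<Omega>. \<phi> x \<in> sym_mats)}"

definition weak_star :: "vec2 set \<Rightarrow> (vec2 \<Rightarrow> mat2) topology" where
  "weak_star \<Omega> = topology_generated_by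
     {{Q \<in> Linf \<Omega>. (LINT x|lebesgue_on \<Omega>. Q x \<bullet> \<phi> x) \<in> U} |\<phi> U. \<phi> \<in> L1 \<Omega> \<and> open U}"

lemma topspace_weak_star: "topspace (weak_star \<Omega>) = Linf \<Omega>"
proof -
  have "(\<lambda>_. 0) \<in> L1 \<Omega>"
    by (simp add: L1_def sym_mats_def transpose_def vec_eq_iff)
  then show ?thesis
    unfolding weak_star_def topology_generated_by_topspace
    by (auto intro!: exI[of _ "Linf \<Omega>"] exI[of _ "UNIV :: real set"])
qed

definition Gamma_liminf ::
  "'a topology \<Rightarrow> 'e filter \<Rightarrow> ('e \<Rightarrow> 'a \<Rightarrow> ereal) \<Rightarrow> 'a \<Rightarrow> ereal" where
  "Gamma_liminf X \<F> F x =
     (SUP U \<in> {U. openin X U \<and> x \<in> U}. Liminf \<F> (\<lambda>\<epsilon>. INF y \<in> U. F \<epsilon> y))"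

definition Gamma_limsup ::
  "'a topology \<Rightarrow> 'e filter \<Rightarrow> ('e \<Rightarrow> 'a \<Rightarrow> ereal) \<Rightarrow> 'a \<Rightarrow> ereal" where
  "Gamma_limsup X \<F> F x =
     (SUP U \<in> {U. openin X U \<and> x \<in> U}. Limsup \<F> (\<lambda>\<epsilon>. INF y \<in> U. F \<epsilon> y))"

definition Gamma_converges ::
  "'a topology \<Rightarrow> 'e filter \<Rightarrow> ('e \<Rightarrow> 'a \<Rightarrow> ereal) \<Rightarrow> ('a \<Rightarrow> ereal) \<Rightarrow> bool" where
  "Gamma_converges X \<F> F F0 \<longleftrightarrow>
     (\<forall>x \<in> topspace X. Gamma_liminf X \<F> F x = F0 x \<and> Gamma_limsup X \<F> F x = F0 x)"

definition Z2 :: "vec2 set" where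
  "Z2 = {i. \<forall>k. i $ k \<in> \<int>}"

definition Z_eps :: "real \<Rightarrow> vec2 set \<Rightarrow> vec2 set" where
  "Z_eps \<epsilon> A = {i \<in> Z2. \<epsilon> *\<^sub>R i \<in> A}"

definition W :: "vec2 set" where
  "W = {x. \<forall>k. - 1/2 \<le> x $ k \<and> x $ k < 1/2}"

definition C_eps :: "real \<Rightarrow> vec2 set \<Rightarrow> (vec2 \<Rightarrow> mat2) set" where
  "C_eps \<epsilon> \<Omega> = {Q. (\<forall>x \<in> \<Omega>. Q x \<in> S1_tensor) \<and>
     (\<forall>i \<in> Z_eps \<epsilon> \<Omega>. \<forall>x \<in> \<Omega> \<inter> (\<lambda>y. \<epsilon> *\<^sub>R (i + y)) ` W. Q x = Q (\<epsilon> *\<^sub>R i))}"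

text \<open>\<open>u\<close> is a spin field of (the almost everywhere class of) \<open>Q\<close>. At each site it is
  determined by the class up to sign, since for open \<open>\<Omega>\<close> and positive \<open>\<epsilon>\<close> every cell with
  centre in \<open>\<Omega>\<close> meets \<open>\<Omega>\<close> in a set of positive measure.\<close>

definition spin_field ::
  "real \<Rightarrow> vec2 set \<Rightarrow> (vec2 \<Rightarrow> mat2) \<Rightarrow> (vec2 \<Rightarrow> vec2) \<Rightarrow> bool" where
  "spin_field \<epsilon> \<Omega> Q u \<longleftrightarrow>
     (\<exists>P \<in> C_eps \<epsilon> \<Omega>. (AE x in lebesgue_on \<Omega>. Q x = P x) \<and>
        (\<forall>i \<in> Z_eps \<epsilon> \<Omega>. u i \<in> S1 \<and> P (\<epsilon> *\<^sub>R i) = tensor (u i) (u i)))"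

text \<open>The choice of \<open>u\<close> is immaterial when \<open>f\<close> is even in each argument on \<^const>\<open>S1\<close>.\<close>

definition F_eps ::
  "(vec2 \<Rightarrow> vec2 \<Rightarrow> real) \<Rightarrow> vec2 set \<Rightarrow> real \<Rightarrow> (vec2 \<Rightarrow> mat2) \<Rightarrow> ereal" where
  "F_eps f \<Omega> \<epsilon> Q =
     (if \<exists>u. spin_field \<epsilon> \<Omega> Q u then
        let u = (SOME u. spin_field \<epsilon> \<Omega> Q u)
        in ereal (\<Sum>(i, j) \<in> {(i, j). i \<in> Z_eps \<epsilon> \<Omega> \<and> j \<in> Z_eps \<epsilon> \<Omega> \<and> norm (i - j) = 1}.
                    \<epsilon>\<^sup>2 * f (u i) (u j))
      else \<infinity>)"

definition fhat :: "(vec2 \<Rightarrow> vec2 \<Rightarrow> real) \<Rightarrow> mat2 \<Rightarrow> real" where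
  "fhat f Q =
     (if Q \<noteq> (1/2) *\<^sub>R mat 1 then
        (THE r. \<exists>u \<in> S1. \<exists>v \<in> S1. Q = (1/2) *\<^sub>R (tensor u u + tensor v v) \<and> r = f u v)
      else Inf {f u v |u v. u \<in> S1 \<and> v \<in> S1 \<and>
                  (1/2) *\<^sub>R (tensor u u + tensor v v) = (1/2) *\<^sub>R mat 1})"

definition fhat_ext :: "(vec2 \<Rightarrow> vec2 \<Rightarrow> real) \<Rightarrow> mat2 \<Rightarrow> ereal" where
  "fhat_ext f Q = (if Q \<in> K_set then ereal (fhat f Q) else \<infinity>)"

definition lsc_on :: "'a::topological_space set \<Rightarrow> ('a \<Rightarrow> ereal) \<Rightarrow> bool" where
  "lsc_on S g \<longleftrightarrow> (\<forall>x \<in> S. g x \<le> Liminf (at x within S) g)"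

definition ereal_convex_on :: "'a::real_vector set \<Rightarrow> ('a \<Rightarrow> ereal) \<Rightarrow> bool" where
  "ereal_convex_on S g \<longleftrightarrow> convex {(x, t :: real). x \<in> S \<and> g x \<le> ereal t}"

definition lsc_convex_envelope ::
  "'a::real_normed_vector set \<Rightarrow> ('a \<Rightarrow> ereal) \<Rightarrow> 'a \<Rightarrow> ereal" where
  "lsc_convex_envelope S h x =
     (SUP g \<in> {g. lsc_on S g \<and> ereal_convex_on S g \<and> (\<forall>y \<in> S. g y \<le> h y)}. g x)"

definition fhat_env :: "(vec2 \<Rightarrow> vec2 \<Rightarrow> real) \<Rightarrow> mat2 \<Rightarrow> ereal" where
  "fhat_env f = lsc_convex_envelope sym_mats (fhat_ext f)"

text \<open>For bounded \<open>f\<close> the envelope is finite on \<^const>\<open>K_set\<close>, so the conversion to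
  \<^typ>\<open>real\<close> under the integral loses nothing.\<close>

definition F_lim ::
  "(vec2 \<Rightarrow> vec2 \<Rightarrow> real) \<Rightarrow> vec2 set \<Rightarrow> (vec2 \<Rightarrow> mat2) \<Rightarrow> ereal" where
  "F_lim f \<Omega> Q =
     (if AE x in lebesgue_on \<Omega>. Q x \<in> K_set
      then ereal (4 * (LINT x|lebesgue_on \<Omega>. real_of_ereal (fhat_env f (Q x))))
      else \<infinity>)"

definition cube_sites :: "real \<Rightarrow> vec2 set" where
  "cube_sites h = Z2 \<inter> (\<lambda>x. h *\<^sub>R x) ` W"

definition cube_average :: "real \<Rightarrow> (vec2 \<Rightarrow> vec2) \<Rightarrow> mat2" where
  "cube_average h u =
     (1 / real (card (cube_sites h))) *\<^sub>R (\<Sum>\<beta> \<in> cube_sites h. tensor (u \<beta>) (u \<beta>))"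

definition cube_energy ::
  "(vec2 \<Rightarrow> vec2 \<Rightarrow> real) \<Rightarrow> mat2 \<Rightarrow> real \<Rightarrow> real \<Rightarrow> ereal" where
  "cube_energy f Q \<rho> h =
     ereal (1 / h\<^sup>2) *
     (INF u \<in> {u. (\<forall>\<beta> \<in> cube_sites h. u \<beta> \<in> S1) \<and> cube_average h u \<in> cball Q \<rho>}.
        ereal (\<Sum>\<xi> \<in> {\<xi> \<in> Z2. norm \<xi> = 1}.
                 \<Sum>\<beta> \<in> {\<beta> \<in> cube_sites h. \<beta> + \<xi> \<in> cube_sites h}. f (u \<beta>) (u (\<beta> + \<xi>))))"

text \<open>\<^const>\<open>Lim\<close> is meaningful only when the limit exists; \<open>fhom_exists\<close> says that
  both limits in \<open>fhom\<close> do.\<close>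

definition fhom_rho :: "(vec2 \<Rightarrow> vec2 \<Rightarrow> real) \<Rightarrow> mat2 \<Rightarrow> real \<Rightarrow> ereal" where
  "fhom_rho f Q \<rho> = Lim at_top (cube_energy f Q \<rho>)"

definition fhom :: "(vec2 \<Rightarrow> vec2 \<Rightarrow> real) \<Rightarrow> mat2 \<Rightarrow> ereal" where
  "fhom f Q = Lim (at_right 0) (fhom_rho f Q)"

definition fhom_exists :: "(vec2 \<Rightarrow> vec2 \<Rightarrow> real) \<Rightarrow> mat2 \<Rightarrow> bool" where
  "fhom_exists f Q \<longleftrightarrow>
     (\<forall>\<rho> > 0. \<exists>l. (cube_energy f Q \<rho> \<longlongrightarrow> l) at_top) \<and>
     (\<exists>l. (fhom_rho f Q \<longlongrightarrow> l) (at_right 0))"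

end

theory Submission
  imports Defs
begin

text \<open>A spin enters \<open>F_eps\<close> only through \<open>u \<otimes> u\<close>, and a bond \<open>(u, v)\<close> costs at least the envelope at
  the midpoint of \<open>u \<otimes> u\<close> and \<open>v \<otimes> v\<close>. On \<open>K\<close> the envelope is the supremum \<open>env\<close> of the affine
  functions lying below \<open>f\<close> at all these midpoints. Summing one such affine minorant over all bonds, and
  using that each site has four neighbours, gives a linear functional of \<open>Q\<close>, which passes to the weak*
  limit; letting the minorant vary continuously in space yields the lower bound. Conversely, checkerboards
  of \<open>u\<close> and \<open>v\<close> have average \<open>(u \<otimes> u + v \<otimes> v) / 2\<close> and energy \<open>4 f(u, v)\<close> per site, and
  juxtaposing rectangles realises every convex combination up to interface terms. Such patterns, placed
  in mesoscopic blocks according to the averages of \<open>Q\<close> over the blocks, give the recovery sequence by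
  Jensen's inequality, and inside a single large cube the same two bounds identify \<open>fhom\<close>.\<close>

section \<open>Symmetric matrices and pairs of spins\<close>

text \<open>Doubling the angle identifies the matrices \<open>u \<otimes> u\<close> with the
  boundary circle of the disc K, so a bond is a chord and f is a function of chords. The centre I/2
  is the one midpoint shared by many chords, which is why minorants are tested against f on pairs of
  spins and not against \<open>fhat\<close>. One chord can occupy all bonds at once because Z^2 is
  bipartite. The obstacle is regularity: f is only bounded, and the envelope, though convex and
  lower semicontinuous on K, may jump along the boundary circle. Three devices replace its
  continuity: a measurable choice among countably many minorants for the lower bound, total
  boundedness of its graph for a block size common to all values of Q, and a small shift towards the
  centre of the ball for the constraint in \<open>fhom\<close>. Both Gamma-bounds are estimates on
  whole neighbourhoods, so neither metrisability nor diagonal sequences are called for.\<close>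

lemma inner_mat2: "(A::mat2) \<bullet> B = A$1$1*B$1$1 + A$1$2*B$1$2 + A$2$1*B$2$1 + A$2$2*B$2$2"
  by (simp add: inner_vec_def sum_2)

lemma mat2_eq_iff: "(A::mat2) = B \<longleftrightarrow> A$1$1 = B$1$1 \<and> A$1$2 = B$1$2 \<and> A$2$1 = B$2$1 \<and> A$2$2 = B$2$2"
  by (auto simp: vec_eq_iff forall_2)

lemma S1_iff: "u \<in> S1 \<longleftrightarrow> (u$1)\<^sup>2 + (u$2)\<^sup>2 = 1"
  by (simp add: norm_eq_1 inner_vec_def sum_2 power2_eq_square)

lemma sym_mats_iff: "Q \<in> sym_mats \<longleftrightarrow> Q$1$2 = Q$2$1"
  by (auto simp: sym_mats_def transpose_def mat2_eq_iff)

lemma inner_tensor: "Q \<bullet> tensor x x = x \<bullet> (Q *v x)"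
  by (simp add: inner_mat2 tensor_def inner_vec_def sum_2 matrix_vector_mult_def algebra_simps)

lemma inner_mat_1: "(Q::mat2) \<bullet> mat 1 = trace Q"
  by (simp add: inner_mat2 mat_def trace_def sum_2)

text \<open>All conditions become linear in Q through the inner product: symmetry is orthogonality
  to an antisymmetric matrix, the trace is the product with the identity. Closedness, convexity and
  stability under averages (\<open>tile_average\<close>) follow from this form.\<close>

lemma K_set_iff:
  "Q \<in> K_set \<longleftrightarrow> Q \<bullet> (tensor (axis 1 1) (axis 2 1) - tensor (axis 2 1) (axis 1 1)) = 0 \<and>
     Q \<bullet> mat 1 = 1 \<and> (\<forall>x. 0 \<le> Q \<bullet> tensor x x)"
  unfolding inner_tensor inner_mat_1
  by (auto simp: K_set_def sym_mats_iff inner_mat2 tensor_def axis_def)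

lemma norm_tensor: "norm (tensor u v) = norm u * norm v"
proof -
  have "tensor u v \<bullet> tensor u v = (u \<bullet> u) * (v \<bullet> v)"
    by (simp add: inner_mat2 tensor_def inner_vec_def sum_2 algebra_simps)
  then show ?thesis by (simp add: norm_eq_sqrt_inner real_sqrt_mult)
qed

lemma norm_tensor_S1: "u \<in> S1 \<Longrightarrow> norm (tensor u u) = 1"
  by (simp add: norm_tensor)

lemma tensor_in_K: "u \<in> S1 \<Longrightarrow> tensor u u \<in> K_set"
proof -
  assume u: "u \<in> S1"
  have "tensor u u \<bullet> tensor x x = (u \<bullet> x)\<^sup>2" for x
    by (simp add: inner_mat2 tensor_def inner_vec_def sum_2 power2_eq_square algebra_simps)
  moreover have "tensor u u \<bullet> mat 1 = 1"
    using u unfolding S1_iff by (simp add: inner_mat2 tensor_def mat_def power2_eq_square)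
  ultimately show ?thesis by (simp add: K_set_iff inner_diff_right inner_mat2[of _ "tensor (axis _ _) _"])
      (simp add: tensor_def axis_def)
qed

lemma closed_K: "closed K_set"
proof -
  have "K_set = {Q. Q \<bullet> (tensor (axis 1 1) (axis 2 1) - tensor (axis 2 1) (axis 1 1)) = 0} \<inter>
     {Q. Q \<bullet> mat 1 = 1} \<inter> (\<Inter>x. {Q. 0 \<le> Q \<bullet> tensor x x})"
    by (auto simp: K_set_iff)
  also have "closed \<dots>"
    by (intro closed_Int closed_INT closed_Collect_eq closed_Collect_le ballI continuous_intros)
  finally show ?thesis .
qed

lemma convex_K: "convex K_set"
  unfolding convex_alt
  by (auto simp: inner_add_left K_set_iff)

text \<open>The inequality is the nonnegativity of four times the determinant, rewritten with trace
  one. It puts the coordinates \<open>(2 * Q$1$1 - 1, 2 * Q$1$2)\<close> of K in the unit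
  disc.\<close>

lemma K_entries:
  assumes "Q \<in> K_set"
  shows "Q$2$1 = Q$1$2" "Q$2$2 = 1 - Q$1$1" "(2 * Q$1$1 - 1)\<^sup>2 + (2 * Q$1$2)\<^sup>2 \<le> 1"
proof -
  show s: "Q$2$1 = Q$1$2" and t: "Q$2$2 = 1 - Q$1$1"
    using assms by (auto simp: K_set_def sym_mats_iff trace_def sum_2)
  have q: "0 \<le> a * (a * Q$1$1) + 2 * (a * (b * Q$1$2)) + b * (b * Q$2$2)" for a b
  proof -
    have "0 \<le> Q \<bullet> tensor (vector [a,b]) (vector [a,b])" using assms by (auto simp: K_set_iff)
    then show ?thesis by (simp add: inner_mat2 tensor_def s algebra_simps)
  qed
  have "(Q$1$2)\<^sup>2 \<le> Q$1$1 * (1 - Q$1$1)"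
  proof (cases "Q$1$1 = 0")
    case True
    \<comment> \<open>With \<open>Q$1$1 = 0\<close> the vector \<open>(- 1, Q$1$2)\<close> makes the
      quadratic form equal to \<open>- (Q$1$2)\<^sup>2\<close>.\<close>
    have "0 \<le> 2 * (- Q$1$2 * Q$1$2) + (Q$1$2)\<^sup>2"
      using q[of "- 1" "Q$1$2"] q[of "- 1" "Q$1$2"] True t q[of "-1/2" "Q$1$2"]
      by (simp add: power2_eq_square)
    then show ?thesis using True by (simp add: power2_eq_square)
  next
    case False
    have p: "Q$1$1 > 0" using q[of 1 0] False by simp
    \<comment> \<open>On the vector \<open>(- Q$1$2, Q$1$1)\<close> the quadratic form is
      \<open>Q$1$1\<close> times the determinant.\<close>
    have "0 \<le> Q$1$1 * (Q$1$1 * (1 - Q$1$1) - (Q$1$2)\<^sup>2)"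
      using q[of "- Q$1$2" "Q$1$1"] t by (simp add: power2_eq_square algebra_simps)
    then show ?thesis using p by (simp add: zero_le_mult_iff)
  qed
  then show "(2 * Q$1$1 - 1)\<^sup>2 + (2 * Q$1$2)\<^sup>2 \<le> 1"
    by (simp add: power2_eq_square algebra_simps)
qed

section \<open>Points of K as midpoints of chords\<close>

definition pair_mat :: "vec2 \<Rightarrow> vec2 \<Rightarrow> mat2" where
  "pair_mat u v = (1/2) *\<^sub>R (tensor u u + tensor v v)"

lemma pair_mat_in_K: "u \<in> S1 \<Longrightarrow> v \<in> S1 \<Longrightarrow> pair_mat u v \<in> K_set"
  using convexD[OF convex_K, of "tensor u u" "tensor v v" "1/2" "1/2"] tensor_in_K
  by (simp add: pair_mat_def scaleR_right_distrib)

text \<open>A spin of angle a corresponds to the boundary point of angle 2a of the disc. A point of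
  modulus cos \<gamma> and argument \<theta> is the midpoint of the chord whose end points have the
  angles \<theta> + \<gamma> and \<theta> - \<gamma>; hence the halved angles in \<open>u\<close>
  and \<open>v\<close>.\<close>

lemma K_pair_mat:
  assumes "Q \<in> K_set"
  obtains u v where "u \<in> S1" "v \<in> S1" "Q = pair_mat u v"
proof -
  define z where "z = Complex (2 * Q$1$1 - 1) (2 * Q$1$2)"
  have "cmod z \<le> 1" using K_entries(3)[OF assms] by (simp add: z_def cmod_def)
  define \<gamma> where "\<gamma> = arccos (cmod z)"
  have \<gamma>: "cos \<gamma> = cmod z" using \<open>cmod z \<le> 1\<close> by (simp add: \<gamma>_def cos_arccos order.trans[OF _ norm_ge_zero])
  obtain \<theta> where \<theta>: "z = rcis (cmod z) \<theta>" using rcis_cmod_Arg by metis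
  define u :: vec2 where "u = vector [cos ((\<theta>+\<gamma>)/2), sin ((\<theta>+\<gamma>)/2)]"
  define v :: vec2 where "v = vector [cos ((\<theta>-\<gamma>)/2), sin ((\<theta>-\<gamma>)/2)]"
  have c: "(cos (x/2))\<^sup>2 = (1 + cos x)/2" "(sin (x/2))\<^sup>2 = (1 - cos x)/2"
    "2 * (cos (x/2) * sin (x/2)) = sin x" for x :: real
    using cos_double_cos[of "x/2"] cos_double_sin[of "x/2"] sin_double[of "x/2"] by auto
  have r: "2 * Q$1$1 - 1 = cos \<gamma> * cos \<theta>" "2 * Q$1$2 = cos \<gamma> * sin \<theta>"
    using arg_cong[OF \<theta>, of Re] arg_cong[OF \<theta>, of Im] \<gamma> by (simp_all add: z_def)
  have "Q = pair_mat u v"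
    using c(1,2)[of "\<theta>+\<gamma>"] c(1,2)[of "\<theta>-\<gamma>"] c(3)[of "\<theta>+\<gamma>"] c(3)[of "\<theta>-\<gamma>"] r K_entries(1,2)[OF assms]
    by (simp add: mat2_eq_iff pair_mat_def tensor_def u_def v_def cos_add cos_diff sin_add sin_diff
        power2_eq_square algebra_simps)
  moreover have "u \<in> S1" "v \<in> S1" unfolding S1_iff by (simp_all add: u_def v_def)
  ultimately show ?thesis using that by blast
qed

text \<open>Both projections are applied to v: one returns v, the other its component along
  u.\<close>

lemma tensor_eq_imp:
  assumes "u \<in> S1" "v \<in> S1" "tensor u u = tensor v v"
  shows "v = u \<or> v = - u"
proof -
  have v: "v = (v \<bullet> u) *\<^sub>R u"
  proof -
    have "tensor u u *v v = (v \<bullet> u) *\<^sub>R u" "tensor v v *v v = (v \<bullet> v) *\<^sub>R v"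
      by (simp_all add: vec_eq_iff forall_2 tensor_def matrix_vector_mult_def inner_vec_def sum_2 algebra_simps)
    then show ?thesis using assms by (simp add: norm_eq_1)
  qed
  have "\<bar>v \<bullet> u\<bar> = 1" using arg_cong[OF v, of norm] assms by simp
  then show ?thesis using v by (metis abs_eq_iff abs_one scaleR_minus1_left scaleR_one)
qed

text \<open>Squaring w as a complex number turns \<open>tensor w w\<close> into a point
  \<open>c w\<close> of the unit circle. Since the conjugate of \<open>c w\<close> is its inverse,
  the sum of two such points determines their product as soon as it is nonzero, that is off I/2.
  Both pairs are then the roots of one quadratic equation.\<close>

lemma pair_mat_unique:
  assumes S: "u \<in> S1" "v \<in> S1" "u' \<in> S1" "v' \<in> S1"
    and eq: "pair_mat u v = pair_mat u' v'" and ne: "pair_mat u v \<noteq> (1/2) *\<^sub>R mat 1"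
  shows "tensor u' u' = tensor u u \<and> tensor v' v' = tensor v v \<or>
    tensor u' u' = tensor v v \<and> tensor v' v' = tensor u u"
proof -
  define c where "c = (\<lambda>w::vec2. (Complex (w$1) (w$2))\<^sup>2)"
  have n: "c w * cnj (c w) = 1" if "w \<in> S1" for w
  proof -
    have "cmod (c w) = 1" using that unfolding S1_iff unfolding c_def norm_power by (simp add: cmod_def)
    then show ?thesis by (simp flip: complex_norm_square)
  qed
  have c: "c w = Complex ((w$1)\<^sup>2 - (w$2)\<^sup>2) (2 * (w$1 * w$2))" for w
    by (simp add: c_def complex_eq_iff power2_eq_square)
  have T: "c w = c w' \<longleftrightarrow> tensor w w = tensor w' w'" if "w \<in> S1" "w' \<in> S1" for w w'
    using that unfolding S1_iff
    by (auto simp: c complex_eq_iff mat2_eq_iff tensor_def power2_eq_square mult.commute)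
  have sum: "c u + c v = c u' + c v'"
    using eq S by (simp add: c complex_eq_iff pair_mat_def mat2_eq_iff tensor_def power2_eq_square)
  have "c u + c v \<noteq> 0"
  proof
    assume "c u + c v = 0"
    then have "pair_mat u v = (1/2) *\<^sub>R mat 1"
      using S unfolding S1_iff
      by (simp add: c complex_eq_iff pair_mat_def mat2_eq_iff tensor_def power2_eq_square mat_def mult.commute)
    then show False using ne by simp
  qed
  have pr: "c w * c w' * cnj (c w + c w') = c w + c w'" if "w \<in> S1" "w' \<in> S1" for w w'
    using n[OF that(1)] n[OF that(2)]
    by (simp add: algebra_simps)
  have "c u * c v * cnj (c u + c v) = c u' * c v' * cnj (c u + c v)"
    using pr[OF S(1,2)] pr[OF S(3,4)] sum by metis
  then have prod: "c u * c v = c u' * c v'"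
    using \<open>c u + c v \<noteq> 0\<close> by (metis complex_cnj_zero_iff mult_right_cancel)
  have "(c u' - c u) * (c u' - c v) = 0"
  proof -
    have "(c u' - c u) * (c u' - c v) = c u' * c u' - c u' * (c u + c v) + c u * c v" by (simp add: algebra_simps)
    also have "\<dots> = 0" unfolding sum prod by (simp add: algebra_simps)
    finally show ?thesis .
  qed
  then have "c u' = c u \<or> c u' = c v" by simp
  then have "c u' = c u \<and> c v' = c v \<or> c u' = c v \<and> c v' = c u"
    using sum by (metis add.commute add_left_cancel)
  then show ?thesis using T S by blast
qed

section \<open>The envelope as a supremum of affine minorants\<close>

text \<open>The pair (a, M) stands for the affine function with value a + M \<bullet> X at X. At I/2
  it is compared with every value of f, so no chord has to be chosen there. Symmetry of M makes
  fields of such matrices admissible test functions in \<open>L1\<close>.\<close>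

definition affs :: "(vec2 \<Rightarrow> vec2 \<Rightarrow> real) \<Rightarrow> (real \<times> mat2) set" where
  "affs f = {(a, M). M \<in> sym_mats \<and> (\<forall>u \<in> S1. \<forall>v \<in> S1. a + M \<bullet> pair_mat u v \<le> f u v)}"

text \<open>Meaningful on K, where the supremum is over a nonempty bounded set; there it is the
  envelope (\<open>fhat_env_eq\<close>).\<close>

definition env :: "(vec2 \<Rightarrow> vec2 \<Rightarrow> real) \<Rightarrow> mat2 \<Rightarrow> real" where
  "env f X = (SUP p \<in> affs f. fst p + snd p \<bullet> X)"

definition graph_pts :: "(vec2 \<Rightarrow> vec2 \<Rightarrow> real) \<Rightarrow> (mat2 \<times> real) set" where
  "graph_pts f = {(pair_mat u v, f u v) |u v. u \<in> S1 \<and> v \<in> S1}"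

lemma norm_K_le_1: "X \<in> K_set \<Longrightarrow> norm X \<le> 1"
proof -
  assume "X \<in> K_set"
  then obtain u v where uv: "u \<in> S1" "v \<in> S1" "X = pair_mat u v" by (rule K_pair_mat)
  have "norm (tensor u u + tensor v v) \<le> 1 + 1"
    using norm_triangle_ineq[of "tensor u u" "tensor v v"] norm_tensor_S1 uv by simp
  then show ?thesis by (simp add: uv pair_mat_def)
qed

lemma compact_K: "compact K_set"
  using closed_K norm_K_le_1 by (auto simp: compact_eq_bounded_closed bounded_iff)

lemma convex_sym_mats: "convex sym_mats"
  by (auto simp: convex_alt sym_mats_iff)

lemma K_sub_sym: "K_set \<subseteq> sym_mats"
  by (auto simp: K_set_def)

locale spin_interaction =
  fixes f :: "vec2 \<Rightarrow> vec2 \<Rightarrow> real" and C :: real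
  assumes f_bdd: "\<And>u v. u \<in> S1 \<Longrightarrow> v \<in> S1 \<Longrightarrow> \<bar>f u v\<bar> \<le> C"
    and f_sym: "\<And>u v. u \<in> S1 \<Longrightarrow> v \<in> S1 \<Longrightarrow> f u v = f v u"
    and f_even: "\<And>u v. u \<in> S1 \<Longrightarrow> v \<in> S1 \<Longrightarrow> f u (- v) = f u v"
begin

text \<open>f descends to a function of the two tensors. This makes \<open>fhat\<close> well defined
  and frees the energy from the signs of the spins.\<close>

lemma f_tensor_cong:
  assumes "u \<in> S1" "v \<in> S1" "u' \<in> S1" "v' \<in> S1" "tensor u u = tensor u' u'" "tensor v v = tensor v' v'"
  shows "f u v = f u' v'"
proof -
  have "u' = u \<or> u' = - u" "v' = v \<or> v' = - v" using assms tensor_eq_imp by blast+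
  moreover have "f (- u) w = f u w" if "w \<in> S1" for w
    using that assms f_sym[of "- u" w] f_sym[of u w] f_even[of w u] by simp
  ultimately show ?thesis using assms f_even by auto
qed

lemma C_nonneg: "0 \<le> C"
proof -
  have "axis 1 1 \<in> S1" by simp
  then show ?thesis using f_bdd[of "axis 1 1" "axis 1 1"] by linarith
qed

lemma fhat_pair_mat:
  assumes "u \<in> S1" "v \<in> S1" "pair_mat u v \<noteq> (1/2) *\<^sub>R mat 1"
  shows "fhat f (pair_mat u v) = f u v"
proof -
  have "(THE r. \<exists>u'\<in>S1. \<exists>v'\<in>S1. pair_mat u v = pair_mat u' v' \<and> r = f u' v') = f u v"
  proof (rule the_equality)
    show "\<exists>u'\<in>S1. \<exists>v'\<in>S1. pair_mat u v = pair_mat u' v' \<and> f u v = f u' v'" using assms by blast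
    fix r assume "\<exists>u'\<in>S1. \<exists>v'\<in>S1. pair_mat u v = pair_mat u' v' \<and> r = f u' v'"
    then obtain u' v' where p: "u' \<in> S1" "v' \<in> S1" "pair_mat u v = pair_mat u' v'" "r = f u' v'" by blast
    then show "r = f u v"
      using pair_mat_unique[OF assms(1,2) p(1,2,3) assms(3)] f_tensor_cong[OF p(1,2) assms(1,2)]
        f_tensor_cong[OF p(1,2) assms(2,1)] f_sym[OF assms(1,2)] by auto
  qed
  then show ?thesis using assms by (simp add: fhat_def pair_mat_def)
qed

lemma fhat_le:
  assumes "u \<in> S1" "v \<in> S1"
  shows "fhat f (pair_mat u v) \<le> f u v"
proof (cases "pair_mat u v = (1/2) *\<^sub>R mat 1")
  case True
  have "bdd_below {f u v |u v. u \<in> S1 \<and> v \<in> S1 \<and> pair_mat u v = (1/2) *\<^sub>R mat 1}"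
    using f_bdd by (intro bdd_belowI[of _ "- C"]) (auto simp: abs_le_iff, smt (verit))
  then have "Inf {f u v |u v. u \<in> S1 \<and> v \<in> S1 \<and> pair_mat u v = (1/2) *\<^sub>R mat 1} \<le> f u v"
    using True assms by (intro cInf_lower) auto
  then show ?thesis by (simp add: fhat_def True flip: pair_mat_def)
next
  case False
  then show ?thesis using fhat_pair_mat assms by simp
qed

lemma fhat_ge:
  assumes X: "X \<in> K_set" and le: "\<And>u v. u \<in> S1 \<Longrightarrow> v \<in> S1 \<Longrightarrow> a + M \<bullet> pair_mat u v \<le> f u v"
  shows "a + M \<bullet> X \<le> fhat f X"
proof -
  obtain u v where uv: "u \<in> S1" "v \<in> S1" "X = pair_mat u v" using X by (rule K_pair_mat)
  show ?thesis
  proof (cases "X = (1/2) *\<^sub>R mat 1")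
    case True
    have "a + M \<bullet> X \<le> Inf {f u v |u v. u \<in> S1 \<and> v \<in> S1 \<and> pair_mat u v = (1/2) *\<^sub>R mat 1}"
    proof (rule cInf_greatest)
      show "{f u v |u v. u \<in> S1 \<and> v \<in> S1 \<and> pair_mat u v = (1/2) *\<^sub>R mat 1} \<noteq> {}"
        using True uv by auto
      fix t assume "t \<in> {f u v |u v. u \<in> S1 \<and> v \<in> S1 \<and> pair_mat u v = (1/2) *\<^sub>R mat 1}"
      then obtain u' v' where t: "t = f u' v'" "u' \<in> S1" "v' \<in> S1" "pair_mat u' v' = (1/2) *\<^sub>R mat 1" by auto
      then show "a + M \<bullet> X \<le> t" using le[OF t(2,3)] True by simp
    qed
    then show ?thesis by (simp add: fhat_def True flip: pair_mat_def)
  next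
    case False
    then show ?thesis using fhat_pair_mat uv le by simp
  qed
qed

lemma const_in_affs: "(- C, 0) \<in> affs f"
proof -
  have "- C \<le> f u v" if "u \<in> S1" "v \<in> S1" for u v using f_bdd[OF that] by (simp add: abs_le_iff)
  then show ?thesis by (auto simp: affs_def sym_mats_iff)
qed

lemma affs_le_C:
  assumes "(a, M) \<in> affs f" "X \<in> K_set" shows "a + M \<bullet> X \<le> C"
proof -
  obtain u v where uv: "u \<in> S1" "v \<in> S1" "X = pair_mat u v" using assms(2) by (rule K_pair_mat)
  then have "a + M \<bullet> X \<le> f u v" using assms by (auto simp: affs_def)
  then show ?thesis using f_bdd[OF uv(1,2)] by linarith
qed

lemma bdd_affs: "X \<in> K_set \<Longrightarrow> bdd_above ((\<lambda>p. fst p + snd p \<bullet> X) ` affs f)"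
  using affs_le_C by (intro bdd_aboveI[of _ C]) auto

lemma affs_le_env: "(a, M) \<in> affs f \<Longrightarrow> X \<in> K_set \<Longrightarrow> a + M \<bullet> X \<le> env f X"
  unfolding env_def using cSUP_upper[OF _ bdd_affs, of "(a, M)" X] by simp

lemma env_le: "(\<And>a M. (a, M) \<in> affs f \<Longrightarrow> a + M \<bullet> X \<le> c) \<Longrightarrow> env f X \<le> c"
  unfolding env_def using const_in_affs by (intro cSUP_least) auto

lemma env_bounds: "X \<in> K_set \<Longrightarrow> \<bar>env f X\<bar> \<le> C"
  using affs_le_env[OF const_in_affs, of X] env_le[of X C] affs_le_C by (simp add: abs_le_iff)

lemma less_env_iff: "X \<in> K_set \<Longrightarrow> t < env f X \<longleftrightarrow> (\<exists>(a, M) \<in> affs f. t < a + M \<bullet> X)"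
  unfolding env_def using const_in_affs by (subst less_cSUP_iff[OF _ bdd_affs]) (auto simp: Bex_def)

text \<open>Convexity lets a field of minorants be regularised inside a convex hull without leaving
  the minorants.\<close>

lemma convex_affs: "convex (affs f)"
proof (rule convexI)
  fix x y and s t :: real
  assume xy: "x \<in> affs f" "y \<in> affs f" and st: "0 \<le> s" "0 \<le> t" "s + t = 1"
  obtain a M b N where p: "x = (a, M)" "y = (b, N)" by fastforce
  have "s * a + t * b + (s *\<^sub>R M + t *\<^sub>R N) \<bullet> pair_mat u v \<le> f u v" if "u \<in> S1" "v \<in> S1" for u v
  proof -
    have "s * (a + M \<bullet> pair_mat u v) + t * (b + N \<bullet> pair_mat u v) \<le> s * f u v + t * f u v"
      using xy that st by (intro add_mono mult_left_mono) (auto simp: affs_def p)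
    also have "\<dots> = f u v" using st by (simp flip: distrib_right)
    finally show ?thesis by (simp add: inner_add_left algebra_simps)
  qed
  moreover have "s *\<^sub>R M + t *\<^sub>R N \<in> sym_mats"
    using xy st convex_sym_mats by (auto simp: affs_def p convex_def)
  ultimately show "s *\<^sub>R x + t *\<^sub>R y \<in> affs f" by (auto simp: affs_def p)
qed

text \<open>By separation: a point strictly above the graph of \<^const>\<open>env\<close> outside the closed convex hull
  of the interaction values would give a better affine minorant.\<close>

lemma env_approx:
  assumes X: "X \<in> K_set" and "\<delta> > 0"
  obtains Y r where "(Y, r) \<in> convex hull (graph_pts f)" "dist Y X < \<delta>" "r < env f X + \<delta>"
proof -
  define H where "H = closure (convex hull (graph_pts f))"
  \<comment> \<open>Adding the vertical ray closes the set upwards, which forces the vertical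
    coefficient s of a separating functional to be positive; compactness of H keeps the sum
    closed.\<close>
  define D where "D = (\<Union>x \<in> H. \<Union>y \<in> {0} \<times> {0..}. {x + y})"
  have "bounded (graph_pts f)"
  proof -
    have "norm p \<le> 1 + C" if "p \<in> graph_pts f" for p
      using that norm_K_le_1[OF pair_mat_in_K] f_bdd norm_Pair_le
      by (fastforce simp: graph_pts_def intro!: order.trans[OF norm_Pair_le] add_mono)
    then show ?thesis unfolding bounded_iff by blast
  qed
  then have "compact H" by (simp add: H_def bounded_convex_hull)
  then have "closed D" unfolding D_def by (intro compact_closed_sums closed_Times) auto
  have "convex D" unfolding D_def H_def
    by (intro convex_sums convex_closure convex_convex_hull convex_Times) auto
  have sub: "graph_pts f \<subseteq> H" unfolding H_def by (rule order.trans[OF hull_subset closure_subset])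
  have up: "(Y, r + s) \<in> D" if "(Y, r) \<in> H" "s \<ge> 0" for Y r s
    unfolding D_def using that by (auto intro!: bexI[of _ "(Y, r)"])
  obtain u v where uv: "u \<in> S1" "v \<in> S1" "X = pair_mat u v" using X by (rule K_pair_mat)
  have Xin: "(X, f u v) \<in> H" using sub uv by (auto simp: graph_pts_def)
  have "(X, env f X + \<delta>/2) \<in> D"
  proof (rule ccontr)
    assume "(X, env f X + \<delta>/2) \<notin> D"
    from separating_hyperplane_closed_point[OF \<open>convex D\<close> \<open>closed D\<close> this]
    obtain M s b where b1: "M \<bullet> X + s * (env f X + \<delta>/2) < b" and b2: "\<And>Y r. (Y, r) \<in> D \<Longrightarrow> b < M \<bullet> Y + s * r"
      by (force simp: inner_prod_def)
    \<comment> \<open>Over X the set D contains the point at height max (f u v) (env f X +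
      \<delta>/2), on the other side of the hyperplane.\<close>
    have "s > 0"
    proof -
      have "b < M \<bullet> X + s * (f u v + max 0 (env f X + \<delta>/2 - f u v))"
        by (intro b2 up[OF Xin]) simp
      then have "0 < s * (f u v + max 0 (env f X + \<delta>/2 - f u v) - (env f X + \<delta>/2))"
        using b1 by (simp add: algebra_simps)
      then show ?thesis by (smt (verit) zero_less_mult_iff)
    qed
    \<comment> \<open>Division by s turns the hyperplane into the graph of an affine function. M is
      symmetrised, as \<open>affs\<close> demands; inner products with elements of K do not
      change.\<close>
    define N where "N = (- 1 / s) *\<^sub>R ((1/2) *\<^sub>R (M + transpose M))"
    have "transpose M \<bullet> Y = M \<bullet> Y" if "Y \<in> K_set" for Y
      using that K_sub_sym by (auto simp: inner_mat2 transpose_def sym_mats_iff)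
    then have N: "N \<bullet> Y = - (M \<bullet> Y) / s" if "Y \<in> K_set" for Y
      using that by (simp add: N_def inner_add_left)
    have "b / s + N \<bullet> pair_mat u' v' \<le> f u' v'" if "u' \<in> S1" "v' \<in> S1" for u' v'
    proof -
      have "(pair_mat u' v', f u' v' + 0) \<in> D" using that sub by (intro up) (auto simp: graph_pts_def)
      from b2[OF this] have "(b - M \<bullet> pair_mat u' v') / s < f u' v'"
        using \<open>s > 0\<close> by (simp add: field_simps)
      then show ?thesis using N[OF pair_mat_in_K[OF that]] by (simp add: diff_divide_distrib)
    qed
    then have "(b / s, N) \<in> affs f" by (auto simp: affs_def sym_mats_iff N_def transpose_def)
    from affs_le_env[OF this X] N[OF X] have "(b - M \<bullet> X) / s \<le> env f X" by (simp add: diff_divide_distrib)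
    then have "b - M \<bullet> X \<le> s * env f X" using \<open>s > 0\<close> by (simp add: field_simps)
    moreover have "s * (\<delta>/2) > 0" using \<open>s > 0\<close> \<open>\<delta> > 0\<close> by simp
    ultimately show False using b1 by (simp add: algebra_simps)
  qed
  then obtain r where r: "(X, r) \<in> H" "r \<le> env f X + \<delta>/2" by (auto simp: D_def)
  then obtain p where p: "p \<in> convex hull (graph_pts f)" "dist p (X, r) < \<delta>/2"
    using \<open>\<delta> > 0\<close> unfolding H_def closure_approachable by (meson half_gt_zero)
  have "dist (fst p) X < \<delta>/2" "dist (snd p) r < \<delta>/2"
    using p(2) dist_fst_le[of p "(X, r)"] dist_snd_le[of p "(X, r)"] by auto
  moreover from this have "snd p < env f X + \<delta>" using r unfolding dist_real_def by linarith
  ultimately show ?thesis using p(1) \<open>\<delta> > 0\<close> that[of "fst p" "snd p"] by simp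
qed

text \<open>From above: the epigraph of a competitor is convex and contains
  \<open>graph_pts\<close>, hence the convex hull, which has points over neighbours of X at heights
  hardly above \<open>env f X\<close>; lower semicontinuity at X concludes. From below: each affine
  minorant is itself a competitor.\<close>

lemma fhat_env_eq:
  assumes X: "X \<in> K_set"
  shows "fhat_env f X = ereal (env f X)"
proof (rule antisym)
  show "fhat_env f X \<le> ereal (env f X)"
    unfolding fhat_env_def lsc_convex_envelope_def
  proof (rule SUP_least, rule ccontr)
    fix g assume g: "g \<in> {g. lsc_on sym_mats g \<and> ereal_convex_on sym_mats g \<and> (\<forall>y\<in>sym_mats. g y \<le> fhat_ext f y)}"
      and "\<not> g X \<le> ereal (env f X)"
    then obtain y where y: "env f X < y" "ereal y < g X" using ereal_dense2 by (metis less_ereal.simps(1) not_le)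
    have sub: "convex hull (graph_pts f) \<subseteq> {(x, t). x \<in> sym_mats \<and> g x \<le> ereal t}"
    proof (rule hull_minimal)
      show "convex {(x, t). x \<in> sym_mats \<and> g x \<le> ereal t}" using g by (simp add: ereal_convex_on_def)
      have "g (pair_mat u v) \<le> ereal (f u v)" "pair_mat u v \<in> sym_mats" if "u \<in> S1" "v \<in> S1" for u v
      proof -
        show s: "pair_mat u v \<in> sym_mats" using pair_mat_in_K[OF that] K_sub_sym by blast
        then have "g (pair_mat u v) \<le> ereal (fhat f (pair_mat u v))"
          using g pair_mat_in_K[OF that] by (auto simp: fhat_ext_def dest!: bspec)
        also have "\<dots> \<le> ereal (f u v)" using fhat_le[OF that] by simp
        finally show "g (pair_mat u v) \<le> ereal (f u v)" .
      qed
      then show "graph_pts f \<subseteq> {(x, t). x \<in> sym_mats \<and> g x \<le> ereal t}" by (auto simp: graph_pts_def)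
    qed
    have "g X \<le> Liminf (at X within sym_mats) g" using g X K_sub_sym by (auto simp: lsc_on_def)
    then have "\<forall>\<^sub>F z in at X within sym_mats. ereal y < g z" using y(2) by (auto simp: le_Liminf_iff)
    then obtain d where d: "d > 0" "\<And>Y. Y \<in> sym_mats \<Longrightarrow> Y \<noteq> X \<Longrightarrow> dist Y X < d \<Longrightarrow> ereal y < g Y"
      by (auto simp: eventually_at)
    obtain Y r where Y: "(Y, r) \<in> convex hull (graph_pts f)" "dist Y X < min d (y - env f X)"
      "r < env f X + min d (y - env f X)"
      using env_approx[OF X, of "min d (y - env f X)"] d y by auto
    have "Y \<in> sym_mats" "g Y \<le> ereal r" using sub Y(1) by auto
    \<comment> \<open>The \<open>Liminf\<close> at X disregards the value at X, so Y = X is a case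
      of its own.\<close>
    moreover have "ereal y < g Y" using d(2)[of Y] Y(2) y(2) \<open>Y \<in> sym_mats\<close> by (cases "Y = X") auto
    ultimately have "y < r" by (meson le_less_trans less_le_trans less_ereal.simps(1))
    then show False using Y(3) by linarith
  qed
  have "ereal t \<le> fhat_env f X" if t: "t < env f X" for t
  proof -
    obtain a M where aM: "(a, M) \<in> affs f" "t < a + M \<bullet> X" using t less_env_iff[OF X] by auto
    define g where "g = (\<lambda>Y. ereal (a + M \<bullet> Y))"
    have "lsc_on sym_mats g"
      unfolding lsc_on_def le_Liminf_iff
    proof (intro ballI allI impI)
      fix x y assume "y < g x"
      moreover have "(g \<longlongrightarrow> g x) (at x within sym_mats)"
        unfolding g_def by (intro tendsto_intros)
      ultimately show "\<forall>\<^sub>F z in at x within sym_mats. y < g z" by (simp add: order_tendstoD(1))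
    qed
    moreover have "ereal_convex_on sym_mats g"
    proof -
      have "{(x, t). x \<in> sym_mats \<and> g x \<le> ereal t} = sym_mats \<times> UNIV \<inter> {p. (M, -1) \<bullet> p \<le> - a}"
        by (auto simp: g_def inner_prod_def)
      then show ?thesis unfolding ereal_convex_on_def
        by (simp only:) (intro convex_Int convex_Times convex_sym_mats convex_UNIV convex_halfspace_le)
    qed
    moreover have "\<forall>y\<in>sym_mats. g y \<le> fhat_ext f y"
      using fhat_ge[of _ a M] aM(1) by (auto simp: g_def fhat_ext_def affs_def)
    ultimately have "g X \<le> fhat_env f X"
      unfolding fhat_env_def lsc_convex_envelope_def by (intro SUP_upper) auto
    then show ?thesis using aM(2) by (simp add: g_def) (meson ereal_less_eq(3) less_imp_le order_trans)
  qed
  then show "ereal (env f X) \<le> fhat_env f X"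
    by (metis ereal_dense2 less_ereal.simps(1) not_le)
qed

end

section \<open>Lattice energies and patterns\<close>

definition nbs :: "vec2 set" where
  "nbs = {\<xi> \<in> Z2. norm \<xi> = 1}"

definition bonds :: "vec2 set \<Rightarrow> (vec2 \<times> vec2) set" where
  "bonds B = {(i, j). i \<in> B \<and> j \<in> B \<and> norm (i - j) = 1}"

text \<open>Bonds are listed by starting site and direction, not by end points, so that together
  with \<open>outp\<close> they fill the product \<open>B \<times> nbs\<close>.\<close>

definition inp :: "vec2 set \<Rightarrow> (vec2 \<times> vec2) set" where
  "inp B = {(i, \<xi>). i \<in> B \<and> \<xi> \<in> nbs \<and> i + \<xi> \<in> B}"

definition outp :: "vec2 set \<Rightarrow> (vec2 \<times> vec2) set" where
  "outp B = {(i, \<xi>). i \<in> B \<and> \<xi> \<in> nbs \<and> i + \<xi> \<notin> B}"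

definition energy :: "(vec2 \<Rightarrow> vec2 \<Rightarrow> real) \<Rightarrow> vec2 set \<Rightarrow> (vec2 \<Rightarrow> vec2) \<Rightarrow> real" where
  "energy g B u = (\<Sum>(i, j) \<in> bonds B. g (u i) (u j))"

definition site :: "int \<Rightarrow> int \<Rightarrow> vec2" where
  "site x y = vector [of_int x, of_int y]"

lemma site_nth [simp]: "site x y $ 1 = of_int x" "site x y $ 2 = of_int y"
  by (simp_all add: site_def)

lemma site_eq_iff [simp]: "site x y = site x' y' \<longleftrightarrow> x = x' \<and> y = y'"
  by (auto simp: vec_eq_iff forall_2)

lemma site_in_Z2 [simp]: "site x y \<in> Z2"
  by (auto simp: Z2_def forall_2)

lemma Z2_site: "i \<in> Z2 \<Longrightarrow> i = site \<lfloor>i$1\<rfloor> \<lfloor>i$2\<rfloor>"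
  by (auto simp: Z2_def vec_eq_iff forall_2)

lemma Z2_add: "i \<in> Z2 \<Longrightarrow> j \<in> Z2 \<Longrightarrow> i + j \<in> Z2"
  and Z2_diff: "i \<in> Z2 \<Longrightarrow> j \<in> Z2 \<Longrightarrow> i - j \<in> Z2"
  by (auto simp: Z2_def)

lemma site_add: "site x y + site x' y' = site (x + x') (y + y')"
  by (simp add: vec_eq_iff forall_2)

lemma nbs_eq: "nbs = {site 1 0, site (-1) 0, site 0 1, site 0 (-1)}"
proof -
  have key: "\<xi> \<in> nbs \<longleftrightarrow> \<xi> \<in> {site 1 0, site (-1) 0, site 0 1, site 0 (-1)}" if "\<xi> = site x y" for \<xi> x y
  proof -
    have "norm \<xi> = 1 \<longleftrightarrow> x * x + y * y = 1"
      by (simp add: that norm_eq_1 inner_vec_def sum_2 flip: of_int_mult of_int_add)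
    also have "\<dots> \<longleftrightarrow> (x = 1 \<and> y = 0) \<or> (x = -1 \<and> y = 0) \<or> (x = 0 \<and> y = 1) \<or> (x = 0 \<and> y = -1)"
    proof
      assume eq: "x * x + y * y = 1"
      have "\<bar>x\<bar> \<le> 1" "\<bar>y\<bar> \<le> 1" 
        using eq by (smt (verit) mult_le_cancel_left1 mult_minus_left mult_minus_right zero_le_square)+
      then have "x \<in> {-1, 0, 1}" "y \<in> {-1, 0, 1}" by auto
      then show "(x = 1 \<and> y = 0) \<or> (x = -1 \<and> y = 0) \<or> (x = 0 \<and> y = 1) \<or> (x = 0 \<and> y = -1)"
        using eq by auto
    qed auto
    finally show ?thesis by (auto simp: nbs_def that)
  qed
  show ?thesis
  proof (intro equalityI subsetI)
    fix \<xi> assume \<xi>: "\<xi> \<in> nbs"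
    then have "\<xi> = site \<lfloor>\<xi>$1\<rfloor> \<lfloor>\<xi>$2\<rfloor>" by (intro Z2_site) (simp add: nbs_def)
    then show "\<xi> \<in> {site 1 0, site (-1) 0, site 0 1, site 0 (-1)}" using key \<xi> by blast
  next
    fix \<xi> assume "\<xi> \<in> {site 1 0, site (-1) 0, site 0 1, site 0 (-1)}"
    then show "\<xi> \<in> nbs" using key by blast
  qed
qed

lemma card_nbs: "card nbs = 4" and finite_nbs: "finite nbs"
  by (simp_all add: nbs_eq)

lemma nbs_Z2: "\<xi> \<in> nbs \<Longrightarrow> \<xi> \<in> Z2" and norm_nbs: "\<xi> \<in> nbs \<Longrightarrow> norm \<xi> = 1"
  by (simp_all add: nbs_def)

lemma bonds_eq_inp: "B \<subseteq> Z2 \<Longrightarrow> bonds B = (\<lambda>(i, \<xi>). (i, i + \<xi>)) ` inp B"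
proof (intro equalityI subsetI)
  fix b assume B: "B \<subseteq> Z2" and "b \<in> bonds B"
  then obtain i j where b: "b = (i, j)" "i \<in> B" "j \<in> B" "norm (i - j) = 1" by (auto simp: bonds_def)
  have "j - i \<in> Z2" using b B Z2_diff[of j i] by blast
  then have "(i, j - i) \<in> inp B" using b by (simp add: inp_def nbs_def norm_minus_commute)
  then show "b \<in> (\<lambda>(i, \<xi>). (i, i + \<xi>)) ` inp B" by (rule rev_image_eqI) (simp add: b)
qed (auto simp: bonds_def inp_def nbs_def)

lemma inj_shift: "inj_on (\<lambda>(i, \<xi>). (i, i + \<xi> :: vec2)) A"
  by (auto simp: inj_on_def)

lemma sum_bonds: "B \<subseteq> Z2 \<Longrightarrow> (\<Sum>(i, j) \<in> bonds B. h i j) = (\<Sum>(i, \<xi>) \<in> inp B. h i (i + \<xi>))"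
  by (subst bonds_eq_inp, assumption, subst sum.reindex[OF inj_shift]) (simp add: case_prod_unfold o_def)

lemma inp_outp: "inp B \<union> outp B = B \<times> nbs" "inp B \<inter> outp B = {}"
  by (auto simp: inp_def outp_def)

lemma finite_inp_outp:
  assumes "finite B" shows "finite (inp B)" "finite (outp B)"
  using finite_subset[of "inp B" "B \<times> nbs"] finite_subset[of "outp B" "B \<times> nbs"] inp_outp(1)[of B] assms finite_nbs
  by auto

lemma finite_bonds: "finite B \<Longrightarrow> finite (bonds B)"
  by (rule finite_subset[of _ "B \<times> B"]) (auto simp: bonds_def)

lemma card_bonds:
  assumes "finite B" "B \<subseteq> Z2"
  shows "card (bonds B) + card (outp B) = 4 * card B"
proof -
  have "card (bonds B) = card (inp B)" by (simp add: bonds_eq_inp assms card_image inj_shift)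
  then have "card (bonds B) + card (outp B) = card (B \<times> nbs)"
    using card_Un_disjoint[OF finite_inp_outp[OF assms(1)] inp_outp(2)] inp_outp(1) by simp
  then show ?thesis by (simp add: card_cartesian_product card_nbs)
qed

text \<open>Four directions start at each site; those that leave B are subtracted at the price S
  each.\<close>

lemma sum_bonds_fst:
  fixes s :: "vec2 \<Rightarrow> real"
  assumes "finite B" "B \<subseteq> Z2" and S: "\<And>i. i \<in> B \<Longrightarrow> \<bar>s i\<bar> \<le> S"
  shows "4 * (\<Sum>i \<in> B. s i) - S * card (outp B) \<le> (\<Sum>(i, j) \<in> bonds B. s i)"
proof -
  have "(\<Sum>(i, j) \<in> bonds B. s i) = (\<Sum>(i, \<xi>) \<in> inp B. s i)"
    by (rule sum_bonds[OF assms(2)])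
  moreover have "(\<Sum>(i, \<xi>) \<in> inp B. s i) + (\<Sum>(i, \<xi>) \<in> outp B. s i) = (\<Sum>(i, \<xi>) \<in> B \<times> nbs. s i)"
    using sum.union_disjoint[OF finite_inp_outp[OF assms(1)] inp_outp(2)] inp_outp(1)[of B] by metis
  moreover have "(\<Sum>(i, \<xi>) \<in> B \<times> nbs. s i) = 4 * (\<Sum>i \<in> B. s i)"
    by (simp add: card_nbs sum_distrib_left flip: sum.cartesian_product)
  moreover have "(\<Sum>(i, \<xi>) \<in> outp B. s i) \<le> (\<Sum>(i, \<xi>) \<in> outp B. S)"
    using S by (intro sum_mono) (auto simp: outp_def abs_le_iff)
  ultimately show ?thesis by (simp add: case_prod_unfold mult.commute)
qed

lemma sum_bonds_swap: "(\<Sum>(i, j) \<in> bonds B. h i j) = (\<Sum>(i, j) \<in> bonds B. h j i)"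
  by (rule sum.reindex_bij_witness[of _ prod.swap prod.swap]) (auto simp: bonds_def norm_minus_commute)

section \<open>Rectangles of lattice sites\<close>

definition rect :: "int \<Rightarrow> int \<Rightarrow> nat \<Rightarrow> nat \<Rightarrow> vec2 set" where
  "rect a b n m = (\<lambda>(x, y). site x y) ` ({a..<a + int n} \<times> {b..<b + int m})"

lemma inj_site: "inj_on (\<lambda>(x, y). site x y) A"
  by (auto simp: inj_on_def)

lemma site_in_rect [simp]: "site x y \<in> rect a b n m \<longleftrightarrow> a \<le> x \<and> x < a + int n \<and> b \<le> y \<and> y < b + int m"
  by (auto simp: rect_def)

lemma rect_props: "finite (rect a b n m)" "rect a b n m \<subseteq> Z2" "card (rect a b n m) = n * m"
  by (auto simp: rect_def card_image inj_site card_cartesian_product)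

lemma sum_rect: "(\<Sum>i \<in> rect a b n m. h i) = (\<Sum>x \<in> {a..<a + int n}. \<Sum>y \<in> {b..<b + int m}. h (site x y))"
  unfolding rect_def by (subst sum.reindex[OF inj_site]) (simp add: o_def case_prod_unfold sum.cartesian_product)

text \<open>Only a site on a side of the rectangle starts an outgoing bond, and a side starts at
  most one per site in its outward direction.\<close>

lemma card_outp_rect: "card (outp (rect a b n m)) \<le> 2 * (n + m)"
proof -
  let ?X = "{a..<a + int n}" and ?Y = "{b..<b + int m}"
  let ?A = "(\<lambda>y. (site (a + int n - 1) y, site 1 0)) ` ?Y" and ?B = "(\<lambda>y. (site a y, site (-1) 0)) ` ?Y"
  let ?A' = "(\<lambda>x. (site x (b + int m - 1), site 0 1)) ` ?X" and ?B' = "(\<lambda>x. (site x b, site 0 (-1))) ` ?X"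
  have "outp (rect a b n m) \<subseteq> (?A \<union> ?B) \<union> (?A' \<union> ?B')"
  proof
    fix p assume "p \<in> outp (rect a b n m)"
    then obtain x y \<xi> where p: "p = (site x y, \<xi>)" "site x y \<in> rect a b n m" "\<xi> \<in> nbs" "site x y + \<xi> \<notin> rect a b n m"
      by (auto simp: outp_def rect_def)
    from p(3) show "p \<in> (?A \<union> ?B) \<union> (?A' \<union> ?B')"
      using p(2,4) by (auto simp: nbs_eq p(1) site_add)
  qed
  then have "card (outp (rect a b n m)) \<le> card ((?A \<union> ?B) \<union> (?A' \<union> ?B'))" by (intro card_mono) auto
  also have "\<dots> \<le> (card ?A + card ?B) + (card ?A' + card ?B')"
    by (meson card_Un_le add_mono order_trans)
  also have "\<dots> \<le> (m + m) + (n + n)"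
    using card_image_le[of ?Y "\<lambda>y. (site (a + int n - 1) y, site 1 0)"] card_image_le[of ?Y "\<lambda>y. (site a y, site (-1) 0)"]
      card_image_le[of ?X "\<lambda>x. (site x (b + int m - 1), site 0 1)"] card_image_le[of ?X "\<lambda>x. (site x b, site 0 (-1))"]
    by (intro add_mono) auto
  finally show ?thesis by simp
qed

lemma real_card_outp_rect: "real (card (outp (rect a b n m))) \<le> 2 * (real n + real m)"
  using of_nat_mono[OF card_outp_rect, of a b n m, where ?'a = real] by simp

lemma energy_cong:
  assumes "\<And>i. i \<in> B \<Longrightarrow> u i = u' i" shows "energy g B u = energy g B u'"
  unfolding energy_def by (rule sum.cong) (auto simp: bonds_def assms)

section \<open>Bulk lower bound and gluing of energies\<close>

context spin_interaction begin

text \<open>On a bond (i, j) the minorant of i is used at the midpoint. Exchanging i and j in the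
  sum turns its part on the spin at j into \<open>M j \<bullet> T i\<close>, which differs from
  \<open>M i \<bullet> T i\<close> by at most w. Each site then collects its own minorant four
  times. The loss is w/2 per bond, and there are at most \<open>4 * card B\<close> bonds.\<close>

lemma energy_lower:
  assumes B: "finite B" "B \<subseteq> Z2" and u: "\<And>i. i \<in> B \<Longrightarrow> u i \<in> S1"
    and aff: "\<And>i. i \<in> B \<Longrightarrow> (a i, M i) \<in> affs f"
    and w: "\<And>i j. i \<in> B \<Longrightarrow> j \<in> B \<Longrightarrow> norm (i - j) = 1 \<Longrightarrow> norm (M i - M j) \<le> w"
    and S: "\<And>i. i \<in> B \<Longrightarrow> \<bar>a i + M i \<bullet> tensor (u i) (u i)\<bar> \<le> S" and "0 \<le> w"
  shows "4 * (\<Sum>i \<in> B. a i + M i \<bullet> tensor (u i) (u i)) - S * card (outp B) - 2 * w * card B \<le> energy f B u"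
proof -
  define T where "T = (\<lambda>i. tensor (u i) (u i))"
  define s where "s = (\<lambda>i. a i + M i \<bullet> T i)"
  have sw: "(\<Sum>(i, j) \<in> bonds B. M i \<bullet> T j) = (\<Sum>(i, j) \<in> bonds B. M j \<bullet> T i)" by (rule sum_bonds_swap)
  have "(\<Sum>(i, j) \<in> bonds B. s i - w / 2) \<le> (\<Sum>(i, j) \<in> bonds B. a i + (1/2) * (M i \<bullet> T i) + (1/2) * (M j \<bullet> T i))"
  proof (rule sum_mono, clarify)
    fix i j assume "(i, j) \<in> bonds B"
    then have ij: "i \<in> B" "j \<in> B" "norm (i - j) = 1" by (auto simp: bonds_def)
    have "(M i - M j) \<bullet> T i \<le> norm (M i - M j) * norm (T i)" by (rule norm_cauchy_schwarz)
    also have "\<dots> \<le> w" using w[OF ij] u[OF ij(1)] by (simp add: T_def norm_tensor_S1)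
    finally show "s i - w / 2 \<le> a i + (1/2) * (M i \<bullet> T i) + (1/2) * (M j \<bullet> T i)"
      by (simp add: s_def inner_diff_left)
  qed
  also have "\<dots> = (\<Sum>(i, j) \<in> bonds B. a i + (1/2) * (M i \<bullet> T i) + (1/2) * (M i \<bullet> T j))"
    using sw by (simp add: case_prod_unfold sum.distrib flip: sum_divide_distrib)
  also have "\<dots> \<le> energy f B u"
    unfolding energy_def
  proof (rule sum_mono, clarify)
    fix i j assume "(i, j) \<in> bonds B"
    then have ij: "i \<in> B" "j \<in> B" by (auto simp: bonds_def)
    have "a i + M i \<bullet> pair_mat (u i) (u j) \<le> f (u i) (u j)" using aff[OF ij(1)] u ij by (auto simp: affs_def)
    then show "a i + (1/2) * (M i \<bullet> T i) + (1/2) * (M i \<bullet> T j) \<le> f (u i) (u j)"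
      by (simp add: T_def pair_mat_def inner_add_right algebra_simps)
  qed
  finally have 1: "(\<Sum>(i, j) \<in> bonds B. s i) - card (bonds B) * (w / 2) \<le> energy f B u"
    by (simp add: case_prod_unfold sum_subtractf)
  have "card (bonds B) * (w / 2) \<le> (4 * card B) * (w / 2)"
    using card_bonds[OF B] \<open>0 \<le> w\<close> by (intro mult_right_mono) auto
  moreover have "4 * (\<Sum>i \<in> B. s i) - S * card (outp B) \<le> (\<Sum>(i, j) \<in> bonds B. s i)"
    using S by (intro sum_bonds_fst B) (simp add: s_def T_def)
  ultimately show ?thesis using 1 by (simp add: s_def T_def)
qed

text \<open>A bond of B inside no single \<open>A j\<close> either starts in some \<open>A j\<close>
  and leaves it, or starts at an uncovered site, which has four directions. Each such bond costs at
  most C.\<close>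

lemma energy_glue:
  assumes J: "finite J" "disjoint_family_on A J" and B: "finite B" "B \<subseteq> Z2" "(\<Union>j \<in> J. A j) \<subseteq> B"
    and u: "\<And>i. i \<in> B \<Longrightarrow> u i \<in> S1"
  shows "energy f B u \<le> (\<Sum>j \<in> J. energy f (A j) u)
    + C * ((\<Sum>j \<in> J. card (outp (A j))) + 4 * card (B - (\<Union>j \<in> J. A j)))"
proof -
  let ?h = "\<lambda>p. case p of (i, j) \<Rightarrow> f (u i) (u j)"
  let ?U = "\<Union>j \<in> J. bonds (A j)"
  define R where "R = bonds B - ?U"
  have AB: "A j \<subseteq> B" if "j \<in> J" for j using B that by blast
  have fA: "finite (A j)" if "j \<in> J" for j using AB that B finite_subset by blast
  have "?U \<subseteq> bonds B" using AB by (fastforce simp: bonds_def)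
  then have "energy f B u = sum ?h ?U + sum ?h R"
    unfolding energy_def R_def using sum.subset_diff[of ?U "bonds B" ?h] finite_bonds B by simp
  moreover have "sum ?h ?U = (\<Sum>j \<in> J. energy f (A j) u)"
    unfolding energy_def
  proof (rule sum.UNION_disjoint)
    show "\<forall>i\<in>J. \<forall>j\<in>J. i \<noteq> j \<longrightarrow> bonds (A i) \<inter> bonds (A j) = {}"
      using J(2) by (fastforce simp: bonds_def disjoint_family_on_def)
  qed (use J fA finite_bonds in auto)
  moreover have "sum ?h R \<le> C * ((\<Sum>j \<in> J. card (outp (A j))) + 4 * card (B - (\<Union>j \<in> J. A j)))"
  proof -
    let ?P = "(\<Union>j \<in> J. outp (A j)) \<union> (B - (\<Union>j \<in> J. A j)) \<times> nbs"
    have fP: "finite ?P" using J fA finite_inp_outp B finite_nbs by auto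
    have "R \<subseteq> (\<lambda>(i, \<xi>). (i, i + \<xi>)) ` ?P"
    proof
      fix b assume "b \<in> R"
      then obtain i \<xi> where b: "b = (i, i + \<xi>)" "(i, \<xi>) \<in> inp B" "(i, i + \<xi>) \<notin> ?U"
        using bonds_eq_inp[OF B(2)] by (auto simp: R_def)
      have "(i, \<xi>) \<in> ?P"
      proof (cases "\<exists>j\<in>J. i \<in> A j")
        case True
        then obtain j where j: "j \<in> J" "i \<in> A j" by blast
        then have "i + \<xi> \<notin> A j" using b by (auto simp: bonds_def inp_def nbs_def)
        then show ?thesis using j b by (auto simp: outp_def inp_def)
      next
        case False
        then show ?thesis using b by (auto simp: inp_def)
      qed
      then show "b \<in> (\<lambda>(i, \<xi>). (i, i + \<xi>)) ` ?P" by (rule rev_image_eqI) (simp add: b)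
    qed
    then have "card R \<le> card ?P" using fP by (meson surj_card_le)
    also have "\<dots> \<le> (\<Sum>j \<in> J. card (outp (A j))) + card ((B - (\<Union>j \<in> J. A j)) \<times> nbs)"
      by (rule order_trans[OF card_Un_le add_right_mono[OF card_UN_le[OF J(1)]]])
    finally have cR: "card R \<le> (\<Sum>j \<in> J. card (outp (A j))) + 4 * card (B - (\<Union>j \<in> J. A j))"
      by (simp add: card_cartesian_product card_nbs)
    have "sum ?h R \<le> (\<Sum>p \<in> R. C)"
    proof (rule sum_mono)
      fix p assume "p \<in> R"
      then have "fst p \<in> B" "snd p \<in> B" by (auto simp: R_def bonds_def)
      then show "?h p \<le> C" using f_bdd[OF u u, of "fst p" "snd p"] by (simp add: case_prod_unfold)
    qed
    also have "\<dots> = C * card R" by simp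
    also have "\<dots> \<le> C * ((\<Sum>j \<in> J. card (outp (A j))) + 4 * card (B - (\<Union>j \<in> J. A j)))"
      using cR C_nonneg by (intro mult_left_mono) (simp_all flip: of_nat_add of_nat_sum of_nat_mult)
    finally show ?thesis .
  qed
  ultimately show ?thesis by simp
qed

section \<open>Patterns with prescribed mean and energy\<close>

definition pattern :: "real \<Rightarrow> mat2 \<Rightarrow> real \<Rightarrow> vec2 set \<Rightarrow> (vec2 \<Rightarrow> vec2) \<Rightarrow> bool" where
  "pattern \<delta> X t B u \<longleftrightarrow> (\<forall>i. u i \<in> S1) \<and>
     norm ((\<Sum>i \<in> B. tensor (u i) (u i)) - real (card B) *\<^sub>R X) \<le> \<delta> * real (card B) \<and>
     energy f B u \<le> real (card B) * (4 * t + \<delta>)"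

text \<open>Position and both side lengths are free above N, so that a rectangle can be cut in two
  and a block can be placed anywhere. In \<open>pattern\<close> the number t is an energy per
  ordered bond, and a site starts four of these.\<close>

definition achievable :: "mat2 \<times> real \<Rightarrow> bool" where
  "achievable p \<longleftrightarrow> (\<forall>\<delta>>0. \<exists>N. \<forall>n\<ge>N. \<forall>m\<ge>N. \<forall>a b. \<exists>u. pattern \<delta> (fst p) (snd p) (rect a b n m) u)"

lemma alternating_sum:
  fixes s :: "int \<Rightarrow> real"
  assumes "\<And>x. s (x + 1) = - s x"
  shows "(\<Sum>x \<in> {a..<a + int n}. s x) = (s a - s (a + int n)) / 2"
proof (induction n)
  case (Suc n)
  have "{a..<a + int (Suc n)} = insert (a + int n) {a..<a + int n}" by auto
  then show ?case using Suc assms[of "a + int n"] by (simp add: algebra_simps)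
qed auto

lemma achievable_checkerboard:
  assumes uv: "u \<in> S1" "v \<in> S1"
  shows "achievable (pair_mat u v, f u v)"
  unfolding achievable_def fst_conv snd_conv
proof (intro allI impI)
  fix \<delta> :: real assume "\<delta> > 0"
  \<comment> \<open>The bound 1 absorbs the unbalanced spins, at most one per column; the bound 4 C
    absorbs the bonds missing at the boundary.\<close>
  define N where "N = nat \<lceil>max 1 (max (1/\<delta>) (4 * C / \<delta>))\<rceil>"
  have N: "real k \<ge> 1" "real k * \<delta> \<ge> 1" "real k * \<delta> \<ge> 4 * C" if "k \<ge> N" for k
  proof -
    have "max 1 (max (1/\<delta>) (4 * C / \<delta>)) \<le> real k" using that unfolding N_def by linarith
    then show "real k \<ge> 1" "real k * \<delta> \<ge> 1" "real k * \<delta> \<ge> 4 * C" using \<open>\<delta> > 0\<close> by (simp_all add: field_simps)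
  qed
  define w where "w = (\<lambda>i::vec2. if even (\<lfloor>i$1\<rfloor> + \<lfloor>i$2\<rfloor>) then u else v)"
  show "\<exists>N. \<forall>n\<ge>N. \<forall>m\<ge>N. \<forall>a b. \<exists>w. pattern \<delta> (pair_mat u v) (f u v) (rect a b n m) w"
    unfolding pattern_def rect_props of_nat_mult
  proof (intro exI[of _ N] allI impI exI[of _ w] conjI)
    fix n m a b assume nm: "n \<ge> N" "m \<ge> N"
    show "w i \<in> S1" for i using uv by (simp add: w_def)
    define D where "D = (1/2) *\<^sub>R (tensor u u - tensor v v)"
    define \<sigma> where "\<sigma> = (\<lambda>x y :: int. if even (x + y) then 1 else - 1 :: real)"
    have "tensor (w (site x y)) (w (site x y)) = pair_mat u v + \<sigma> x y *\<^sub>R D" for x y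
      by (simp add: w_def \<sigma>_def pair_mat_def D_def mat2_eq_iff field_simps)
    then have "(\<Sum>i \<in> rect a b n m. tensor (w i) (w i)) - (real n * real m) *\<^sub>R pair_mat u v
      = (\<Sum>x \<in> {a..<a + int n}. \<Sum>y \<in> {b..<b + int m}. \<sigma> x y) *\<^sub>R D"
      by (simp add: sum_rect sum.distrib sum_constant_scaleR scaleR_sum_left del: sum_constant)
    moreover have "norm D \<le> 1"
      using norm_triangle_ineq4[of "tensor u u" "tensor v v"] uv norm_tensor_S1 by (simp add: D_def)
    moreover have "\<bar>\<Sum>x \<in> {a..<a + int n}. \<Sum>y \<in> {b..<b + int m}. \<sigma> x y\<bar> \<le> real n"
    proof -
      have "\<bar>\<Sum>y \<in> {b..<b + int m}. \<sigma> x y\<bar> \<le> 1" for x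
      proof -
        have *: "(\<Sum>y \<in> {b..<b + int m}. \<sigma> x y) = (\<sigma> x b - \<sigma> x (b + int m)) / 2"
          by (rule alternating_sum) (simp add: \<sigma>_def add.assoc[symmetric])
        show ?thesis unfolding * by (simp add: \<sigma>_def)
      qed
      then have "\<bar>\<Sum>x \<in> {a..<a + int n}. \<Sum>y \<in> {b..<b + int m}. \<sigma> x y\<bar> \<le> (\<Sum>x \<in> {a..<a + int n}. 1)"
        by (rule order.trans[OF sum_abs sum_mono])
      then show ?thesis by simp
    qed
    ultimately have "norm ((\<Sum>i \<in> rect a b n m. tensor (w i) (w i)) - (real n * real m) *\<^sub>R pair_mat u v) \<le> real n * 1"
      by (simp only: norm_scaleR) (intro mult_mono, auto)
    also have "\<dots> \<le> \<delta> * (real n * real m)"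
      using mult_left_mono[OF N(2)[OF nm(2)], of "real n"] by (simp add: mult_ac)
    finally show "norm ((\<Sum>i \<in> rect a b n m. tensor (w i) (w i)) - (real n * real m) *\<^sub>R pair_mat u v) \<le> \<delta> * (real n * real m)" .
    let ?B = "rect a b n m"
    have "energy f ?B w = (\<Sum>(i, \<xi>) \<in> inp ?B. f (w i) (w (i + \<xi>)))"
      unfolding energy_def by (rule sum_bonds[OF rect_props(2)])
    \<comment> \<open>Neighbours have opposite parity, so every bond joins u and v, in an order that
      the symmetry of f ignores.\<close>
    also have "\<dots> = (\<Sum>(i, \<xi>) \<in> inp ?B. f u v)"
    proof (rule sum.cong, simp, clarify)
      fix i \<xi> assume "(i, \<xi>) \<in> inp ?B"
      then obtain x y where i: "i = site x y" and "\<xi> \<in> nbs" by (auto simp: inp_def rect_def)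
      moreover have "\<lfloor>- 1 :: real\<rfloor> = - 1" by (rule floor_unique) auto
      ultimately show "f (w i) (w (i + \<xi>)) = f u v"
        using f_sym[OF uv] by (auto simp: nbs_eq w_def i site_add)
    qed
    also have "\<dots> = real (card (bonds ?B)) * f u v"
      by (simp add: bonds_eq_inp rect_props card_image inj_shift)
    also have "\<dots> = (4 * real (card ?B) - real (card (outp ?B))) * f u v"
      using card_bonds[of ?B] rect_props(1,2) by (metis add_diff_cancel_right' of_nat_add of_nat_mult of_nat_numeral)
    \<comment> \<open>The outgoing bonds are missing from the sum. Since f u v may be negative, each
      of them can cost up to C.\<close>
    also have "\<dots> \<le> 4 * (real n * real m) * f u v + C * (2 * (real n + real m))"
    proof -
      have "- f u v * real (card (outp ?B)) \<le> C * (2 * (real n + real m))"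
        using f_bdd[OF uv] C_nonneg by (intro mult_mono real_card_outp_rect) auto
      then show ?thesis by (simp add: rect_props algebra_simps)
    qed
    also have "\<dots> \<le> real n * real m * (4 * f u v + \<delta>)"
      using mult_left_mono[OF N(3)[OF nm(2)], of "real n"] mult_left_mono[OF N(3)[OF nm(1)], of "real m"]
      by (simp add: algebra_simps)
    finally show "energy f ?B w \<le> real n * real m * (4 * f u v + \<delta>)" .
  qed
qed

lemma pattern_perturb:
  assumes "pattern \<delta> X t B u" "norm (X - Y) \<le> \<eta>" "4 * (t - t') \<le> \<eta>"
  shows "pattern (\<delta> + \<eta>) Y t' B u"
proof -
  let ?T = "\<Sum>i \<in> B. tensor (u i) (u i)" and ?c = "real (card B)"
  have "?T - ?c *\<^sub>R Y = (?T - ?c *\<^sub>R X) + ?c *\<^sub>R (X - Y)" by (simp add: algebra_simps)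
  then have "norm (?T - ?c *\<^sub>R Y) \<le> norm (?T - ?c *\<^sub>R X) + norm (?c *\<^sub>R (X - Y))"
    by (simp only: norm_triangle_ineq)
  also have "\<dots> \<le> \<delta> * ?c + \<eta> * ?c"
  proof (rule add_mono)
    show "norm (?c *\<^sub>R (X - Y)) \<le> \<eta> * ?c" using mult_right_mono[OF assms(2), of ?c] by (simp add: mult.commute)
  qed (use assms in \<open>simp add: pattern_def\<close>)
  finally have "norm (?T - ?c *\<^sub>R Y) \<le> (\<delta> + \<eta>) * ?c" by (simp add: algebra_simps)
  moreover have "?c * (4 * t + \<delta>) \<le> ?c * (4 * t' + (\<delta> + \<eta>))"
    using assms(3) by (intro mult_left_mono) auto
  ultimately show ?thesis using assms(1) by (auto simp: pattern_def)
qed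

lemma rect_split: "n = n1 + n2 \<Longrightarrow> rect a b n m = rect a b n1 m \<union> rect (a + int n1) b n2 m"
  "rect a b n1 m \<inter> rect (a + int n1) b n2 m = {}"
proof -
  assume n: "n = n1 + n2"
  have "{a..<a + int n} = {a..<a + int n1} \<union> {a + int n1..<a + int n1 + int n2}" by (auto simp: n)
  then show "rect a b n m = rect a b n1 m \<union> rect (a + int n1) b n2 m"
    by (simp add: rect_def Sigma_Un_distrib1 image_Un)
qed (auto simp: rect_def)

text \<open>The two rectangles stand side by side. Rounding makes the first one too wide or too
  narrow by at most one column; k is this error, and it moves the sum of the tensors by at most |k|
  m times the norm of X1 - X2. The interfaces, counted through all bonds that leave either piece,
  cost at most C (4 m + 2 n), where n is the total width. The hypotheses keep each error below
  \<delta> n m.\<close>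

lemma pattern_union:
  fixes a b :: int and n1 n2 m :: nat
  defines "R1 \<equiv> rect a b n1 m" and "R2 \<equiv> rect (a + int n1) b n2 m"
  assumes p: "pattern \<delta> X1 t1 R1 u1" "pattern \<delta> X2 t2 R2 u2"
    and \<theta>: "\<bar>real n1 - s * (real n1 + real n2)\<bar> \<le> 1"
    and D: "norm (X1 - X2) \<le> \<delta> * (real n1 + real n2)"
    and E: "4 * \<bar>t1 - t2\<bar> + 4 * C \<le> \<delta> / 2 * (real n1 + real n2)" and m: "2 * C \<le> \<delta> / 2 * real m"
  shows "\<exists>u. pattern (2 * \<delta>) (s *\<^sub>R X1 + (1 - s) *\<^sub>R X2) (s * t1 + (1 - s) * t2) (R1 \<union> R2) u"
proof -
  define n where "n = real n1 + real n2"
  define k where "k = real n1 - s * n"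
  define M where "M = real m"
  have k: "\<bar>k\<bar> \<le> 1" using \<theta> by (simp add: k_def n_def)
  have n1: "real n1 = s * n + k" and n2: "real n2 = (1 - s) * n - k" by (simp_all add: k_def n_def algebra_simps)
  define u where "u = (\<lambda>i::vec2. if i \<in> R1 then u1 i else u2 i)"
  have disj: "R1 \<inter> R2 = {}" by (simp add: R1_def R2_def rect_split)
  have fin: "finite R1" "finite R2" and Z: "R1 \<union> R2 \<subseteq> Z2" using rect_props by (auto simp: R1_def R2_def)
  have card: "real (card R1) = real n1 * M" "real (card R2) = real n2 * M" "real (card (R1 \<union> R2)) = n * M"
    using rect_props disj fin by (simp_all add: R1_def R2_def M_def n_def card_Un_disjoint algebra_simps)
  have uS: "u i \<in> S1" for i using p by (simp add: u_def pattern_def)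
  let ?T = "\<lambda>u. tensor u u"
  let ?X = "s *\<^sub>R X1 + (1 - s) *\<^sub>R X2" and ?t = "s * t1 + (1 - s) * t2"
  have u12: "(\<Sum>i \<in> R1. ?T (u i)) = (\<Sum>i \<in> R1. ?T (u1 i))" "(\<Sum>i \<in> R2. ?T (u i)) = (\<Sum>i \<in> R2. ?T (u2 i))"
    using disj by (auto intro!: sum.cong simp: u_def)
  have "(\<Sum>i \<in> R1 \<union> R2. ?T (u i)) - (n * M) *\<^sub>R ?X
    = ((\<Sum>i \<in> R1. ?T (u1 i)) - (real n1 * M) *\<^sub>R X1) + ((\<Sum>i \<in> R2. ?T (u2 i)) - (real n2 * M) *\<^sub>R X2)
      + (M * k) *\<^sub>R (X1 - X2)"
    unfolding sum.union_disjoint[OF fin disj] u12 n1 n2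
    by (simp add: algebra_simps)
  then have "norm ((\<Sum>i \<in> R1 \<union> R2. ?T (u i)) - (n * M) *\<^sub>R ?X)
    \<le> norm ((\<Sum>i \<in> R1. ?T (u1 i)) - (real n1 * M) *\<^sub>R X1) + norm ((\<Sum>i \<in> R2. ?T (u2 i)) - (real n2 * M) *\<^sub>R X2)
      + norm ((M * k) *\<^sub>R (X1 - X2))"
    by (simp only:) (intro norm_triangle_le add_mono norm_triangle_ineq order_refl)
  also have "\<dots> \<le> \<delta> * (real n1 * M) + \<delta> * (real n2 * M) + M * (\<delta> * n)"
  proof (intro add_mono)
    have "\<bar>k\<bar> * norm (X1 - X2) \<le> 1 * (\<delta> * n)" using k D by (intro mult_mono) (auto simp: n_def)
    then have "M * (\<bar>k\<bar> * norm (X1 - X2)) \<le> M * (\<delta> * n)" by (intro mult_left_mono) (auto simp: M_def)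
    then show "norm ((M * k) *\<^sub>R (X1 - X2)) \<le> M * (\<delta> * n)" by (simp add: abs_mult M_def mult_ac)
  qed (use p card in \<open>auto simp: pattern_def\<close>)
  finally have 1: "norm ((\<Sum>i \<in> R1 \<union> R2. ?T (u i)) - (n * M) *\<^sub>R ?X) \<le> 2 * \<delta> * (n * M)"
    by (simp add: n_def algebra_simps)
  have "energy f (R1 \<union> R2) u \<le> (\<Sum>j \<in> UNIV. energy f (if j then R1 else R2) u)
    + C * ((\<Sum>j \<in> UNIV. card (outp (if j then R1 else R2))) + 4 * card (R1 \<union> R2 - (\<Union>j. if j then R1 else R2)))"
    using disj fin Z uS by (intro energy_glue) (auto simp: disjoint_family_on_def split: if_splits)
  also have "\<dots> = energy f R1 u1 + energy f R2 u2 + C * (real (card (outp R1)) + real (card (outp R2)))"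
  proof -
    have "energy f R1 u = energy f R1 u1" "energy f R2 u = energy f R2 u2"
      using disj by (auto intro!: energy_cong simp: u_def)
    moreover have "R1 \<union> R2 - (\<Union>j. if j then R1 else R2) = {}" by auto
    ultimately show ?thesis by (simp add: UNIV_bool Un_commute)
  qed
  also have "\<dots> \<le> real n1 * M * (4 * t1 + \<delta>) + real n2 * M * (4 * t2 + \<delta>) + C * (2 * (real n1 + M) + 2 * (real n2 + M))"
    unfolding R1_def R2_def M_def using C_nonneg
    by (intro add_mono mult_left_mono real_card_outp_rect)
      (use p card in \<open>simp_all only: pattern_def R1_def R2_def M_def\<close>)
  also have "\<dots> = n * M * (4 * ?t + \<delta>) + (4 * k * (t1 - t2) + 4 * C) * M + 2 * C * n"
    unfolding n1 n2 by (simp add: algebra_simps)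
  also have "\<dots> \<le> n * M * (4 * ?t + \<delta>) + (\<delta> / 2 * n) * M + (\<delta> / 2 * M) * n"
  proof (intro add_mono order_refl mult_right_mono)
    have "k * (t1 - t2) \<le> \<bar>k\<bar> * \<bar>t1 - t2\<bar>" by (metis abs_ge_self abs_mult)
    also have "\<dots> \<le> 1 * \<bar>t1 - t2\<bar>" using k by (intro mult_right_mono) auto
    finally show "4 * k * (t1 - t2) + 4 * C \<le> \<delta> / 2 * n" using E by (simp add: n_def)
  qed (use m in \<open>auto simp: M_def n_def\<close>)
  finally have "energy f (R1 \<union> R2) u \<le> (n * M) * (4 * ?t + 2 * \<delta>)" by (simp add: algebra_simps)
  with 1 show ?thesis using uS by (intro exI[of _ u]) (simp add: pattern_def card)
qed

text \<open>A large rectangle is cut by a vertical line in the ratio s : t, and each part receives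
  its own pattern.\<close>

lemma convex_achievable: "convex {p. achievable p}"
proof (rule convexI)
  fix p q :: "mat2 \<times> real" and s t :: real
  assume pq: "p \<in> {p. achievable p}" "q \<in> {p. achievable p}" and st: "0 \<le> s" "0 \<le> t" "s + t = 1"
  show "s *\<^sub>R p + t *\<^sub>R q \<in> {p. achievable p}"
  \<comment> \<open>A zero weight would deny one part the minimal width that its pattern
    needs.\<close>
  proof (cases "s = 0 \<or> t = 0")
    case True
    then show ?thesis using pq st by auto
  next
    case False
    then have pos: "0 < s" "0 < t" and t: "t = 1 - s" using st by auto
    have "\<exists>N. \<forall>n\<ge>N. \<forall>m\<ge>N. \<forall>a b. \<exists>u. pattern \<delta> (fst (s *\<^sub>R p + t *\<^sub>R q)) (snd (s *\<^sub>R p + t *\<^sub>R q)) (rect a b n m) u"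
      if "\<delta> > 0" for \<delta>
    proof -
      define \<delta>' where "\<delta>' = \<delta> / 2"
      have "\<delta>' > 0" using that by (simp add: \<delta>'_def)
      obtain N1 where N1: "\<And>n m a b. n \<ge> N1 \<Longrightarrow> m \<ge> N1 \<Longrightarrow> \<exists>u. pattern \<delta>' (fst p) (snd p) (rect a b n m) u"
        using pq(1) \<open>\<delta>' > 0\<close> unfolding mem_Collect_eq achievable_def by meson
      obtain N2 where N2: "\<And>n m a b. n \<ge> N2 \<Longrightarrow> m \<ge> N2 \<Longrightarrow> \<exists>u. pattern \<delta>' (fst q) (snd q) (rect a b n m) u"
        using pq(2) \<open>\<delta>' > 0\<close> unfolding mem_Collect_eq achievable_def by meson
      \<comment> \<open>Largeness of a side length, imposed on both sides. The 1 next to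
        \<open>N1\<close> pays for rounding \<open>s * real n\<close> down.\<close>
      define L where "L = (\<lambda>n::nat. real N1 + 1 \<le> s * real n \<and> real N2 \<le> t * real n \<and> N1 + N2 \<le> n \<and>
        norm (fst p - fst q) \<le> \<delta>' * real n \<and> 4 * \<bar>snd p - snd q\<bar> + 4 * C \<le> \<delta>' / 2 * real n)"
      have lin: "\<forall>\<^sub>F n in sequentially. c \<le> d * real n" if "d > 0" for c d :: real
      proof -
        have "\<forall>\<^sub>F n in sequentially. c / d \<le> real n" using filterlim_real_sequentially by (simp add: filterlim_at_top)
        then show ?thesis by eventually_elim (use that in \<open>simp add: field_simps\<close>)
      qed
      have "\<forall>\<^sub>F n in sequentially. L n"
        unfolding L_def using pos \<open>\<delta>' > 0\<close> by (intro eventually_conj lin eventually_ge_at_top) auto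
      then obtain N where N: "\<And>n. n \<ge> N \<Longrightarrow> L n" by (auto simp: eventually_sequentially)
      have "\<exists>u. pattern \<delta> (fst (s *\<^sub>R p + t *\<^sub>R q)) (snd (s *\<^sub>R p + t *\<^sub>R q)) (rect a b n m) u"
        if nm: "n \<ge> N" "m \<ge> N" for n m a b
      proof -
        define n1 where "n1 = nat \<lfloor>s * real n\<rfloor>"
        have n1: "real n1 \<le> s * real n" "s * real n < real n1 + 1" using pos by (auto simp: n1_def)
        moreover have "s * real n \<le> 1 * real n" using t pos by (intro mult_right_mono) auto
        ultimately have "n1 \<le> n" by linarith
        define n2 where "n2 = n - n1"
        have n: "n = n1 + n2" using \<open>n1 \<le> n\<close> by (simp add: n2_def)
        have L: "L n" "L m" using N nm by auto
        have "n1 \<ge> N1" using L(1) n1 unfolding L_def by linarith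
        have "t * real n = real n - s * real n" by (simp add: t algebra_simps)
        then have "t * real n \<le> real n2" using n1(1) n by linarith
        then have "n2 \<ge> N2" using L(1) unfolding L_def by linarith
        have "m \<ge> N1" "m \<ge> N2" using L(2) by (auto simp: L_def)
        obtain u1 where u1: "pattern \<delta>' (fst p) (snd p) (rect a b n1 m) u1" using N1 \<open>n1 \<ge> N1\<close> \<open>m \<ge> N1\<close> by blast
        obtain u2 where u2: "pattern \<delta>' (fst q) (snd q) (rect (a + int n1) b n2 m) u2" using N2 \<open>n2 \<ge> N2\<close> \<open>m \<ge> N2\<close> by blast
        have "\<exists>u. pattern (2 * \<delta>') (s *\<^sub>R fst p + (1 - s) *\<^sub>R fst q) (s * snd p + (1 - s) * snd q)
          (rect a b n1 m \<union> rect (a + int n1) b n2 m) u"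
        proof (rule pattern_union[OF u1 u2])
          show "\<bar>real n1 - s * (real n1 + real n2)\<bar> \<le> 1" using n1 n by (simp add: abs_le_iff)
          have "4 * \<bar>snd p - snd q\<bar> + 4 * C \<le> \<delta>' / 2 * real m" using L(2) by (simp only: L_def)
          moreover have "2 * C \<le> 4 * \<bar>snd p - snd q\<bar> + 4 * C" using C_nonneg by simp
          ultimately show "2 * C \<le> \<delta>' / 2 * real m" by (rule order_trans[rotated])
        qed (use L(1) n in \<open>auto simp: L_def\<close>)
        then show ?thesis by (simp add: rect_split(1)[OF n] \<delta>'_def t)
      qed
      then show ?thesis by blast
    qed
    then show ?thesis by (simp add: achievable_def)
  qed
qed

text \<open>The achievable pairs form a convex set that contains \<open>graph_pts\<close>, hence its
  convex hull, and \<open>env_approx\<close> provides a point of the hull close enough to be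
  perturbed. The tolerance \<delta>/8 becomes \<delta>/2 through the factor 4 in the energy.\<close>

lemma achievable_env:
  assumes X: "X \<in> K_set" shows "achievable (X, env f X)"
  unfolding achievable_def fst_conv snd_conv
proof (intro allI impI)
  fix \<delta> :: real assume "\<delta> > 0"
  then obtain Y r where Y: "(Y, r) \<in> convex hull (graph_pts f)" "dist Y X < \<delta> / 8" "r < env f X + \<delta> / 8"
    using env_approx[OF X, of "\<delta> / 8"] by auto
  have "graph_pts f \<subseteq> {p. achievable p}" by (auto simp: graph_pts_def achievable_checkerboard)
  then have "convex hull (graph_pts f) \<subseteq> {p. achievable p}" using convex_achievable by (rule hull_minimal)
  then have "achievable (Y, r)" using Y(1) by blast
  then obtain N where N: "\<And>n m a b. n \<ge> N \<Longrightarrow> m \<ge> N \<Longrightarrow> \<exists>u. pattern (\<delta>/2) Y r (rect a b n m) u"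
    using \<open>\<delta> > 0\<close> unfolding achievable_def by (metis fst_conv half_gt_zero snd_conv)
  have "pattern \<delta> X (env f X) B u" if "pattern (\<delta>/2) Y r B u" for B u
    using pattern_perturb[OF that, of X "\<delta>/2" "env f X"] Y \<open>\<delta> > 0\<close> by (simp add: dist_norm)
  then show "\<exists>N. \<forall>n\<ge>N. \<forall>m\<ge>N. \<forall>a b. \<exists>u. pattern \<delta> X (env f X) (rect a b n m) u"
    using N by blast
qed

text \<open>The size of the rectangle can be chosen uniformly in \<open>X\<close> although \<^const>\<open>env\<close> may be discontinuous:
  the graph of \<^const>\<open>env\<close> is totally bounded.\<close>

lemma uniform_patterns:
  assumes "\<delta> > 0"
  shows "\<exists>N. \<forall>X \<in> K_set. \<forall>n\<ge>N. \<forall>m\<ge>N. \<forall>a b. \<exists>u. pattern \<delta> X (env f X) (rect a b n m) u"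
proof -
  define G where "G = (\<lambda>X. (X, env f X)) ` K_set"
  have "norm p \<le> 1 + C" if "p \<in> G" for p
    using that norm_K_le_1 env_bounds by (auto simp: G_def intro!: order.trans[OF norm_Pair_le] add_mono)
  then have "bounded G" unfolding bounded_iff by blast
  then have "compact (closure G)" by simp
  \<comment> \<open>The balls are centred on the graph itself, where patterns are available;
    finitely many cover its closure.\<close>
  moreover have "closure G \<subseteq> (\<Union>q \<in> G. ball q (\<delta> / 8))"
  proof
    fix p assume "p \<in> closure G"
    then obtain q where "q \<in> G" "dist q p < \<delta> / 8" using assms unfolding closure_approachable by (meson divide_pos_pos zero_less_numeral)
    then show "p \<in> (\<Union>q \<in> G. ball q (\<delta> / 8))" by auto
  qed
  ultimately obtain D where D: "D \<subseteq> G" "finite D" "closure G \<subseteq> (\<Union>q \<in> D. ball q (\<delta> / 8))"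
    using compactE_image[of "closure G" G "\<lambda>q. ball q (\<delta> / 8)"] by (metis open_ball)
  have "\<exists>N. \<forall>n\<ge>N. \<forall>m\<ge>N. \<forall>a b. \<exists>u. pattern (\<delta>/2) (fst q) (snd q) (rect a b n m) u" if "q \<in> D" for q
    using that D(1) achievable_env assms by (auto simp: G_def achievable_def)
  then obtain N where N: "\<And>q n m a b. q \<in> D \<Longrightarrow> n \<ge> N q \<Longrightarrow> m \<ge> N q \<Longrightarrow> \<exists>u. pattern (\<delta>/2) (fst q) (snd q) (rect a b n m) u"
    by metis
  define N0 where "N0 = Max (insert 0 (N ` D))"
  have N0: "N q \<le> N0" if "q \<in> D" for q using that D(2) by (simp add: N0_def)
  have "\<exists>u. pattern \<delta> X (env f X) (rect a b n m) u" if X: "X \<in> K_set" and nm: "n \<ge> N0" "m \<ge> N0" for X n m a b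
  proof -
    have "(X, env f X) \<in> closure G" using X by (intro subsetD[OF closure_subset]) (simp add: G_def)
    then obtain q where q: "q \<in> D" "dist q (X, env f X) < \<delta> / 8" using D(3) by auto
    then obtain u where u: "pattern (\<delta>/2) (fst q) (snd q) (rect a b n m) u" using N N0 nm by (meson order_trans)
    have "dist (fst q) X < \<delta>/8" "dist (snd q) (env f X) < \<delta>/8"
      using q(2) dist_fst_le[of q "(X, env f X)"] dist_snd_le[of q "(X, env f X)"] by auto
    then have "norm (fst q - X) \<le> \<delta>/2" "4 * (snd q - env f X) \<le> \<delta>/2"
      using assms abs_ge_self[of "snd q - env f X"] unfolding dist_norm real_norm_def by argo+
    \<comment> \<open>A pattern made for the centre of a ball serves every graph point in it, at the
      price \<delta>/2.\<close>
    then have "pattern (\<delta>/2 + \<delta>/2) X (env f X) (rect a b n m) u" by (rule pattern_perturb[OF u])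
    then show ?thesis by auto
  qed
  then show ?thesis by blast
qed

end

section \<open>The homogenized density\<close>

lemma tendsto_ereal_sandwich:
  fixes l :: real
  assumes "\<And>e. e > 0 \<Longrightarrow> \<forall>\<^sub>F x in F. ereal (l - e) \<le> g x"
    and "\<And>e. e > 0 \<Longrightarrow> \<forall>\<^sub>F x in F. g x \<le> ereal (l + e)"
  shows "(g \<longlongrightarrow> ereal l) F"
proof (rule order_tendstoI)
  fix y assume "y < ereal l"
  then obtain z where z: "y < ereal z" "z < l" using ereal_dense2 by (metis less_ereal.simps(1))
  have "\<forall>\<^sub>F x in F. ereal z \<le> g x" using assms(1)[of "l - z"] z by simp
  then show "\<forall>\<^sub>F x in F. y < g x" by eventually_elim (rule less_le_trans[OF z(1)])
next
  fix y assume "ereal l < y"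
  then obtain z where z: "ereal z < y" "l < z" using ereal_dense2 by (metis less_ereal.simps(1))
  have "\<forall>\<^sub>F x in F. g x \<le> ereal z" using assms(2)[of "z - l"] z by simp
  then show "\<forall>\<^sub>F x in F. g x < y" by eventually_elim (rule le_less_trans[OF _ z(1)])
qed

text \<open>The integers in the half-open interval [-h/2, h/2) run from \<lceil>-h/2\<rceil> to
  \<lceil>h/2\<rceil> - 1.\<close>

definition cube_lo :: "real \<Rightarrow> int" where "cube_lo h = \<lceil>- h / 2\<rceil>"
definition cube_n :: "real \<Rightarrow> nat" where "cube_n h = nat (\<lceil>h / 2\<rceil> - \<lceil>- h / 2\<rceil>)"

lemma cube_sites_rect:
  assumes "h > 0" shows "cube_sites h = rect (cube_lo h) (cube_lo h) (cube_n h) (cube_n h)"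
proof -
  have n: "cube_lo h + int (cube_n h) = \<lceil>h / 2\<rceil>"
    using assms ceiling_mono[of "- h / 2" "h / 2"] by (simp add: cube_lo_def cube_n_def)
  have "x \<in> (\<lambda>x. h *\<^sub>R x) ` W \<longleftrightarrow> (\<forall>k. - h / 2 \<le> x$k \<and> x$k < h / 2)" for x
  proof
    assume "\<forall>k. - h / 2 \<le> x$k \<and> x$k < h / 2"
    then have "(1 / h) *\<^sub>R x \<in> W" using assms by (auto simp: W_def field_simps)
    then show "x \<in> (\<lambda>x. h *\<^sub>R x) ` W" using assms by (auto intro!: rev_image_eqI)
  next
    assume "x \<in> (\<lambda>x. h *\<^sub>R x) ` W"
    then obtain y where "y \<in> W" "x = h *\<^sub>R y" by auto
    then have "h * (- 1/2) \<le> h * y$k" "h * y$k < h * (1/2)" for k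
      using mult_left_mono[of "- 1/2" "y$k" h] mult_strict_left_mono[of "y$k" "1/2" h] assms
      by (auto simp: W_def)
    then show "\<forall>k. - h / 2 \<le> x$k \<and> x$k < h / 2" by (simp add: \<open>x = h *\<^sub>R y\<close>)
  qed
  then have "site x y \<in> cube_sites h \<longleftrightarrow> site x y \<in> rect (cube_lo h) (cube_lo h) (cube_n h) (cube_n h)" for x y
    by (auto simp: cube_sites_def forall_2 n) (auto simp: cube_lo_def ceiling_le_iff less_ceiling_iff)
  moreover have "cube_sites h \<subseteq> Z2" by (auto simp: cube_sites_def)
  moreover have "i \<in> cube_sites h \<longleftrightarrow> i \<in> R" if "cube_sites h \<subseteq> Z2" "R \<subseteq> Z2"
      "\<And>x y. site x y \<in> cube_sites h \<longleftrightarrow> site x y \<in> R" for R i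
    using that Z2_site[of i] by (metis subsetD)
  ultimately show ?thesis using rect_props(2) by blast
qed

lemma cube_n_bounds: "h > 0 \<Longrightarrow> \<bar>real (cube_n h) - h\<bar> \<le> 1"
  using ceiling_mono[of "- h / 2" "h / 2"] unfolding cube_n_def by (simp add: abs_le_iff) linarith

lemma cube_n_ratio: "((\<lambda>h. real (cube_n h) / h) \<longlongrightarrow> 1) at_top"
proof -
  have "((\<lambda>h::real. 1 / h) \<longlongrightarrow> 0) at_top" using tendsto_inverse_0_at_top[OF filterlim_ident] by (simp add: inverse_eq_divide)
  moreover have "\<forall>\<^sub>F h in at_top. norm (real (cube_n h) / h - 1) \<le> 1 / h"
    using eventually_gt_at_top[of 0]
  proof eventually_elim
    case (elim h)
    have "real (cube_n h) / h - 1 = (real (cube_n h) - h) / h" using elim by (simp add: field_simps)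
    then show ?case using elim cube_n_bounds[OF elim] by (simp add: divide_right_mono)
  qed
  ultimately have "((\<lambda>h. real (cube_n h) / h - 1) \<longlongrightarrow> 0) at_top" by (rule Lim_null_comparison[rotated])
  then show ?thesis using tendsto_add[OF _ tendsto_const[of 1]] by fastforce
qed

lemma cube_n_at_top: "filterlim cube_n at_top at_top"
  unfolding filterlim_at_top
proof
  fix N :: nat
  show "\<forall>\<^sub>F h in at_top. N \<le> cube_n h"
    using eventually_ge_at_top[of "real N + 1"]
  proof eventually_elim
    case (elim h)
    then show ?case using cube_n_bounds[of h] by linarith
  qed
qed

lemma cube_energy_eq:
  assumes "h > 0"
  shows "cube_energy f Q \<rho> h = ereal (1 / h\<^sup>2) *
    (INF u \<in> {u. (\<forall>\<beta> \<in> cube_sites h. u \<beta> \<in> S1) \<and> cube_average h u \<in> cball Q \<rho>}. ereal (energy f (cube_sites h) u))"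
proof -
  have Z: "cube_sites h \<subseteq> Z2" and fin: "finite (cube_sites h)" using cube_sites_rect[OF assms] rect_props by auto
  have "(\<Sum>\<xi> \<in> {\<xi> \<in> Z2. norm \<xi> = 1}. \<Sum>\<beta> \<in> {\<beta> \<in> cube_sites h. \<beta> + \<xi> \<in> cube_sites h}. f (u \<beta>) (u (\<beta> + \<xi>)))
    = energy f (cube_sites h) u" for u
  proof -
    have "(\<Sum>\<xi> \<in> nbs. \<Sum>\<beta> \<in> {\<beta> \<in> cube_sites h. \<beta> + \<xi> \<in> cube_sites h}. f (u \<beta>) (u (\<beta> + \<xi>)))
      = (\<Sum>(\<xi>, \<beta>) \<in> (SIGMA \<xi>:nbs. {\<beta> \<in> cube_sites h. \<beta> + \<xi> \<in> cube_sites h}). f (u \<beta>) (u (\<beta> + \<xi>)))"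
      using finite_nbs fin by (intro sum.Sigma) auto
    also have "\<dots> = (\<Sum>(\<beta>, \<xi>) \<in> inp (cube_sites h). f (u \<beta>) (u (\<beta> + \<xi>)))"
      by (rule sum.reindex_bij_witness[of _ prod.swap prod.swap]) (auto simp: inp_def)
    finally show ?thesis using sum_bonds[OF Z, of "\<lambda>i j. f (u i) (u j)"] by (simp add: energy_def nbs_def)
  qed
  then show ?thesis by (simp add: cube_energy_def)
qed

section \<open>Limits of the cube energies\<close>

context spin_interaction begin

text \<open>A quarter of the limit in h of the cube energy at fixed \<rho>.\<close>

definition env_min :: "mat2 \<Rightarrow> real \<Rightarrow> real" where
  "env_min Q \<rho> = (INF Y \<in> K_set \<inter> cball Q \<rho>. env f Y)"

lemma env_convex:
  assumes "X \<in> K_set" "Y \<in> K_set" "0 \<le> s" "s \<le> 1"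
  shows "env f ((1 - s) *\<^sub>R X + s *\<^sub>R Y) \<le> (1 - s) * env f X + s * env f Y"
proof (rule env_le)
  fix a M assume "(a, M) \<in> affs f"
  then have "(1 - s) * (a + M \<bullet> X) + s * (a + M \<bullet> Y) \<le> (1 - s) * env f X + s * env f Y"
    using assms affs_le_env by (intro add_mono mult_left_mono) auto
  then show "a + M \<bullet> ((1 - s) *\<^sub>R X + s *\<^sub>R Y) \<le> (1 - s) * env f X + s * env f Y"
    by (simp add: inner_add_right algebra_simps)
qed

lemma bdd_env: "bdd_below (env f ` (K_set \<inter> S))"
proof (rule bdd_belowI2)
  show "- C \<le> env f Y" if "Y \<in> K_set \<inter> S" for Y using env_bounds[of Y] that by (simp add: abs_le_iff)
qed

lemma mean_tensor_in_K:
  assumes "finite B" "B \<noteq> {}" "\<And>i. i \<in> B \<Longrightarrow> u i \<in> S1"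
  shows "(1 / real (card B)) *\<^sub>R (\<Sum>i \<in> B. tensor (u i) (u i)) \<in> K_set"
proof -
  have "(\<Sum>i \<in> B. (1 / real (card B)) *\<^sub>R tensor (u i) (u i)) \<in> K_set"
    using assms tensor_in_K by (intro convex_sum convex_K) auto
  then show ?thesis by (simp only: scaleR_sum_right)
qed

text \<open>A good minorant depends on the average of u, which varies with u. Compactness of
  \<open>K_set \<inter> cball Q \<rho>\<close> leaves finitely many minorants to choose from, so the
  boundary error 4 S n has one constant S for all u and vanishes after division by the square of
  h.\<close>

lemma cube_energy_lower:
  assumes Q: "Q \<in> K_set" and "\<rho> > 0" "e > 0"
  shows "\<forall>\<^sub>F h in at_top. ereal (4 * env_min Q \<rho> - e) \<le> cube_energy f Q \<rho> h"
proof -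
  \<comment> \<open>After the factor 4 this spends e/2; the other e/2 pays for the boundary and for
    comparing the number of sites with the square of h.\<close>
  define t where "t = env_min Q \<rho> - e / 8"
  have "\<exists>p \<in> affs f. t < fst p + snd p \<bullet> Y" if "Y \<in> K_set \<inter> cball Q \<rho>" for Y
  proof -
    have "t < env f Y" using cINF_lower[OF bdd_env that] \<open>e > 0\<close> by (simp add: t_def env_min_def)
    then show ?thesis using less_env_iff that by fastforce
  qed
  then have cover: "K_set \<inter> cball Q \<rho> \<subseteq> (\<Union>p \<in> affs f. {Y. t < fst p + snd p \<bullet> Y})" by blast
  have comp: "compact (K_set \<inter> cball Q \<rho>)" by (intro compact_Int compact_K compact_cball)
  have op: "open {Y. t < fst p + snd p \<bullet> Y}" for p :: "real \<times> mat2"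
    by (intro open_Collect_less continuous_intros)
  from compactE_image[OF comp op cover] obtain D where D: "D \<subseteq> affs f" "finite D" "K_set \<inter> cball Q \<rho> \<subseteq> (\<Union>p \<in> D. {Y. t < fst p + snd p \<bullet> Y})"
    by blast
  define S where "S = (\<Sum>p \<in> D. \<bar>fst p\<bar> + norm (snd p))"
  have S: "\<bar>fst p + snd p \<bullet> tensor u u\<bar> \<le> S" if "p \<in> D" "u \<in> S1" for p u
  proof -
    have "\<bar>snd p \<bullet> tensor u u\<bar> \<le> norm (snd p)"
      using Cauchy_Schwarz_ineq2[of "snd p" "tensor u u"] that norm_tensor_S1 by simp
    then have "\<bar>fst p + snd p \<bullet> tensor u u\<bar> \<le> \<bar>fst p\<bar> + norm (snd p)" by linarith
    also have "\<dots> \<le> S" unfolding S_def using that D(2) by (intro member_le_sum) auto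
    finally show ?thesis .
  qed
  have S0: "0 \<le> S" unfolding S_def by (intro sum_nonneg) auto
  have "((\<lambda>h. 4 * t * (real (cube_n h) / h)\<^sup>2 - 4 * S * (real (cube_n h) / h) * (1 / h)) \<longlongrightarrow> 4 * t * 1\<^sup>2 - 4 * S * 1 * 0) at_top"
    using tendsto_inverse_0_at_top[OF filterlim_ident]
    by (intro tendsto_intros cube_n_ratio) (simp add: inverse_eq_divide)
  then have "\<forall>\<^sub>F h in at_top. 4 * t - e / 2 < 4 * t * (real (cube_n h) / h)\<^sup>2 - 4 * S * (real (cube_n h) / h) * (1 / h)"
    using \<open>e > 0\<close> by (intro order_tendstoD(1)) auto
  moreover have "\<forall>\<^sub>F h in at_top. 1 \<le> cube_n h"
    using cube_n_at_top unfolding filterlim_at_top by blast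
  ultimately show ?thesis using eventually_gt_at_top[of 0]
  proof eventually_elim
    case (elim h)
    let ?B = "cube_sites h" and ?n = "real (cube_n h)"
    note R = cube_sites_rect[OF elim(3)]
    have card: "real (card ?B) = ?n * ?n" and fin: "finite ?B" and Z: "?B \<subseteq> Z2" using rect_props by (simp_all add: R)
    have "ereal ((4 * env_min Q \<rho> - e) * h\<^sup>2) \<le>
      (INF u \<in> {u. (\<forall>\<beta> \<in> ?B. u \<beta> \<in> S1) \<and> cube_average h u \<in> cball Q \<rho>}. ereal (energy f ?B u))"
    proof (rule INF_greatest, clarify)
      fix u assume u: "\<forall>\<beta> \<in> ?B. u \<beta> \<in> S1" and avg: "cube_average h u \<in> cball Q \<rho>"
      have "?B \<noteq> {}" using card elim(2) by auto
      then have "cube_average h u \<in> K_set" unfolding cube_average_def using u fin by (intro mean_tensor_in_K) auto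
      then obtain p where p: "p \<in> D" "t < fst p + snd p \<bullet> cube_average h u" using D(3) avg by auto
      \<comment> \<open>The minorant is the same at all sites, so its oscillation w is 0.\<close>
      have "4 * (\<Sum>i \<in> ?B. fst p + snd p \<bullet> tensor (u i) (u i)) - S * card (outp ?B) - 2 * 0 * real (card ?B) \<le> energy f ?B u"
        using u p D(1) S by (intro energy_lower fin Z) auto
      moreover have "(\<Sum>i \<in> ?B. fst p + snd p \<bullet> tensor (u i) (u i)) = ?n * ?n * (fst p + snd p \<bullet> cube_average h u)"
      proof -
        have "?n * ?n \<noteq> 0" using elim(2) by auto
        then show ?thesis
          by (simp add: cube_average_def sum.distrib card inner_sum_right algebra_simps)
      qed
      moreover have "?n * ?n * t \<le> ?n * ?n * (fst p + snd p \<bullet> cube_average h u)"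
        using p(2) by (intro mult_left_mono) auto
      moreover have "S * card (outp ?B) \<le> S * (4 * ?n)"
        using real_card_outp_rect[of "cube_lo h" "cube_lo h" "cube_n h" "cube_n h"] S0 by (intro mult_left_mono) (auto simp: R)
      ultimately have "4 * (?n * ?n * t) - S * (4 * ?n) \<le> energy f ?B u" by linarith
      moreover have "(4 * env_min Q \<rho> - e) * h\<^sup>2 \<le> 4 * (?n * ?n * t) - S * (4 * ?n)"
      proof -
        have "(4 * t - e / 2) * h\<^sup>2 \<le> (4 * t * (?n / h)\<^sup>2 - 4 * S * (?n / h) * (1 / h)) * h\<^sup>2"
          using elim(1) by (intro mult_right_mono) auto
        also have "\<dots> = 4 * (?n * ?n * t) - S * (4 * ?n)"
          using elim(3) by (simp add: field_simps power2_eq_square)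
        finally show ?thesis by (simp add: t_def)
      qed
      ultimately show "ereal ((4 * env_min Q \<rho> - e) * h\<^sup>2) \<le> ereal (energy f ?B u)" by simp
    qed
    then have "ereal (1 / h\<^sup>2) * ereal ((4 * env_min Q \<rho> - e) * h\<^sup>2) \<le> cube_energy f Q \<rho> h"
      unfolding cube_energy_eq[OF elim(3)] by (intro ereal_mult_left_mono) auto
    then show ?case using elim(3) by simp
  qed
qed

text \<open>An almost minimising Y may lie on the boundary of the ball, while a pattern meets its
  mean only approximately. Moving Y by the fraction s towards Q leaves the margin
  \<open>s * \<rho>\<close> for that error, and convexity of \<open>env\<close> bounds the cost by
  \<open>2 * C * s\<close>.\<close>

lemma cube_energy_upper:
  assumes Q: "Q \<in> K_set" and "\<rho> > 0" "e > 0"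
  shows "\<forall>\<^sub>F h in at_top. cube_energy f Q \<rho> h \<le> ereal (4 * env_min Q \<rho> + e)"
proof -
  have "Q \<in> K_set \<inter> cball Q \<rho>" using Q \<open>\<rho> > 0\<close> by simp
  then obtain Y where Y: "Y \<in> K_set \<inter> cball Q \<rho>" "env f Y < env_min Q \<rho> + e / 16"
    using cInf_lessD[of "env f ` (K_set \<inter> cball Q \<rho>)" "env_min Q \<rho> + e / 16"] \<open>e > 0\<close> unfolding env_min_def
    by (metis (no_types, lifting) empty_iff image_iff less_add_same_cancel1 zero_less_divide_iff zero_less_numeral)
  define s where "s = min 1 (e / (32 * (C + 1)))"
  have s: "0 < s" "s \<le> 1" "2 * C * s \<le> e / 16"
  proof -
    show "0 < s" "s \<le> 1" using \<open>e > 0\<close> C_nonneg by (auto simp: s_def)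
    have "(C + 1) * s \<le> (C + 1) * (e / (32 * (C + 1)))" using C_nonneg by (intro mult_left_mono) (auto simp: s_def)
    also have "\<dots> = e / 32" using C_nonneg by (simp add: divide_simps)
    finally have "(C + 1) * s \<le> e / 32" .
    then show "2 * C * s \<le> e / 16" using \<open>0 < s\<close> by (simp add: algebra_simps)
  qed
  define X where "X = (1 - s) *\<^sub>R Y + s *\<^sub>R Q"
  have X: "X \<in> K_set" unfolding X_def using convexD[OF convex_K, of Y Q "1 - s" s] Y Q s by simp
  have "env f X \<le> (1 - s) * env f Y + s * env f Q" unfolding X_def using Y Q s by (intro env_convex) auto
  also have "\<dots> = env f Y + s * (env f Q - env f Y)" by (simp add: algebra_simps)
  also have "s * (env f Q - env f Y) \<le> s * (2 * C)"
    using s env_bounds[OF Q] env_bounds[of Y] Y by (intro mult_left_mono) (auto simp: abs_le_iff)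
  finally have envX: "env f X < env_min Q \<rho> + e / 8" using Y(2) s(3) by (simp add: mult_ac)
  have "X - Q = (1 - s) *\<^sub>R (Y - Q)" by (simp add: X_def algebra_simps)
  then have "norm (X - Q) = (1 - s) * norm (Y - Q)" using s by simp
  also have "\<dots> \<le> (1 - s) * \<rho>" using Y s by (intro mult_left_mono) (auto simp: dist_norm norm_minus_commute)
  finally have XQ: "norm (X - Q) \<le> \<rho> - s * \<rho>" by (simp add: algebra_simps)
  define \<delta> where "\<delta> = min (s * \<rho>) (e / 8)"
  have "\<delta> > 0" using s \<open>\<rho> > 0\<close> \<open>e > 0\<close> by (simp add: \<delta>_def)
  then obtain N where N: "\<And>n m a b. n \<ge> N \<Longrightarrow> m \<ge> N \<Longrightarrow> \<exists>u. pattern \<delta> X (env f X) (rect a b n m) u"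
    using achievable_env[OF X] unfolding achievable_def fst_conv snd_conv by meson
  let ?c = "4 * env f X + \<delta>"
  have "((\<lambda>h. (real (cube_n h) / h)\<^sup>2 * ?c) \<longlongrightarrow> 1\<^sup>2 * ?c) at_top"
    by (intro tendsto_intros cube_n_ratio)
  then have "\<forall>\<^sub>F h in at_top. (real (cube_n h) / h)\<^sup>2 * ?c < ?c + e / 4"
    using \<open>e > 0\<close> by (intro order_tendstoD(2)) auto
  moreover have "\<forall>\<^sub>F h in at_top. max 1 N \<le> cube_n h"
    using cube_n_at_top unfolding filterlim_at_top by blast
  ultimately show ?thesis using eventually_gt_at_top[of 0]
  proof eventually_elim
    case (elim h)
    let ?B = "cube_sites h" and ?n = "real (cube_n h)"
    note R = cube_sites_rect[OF elim(3)]
    have card: "real (card ?B) = ?n * ?n" using rect_props by (simp_all add: R)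
    have n0: "?n * ?n > 0" using elim(2) by auto
    obtain u where u: "pattern \<delta> X (env f X) ?B u" using N[of "cube_n h" "cube_n h"] elim(2) unfolding R by auto
    have "norm (cube_average h u - X) \<le> \<delta>"
    proof -
      let ?T = "\<Sum>i \<in> ?B. tensor (u i) (u i)"
      have "cube_average h u - X = (1 / (?n * ?n)) *\<^sub>R (?T - (?n * ?n) *\<^sub>R X)"
        using n0 by (auto simp: cube_average_def card scaleR_diff_right)
      then have "norm (cube_average h u - X) = (1 / (?n * ?n)) * norm (?T - (?n * ?n) *\<^sub>R X)" using n0 by simp
      also have "\<dots> \<le> (1 / (?n * ?n)) * (\<delta> * (?n * ?n))"
        using u card by (intro mult_left_mono) (auto simp: pattern_def)
      also have "\<dots> = \<delta>" using n0 by auto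
      finally show ?thesis .
    qed
    then have "norm (cube_average h u - Q) \<le> \<rho>"
      using XQ norm_triangle_ineq[of "cube_average h u - X" "X - Q"] by (simp add: \<delta>_def)
    then have "u \<in> {u. (\<forall>\<beta> \<in> ?B. u \<beta> \<in> S1) \<and> cube_average h u \<in> cball Q \<rho>}"
      using u by (auto simp: pattern_def dist_norm norm_minus_commute)
    then have "cube_energy f Q \<rho> h \<le> ereal (1 / h\<^sup>2) * ereal (energy f ?B u)"
      unfolding cube_energy_eq[OF elim(3)] by (intro ereal_mult_left_mono INF_lower) auto
    also have "\<dots> = ereal (1 / h\<^sup>2 * energy f ?B u)" by simp
    also have "1 / h\<^sup>2 * energy f ?B u \<le> 1 / h\<^sup>2 * ((?n * ?n) * ?c)"
      using u card by (intro mult_left_mono) (auto simp: pattern_def)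
    also have "\<dots> = (?n / h)\<^sup>2 * ?c" by (simp add: power2_eq_square)
    also have "\<dots> \<le> ?c + e / 4" using elim(1) by simp
    also have "\<dots> \<le> 4 * env_min Q \<rho> + e" using envX \<open>e > 0\<close> by (simp add: \<delta>_def)
    finally show ?case by simp
  qed
qed

lemma cube_energy_tendsto:
  assumes "Q \<in> K_set" "\<rho> > 0" shows "(cube_energy f Q \<rho> \<longlongrightarrow> ereal (4 * env_min Q \<rho>)) at_top"
  using cube_energy_lower cube_energy_upper assms by (intro tendsto_ereal_sandwich) auto

lemma fhom_rho_eq: "Q \<in> K_set \<Longrightarrow> \<rho> > 0 \<Longrightarrow> fhom_rho f Q \<rho> = ereal (4 * env_min Q \<rho>)"
  unfolding fhom_rho_def using cube_energy_tendsto by (intro tendsto_Lim) auto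

text \<open>Q itself competes, which bounds the infimum from above. From below, a minorant almost
  optimal at Q loses at most \<open>norm M * \<rho>\<close> on the ball.\<close>

lemma env_min_tendsto:
  assumes Q: "Q \<in> K_set" shows "(env_min Q \<longlongrightarrow> env f Q) (at_right 0)"
proof (rule order_tendstoI)
  fix y assume "env f Q < y"
  moreover have "env_min Q \<rho> \<le> env f Q" if "\<rho> > 0" for \<rho>
    unfolding env_min_def using Q that by (intro cINF_lower bdd_env) auto
  ultimately show "\<forall>\<^sub>F \<rho> in at_right 0. env_min Q \<rho> < y"
    by (auto simp: eventually_at_filter intro!: always_eventually) (meson le_less_trans)
next
  fix y assume "y < env f Q"
  then obtain a M where aM: "(a, M) \<in> affs f" "y < a + M \<bullet> Q" using less_env_iff[OF Q] by auto
  have "((\<lambda>\<rho>. a + M \<bullet> Q - norm M * \<rho>) \<longlongrightarrow> a + M \<bullet> Q - norm M * 0) (at_right 0)" by (intro tendsto_intros)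
  then have "\<forall>\<^sub>F \<rho> in at_right 0. y < a + M \<bullet> Q - norm M * \<rho>"
    using aM by (intro order_tendstoD(1)) auto
  then show "\<forall>\<^sub>F \<rho> in at_right 0. y < env_min Q \<rho>"
    using eventually_at_right_less[of 0]
  proof eventually_elim
    case (elim \<rho>)
    have "a + M \<bullet> Q - norm M * \<rho> \<le> env_min Q \<rho>"
      unfolding env_min_def
    proof (rule cINF_greatest)
      show "K_set \<inter> cball Q \<rho> \<noteq> {}" using Q elim by auto
      fix Y assume Y: "Y \<in> K_set \<inter> cball Q \<rho>"
      have "M \<bullet> (Q - Y) \<le> norm M * norm (Q - Y)" by (rule norm_cauchy_schwarz)
      also have "\<dots> \<le> norm M * \<rho>" using Y by (intro mult_left_mono) (auto simp: dist_norm)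
      finally have "a + M \<bullet> Q - norm M * \<rho> \<le> a + M \<bullet> Y" by (simp add: inner_diff_right)
      also have "\<dots> \<le> env f Y" using Y aM affs_le_env by auto
      finally show "a + M \<bullet> Q - norm M * \<rho> \<le> env f Y" .
    qed
    then show ?case using elim by linarith
  qed
qed

lemma fhom_eq:
  assumes Q: "Q \<in> K_set"
  shows "fhom_exists f Q \<and> fhom f Q = 4 * fhat_env f Q"
proof -
  have "((\<lambda>\<rho>. ereal (4 * env_min Q \<rho>)) \<longlongrightarrow> ereal (4 * env f Q)) (at_right 0)"
    by (intro tendsto_intros env_min_tendsto Q)
  then have lim: "(fhom_rho f Q \<longlongrightarrow> ereal (4 * env f Q)) (at_right 0)"
    by (rule Lim_transform_eventually) (auto simp: eventually_at_filter fhom_rho_eq[OF Q])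
  then have "fhom f Q = ereal (4 * env f Q)"
    unfolding fhom_def by (intro tendsto_Lim) (auto simp: trivial_limit_at_right_real)
  moreover have "fhom_exists f Q"
    unfolding fhom_exists_def using lim cube_energy_tendsto[OF Q] by blast
  ultimately show ?thesis by (simp add: fhat_env_eq[OF Q])
qed

end

section \<open>Tilings and continuous approximation\<close>

lemma orthonormal_expansion:
  fixes x e1 e2 :: vec2
  assumes "norm e1 = 1" "norm e2 = 1" "e1 \<bullet> e2 = 0"
  shows "x = (x \<bullet> e1) *\<^sub>R e1 + (x \<bullet> e2) *\<^sub>R e2"
proof -
  have e: "(e1$1)\<^sup>2 + (e1$2)\<^sup>2 = 1" "(e2$1)\<^sup>2 + (e2$2)\<^sup>2 = 1" "e1$1 * e2$1 + e1$2 * e2$2 = 0"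
    using assms by (simp_all add: norm_eq_1 inner_vec_def sum_2 power2_eq_square)
  \<comment> \<open>The determinant of the frame: e2 is s times e1 rotated by a right angle, and s
    has square 1.\<close>
  define s where "s = e1$1 * e2$2 - e1$2 * e2$1"
  have "e2$1 = e2$1 * ((e1$1)\<^sup>2 + (e1$2)\<^sup>2)" by (simp only: e(1) mult_1_right)
  also have "\<dots> = e1$1 * (e1$1 * e2$1 + e1$2 * e2$2) - s * e1$2"
    by (simp add: s_def power2_eq_square algebra_simps)
  finally have e21: "e2$1 = - s * e1$2" unfolding e(3) by simp
  have "e2$2 = e2$2 * ((e1$1)\<^sup>2 + (e1$2)\<^sup>2)" by (simp only: e(1) mult_1_right)
  also have "\<dots> = e1$2 * (e1$1 * e2$1 + e1$2 * e2$2) + s * e1$1"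
    by (simp add: s_def power2_eq_square algebra_simps)
  finally have e22: "e2$2 = s * e1$1" unfolding e(3) by simp
  note e2 = e21 e22
  have "s\<^sup>2 * ((e1$1)\<^sup>2 + (e1$2)\<^sup>2) = 1" using e(2) by (simp add: e2 power2_eq_square algebra_simps)
  then have "s * s = 1" using e(1) by (simp add: power2_eq_square)
  then have ss: "s * (s * a) = a" for a by (simp flip: mult.assoc)
  have "x$1 * ((e1$1)\<^sup>2 + (e1$2)\<^sup>2) = x$1" "x$2 * ((e1$1)\<^sup>2 + (e1$2)\<^sup>2) = x$2" using e(1) by simp_all
  then show ?thesis
    by (simp add: vec_eq_iff forall_2 inner_vec_def sum_2 e2 power2_eq_square algebra_simps ss)
qed

text \<open>Near a boundary point the frontier lies on the graph, a Lipschitz image of a line: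
  points strictly above the graph are in the open set \<Omega>, and points strictly below it have a
  neighbourhood free of \<Omega>.\<close>

lemma negligible_frontier_lipschitz:
  assumes "open \<Omega>" "lipschitz_boundary \<Omega>"
  shows "negligible (frontier \<Omega>)"
  unfolding locally_negligible_alt[of "frontier \<Omega>"]
proof
  fix p assume p: "p \<in> frontier \<Omega>"
  then obtain r e1 e2 \<gamma> L where r: "r > 0" and e: "norm e1 = 1" "norm e2 = 1" "e1 \<bullet> e2 = 0"
    and \<gamma>: "L-lipschitz_on UNIV (\<gamma> :: real \<Rightarrow> real)"
    and eq: "\<Omega> \<inter> ball p r = {x \<in> ball p r. (x - p) \<bullet> e2 > \<gamma> ((x - p) \<bullet> e1)}"
    using assms(2) unfolding lipschitz_boundary_def by meson
  define g where "g = (\<lambda>y::vec2. p + (y$1) *\<^sub>R e1 + \<gamma> (y$1) *\<^sub>R e2)"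
  define H where "H = {y::vec2. y$2 = 0}"
  have "negligible H"
    using negligible_standard_hyperplane[of "axis 2 1 :: vec2" 0] by (simp add: H_def inner_axis)
  have "negligible (g ` H)"
  proof (rule negligible_locally_Lipschitz_image[OF _ \<open>negligible H\<close>])
    fix x assume "x \<in> H"
    have "norm (g y - g x) \<le> (1 + L) * norm (y - x)" for y
    proof -
      have "g y - g x = (y$1 - x$1) *\<^sub>R e1 + (\<gamma> (y$1) - \<gamma> (x$1)) *\<^sub>R e2" by (simp add: g_def algebra_simps)
      then have "norm (g y - g x) \<le> \<bar>y$1 - x$1\<bar> + \<bar>\<gamma> (y$1) - \<gamma> (x$1)\<bar>"
        using norm_triangle_ineq[of "(y$1 - x$1) *\<^sub>R e1" "(\<gamma> (y$1) - \<gamma> (x$1)) *\<^sub>R e2"] e by simp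
      also have "\<dots> \<le> \<bar>y$1 - x$1\<bar> + L * \<bar>y$1 - x$1\<bar>"
        using lipschitz_onD[OF \<gamma>, of "y$1" "x$1"] by (simp add: dist_real_def)
      also have "\<dots> = (1 + L) * \<bar>(y - x)$1\<bar>" by (simp add: algebra_simps)
      also have "\<dots> \<le> (1 + L) * norm (y - x)"
        using lipschitz_on_nonneg[OF \<gamma>] by (intro mult_left_mono component_le_norm_cart) auto
      finally show ?thesis .
    qed
    then show "\<exists>T B. open T \<and> x \<in> T \<and> (\<forall>y\<in>H \<inter> T. norm (g y - g x) \<le> B * norm (y - x))"
      by (intro exI[of _ UNIV] exI[of _ "1 + L"]) auto
  qed simp
  moreover have "frontier \<Omega> \<inter> ball p r \<subseteq> g ` H"
  proof
    fix x assume x: "x \<in> frontier \<Omega> \<inter> ball p r"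
    have "x \<notin> \<Omega>" using x \<open>open \<Omega>\<close> frontier_disjoint_eq[of \<Omega>] by blast
    then have le: "(x - p) \<bullet> e2 \<le> \<gamma> ((x - p) \<bullet> e1)" using eq x by force
    have cont: "continuous_on UNIV \<gamma>" using \<gamma> by (rule lipschitz_on_continuous_on)
    have "open {y. (y - p) \<bullet> e2 < \<gamma> ((y - p) \<bullet> e1)}"
      by (intro open_Collect_less continuous_intros continuous_on_compose2[OF cont]) auto
    then have "open ({y. (y - p) \<bullet> e2 < \<gamma> ((y - p) \<bullet> e1)} \<inter> ball p r)" by blast
    moreover have "({y. (y - p) \<bullet> e2 < \<gamma> ((y - p) \<bullet> e1)} \<inter> ball p r) \<inter> \<Omega> = {}"
    proof -
      have "\<not> (y - p) \<bullet> e2 < \<gamma> ((y - p) \<bullet> e1)" if "y \<in> \<Omega>" "y \<in> ball p r" for y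
      proof -
        have "y \<in> {x \<in> ball p r. (x - p) \<bullet> e2 > \<gamma> ((x - p) \<bullet> e1)}" using that eq by blast
        then show ?thesis by simp
      qed
      then show ?thesis by blast
    qed
    ultimately have "({y. (y - p) \<bullet> e2 < \<gamma> ((y - p) \<bullet> e1)} \<inter> ball p r) \<inter> closure \<Omega> = {}"
      using open_Int_closure_eq_empty by blast
    then have "(x - p) \<bullet> e2 = \<gamma> ((x - p) \<bullet> e1)" using le x by (force simp: frontier_def)
    then have "x = g (vector [(x - p) \<bullet> e1, 0])"
      using orthonormal_expansion[OF e, of "x - p"] by (simp add: g_def algebra_simps)
    moreover have "vector [(x - p) \<bullet> e1, 0] \<in> H" by (simp add: H_def)
    ultimately show "x \<in> g ` H" by blast
  qed
  ultimately have "negligible (frontier \<Omega> \<inter> ball p r)" by (rule negligible_subset)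
  then show "\<exists>U. openin (top_of_set (frontier \<Omega>)) U \<and> p \<in> U \<and> negligible U"
    using p r by (intro exI[of _ "frontier \<Omega> \<inter> ball p r"]) (auto simp: openin_open)
qed

text \<open>V collects all errors at the boundary: a small cell that meets both \<Omega> and its
  complement lies in V, as does one with a neighbouring site outside. A ball with points on both
  sides is connected, so it meets the frontier; the frontier is compact, so a whole r-neighbourhood
  of it fits into an open set of small measure.\<close>

lemma thin_layer:
  fixes \<Omega> :: "vec2 set"
  assumes "bounded \<Omega>" "negligible (frontier \<Omega>)" "\<delta> > 0"
  obtains r V where "r > 0" "V \<in> lmeasurable" "measure lebesgue V < \<delta>"
    "\<And>x y z. y \<in> \<Omega> \<Longrightarrow> z \<notin> \<Omega> \<Longrightarrow> dist x y < r \<Longrightarrow> dist x z < r \<Longrightarrow> x \<in> V"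
proof -
  have F: "frontier \<Omega> \<in> null_sets lebesgue" "frontier \<Omega> \<in> lmeasurable"
    using assms(2) by (simp_all add: negligible_iff_null_sets negligible_imp_measurable)
  then obtain V where V: "open V" "frontier \<Omega> \<subseteq> V" "V - frontier \<Omega> \<in> lmeasurable"
      "emeasure lebesgue (V - frontier \<Omega>) < \<delta>"
    using sets_lebesgue_outer_open[of "frontier \<Omega>" \<delta>] assms(3) by (metis fmeasurableD)
  have Veq: "V = (V - frontier \<Omega>) \<union> frontier \<Omega>" using V(2) by blast
  then have "V \<in> lmeasurable" using V(3) F(2) by (metis fmeasurable.Un)
  have "emeasure lebesgue V = emeasure lebesgue (V - frontier \<Omega>)"
    using emeasure_Un_null_set[OF fmeasurableD[OF V(3)] F(1)] Veq by metis
  then have "ennreal (measure lebesgue V) < ennreal \<delta>"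
    using V(4) emeasure_eq_measure2[OF \<open>V \<in> lmeasurable\<close>] by simp
  then have "measure lebesgue V < \<delta>" by (simp add: ennreal_less_iff)
  obtain r where r: "r > 0" "(\<Union>x\<in>frontier \<Omega>. ball x r) \<subseteq> V"
    using compact_subset_open_imp_ball_epsilon_subset[OF compact_frontier_bounded[OF assms(1)] V(1,2)] by blast
  have "x \<in> V" if "y \<in> \<Omega>" "z \<notin> \<Omega>" "dist x y < r" "dist x z < r" for x y z
  proof -
    have "ball x r \<inter> frontier \<Omega> \<noteq> {}" using that by (intro connected_Int_frontier connected_ball) auto
    then obtain w where "w \<in> frontier \<Omega>" "dist x w < r" by auto
    then have "x \<in> ball w r" by (simp add: dist_commute)
    then show ?thesis using r(2) \<open>w \<in> frontier \<Omega>\<close> by blast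
  qed
  then show ?thesis using that r(1) \<open>V \<in> lmeasurable\<close> \<open>measure lebesgue V < \<delta>\<close> by blast
qed

text \<open>For \<open>c = - \<epsilon> / 2\<close> and \<open>\<eta> = \<epsilon>\<close> the tiles are the cells \<open>\<epsilon> (i + W)\<close>; for \<open>\<eta> = p \<epsilon>\<close> they are blocks of
  \<open>p \<times> p\<close> such cells.\<close>

definition tile :: "real \<Rightarrow> real \<Rightarrow> vec2 \<Rightarrow> vec2 set" where
  "tile c \<eta> j = {x. \<forall>k. c + \<eta> * j$k \<le> x$k \<and> x$k < c + \<eta> * j$k + \<eta>}"

definition idx :: "real \<Rightarrow> real \<Rightarrow> vec2 \<Rightarrow> vec2" where
  "idx c \<eta> x = (\<chi> k. of_int \<lfloor>(x$k - c) / \<eta>\<rfloor>)"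

lemma idx_Z2 [simp]: "idx c \<eta> x \<in> Z2"
  by (simp add: idx_def Z2_def)

lemma tile_iff_idx:
  assumes "\<eta> > 0" "j \<in> Z2" shows "x \<in> tile c \<eta> j \<longleftrightarrow> idx c \<eta> x = j"
proof -
  have "(c + \<eta> * j$k \<le> x$k \<and> x$k < c + \<eta> * j$k + \<eta>) \<longleftrightarrow> real_of_int \<lfloor>(x$k - c) / \<eta>\<rfloor> = j$k" for k
  proof -
    obtain z where z: "j$k = of_int z" using assms(2) by (auto simp: Z2_def elim: Ints_cases)
    have "real_of_int \<lfloor>(x$k - c) / \<eta>\<rfloor> = j$k \<longleftrightarrow> of_int z \<le> (x$k - c) / \<eta> \<and> (x$k - c) / \<eta> < of_int z + 1"
      by (simp add: z floor_eq_iff)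
    also have "\<dots> \<longleftrightarrow> c + \<eta> * j$k \<le> x$k \<and> x$k < c + \<eta> * j$k + \<eta>"
      using assms(1) by (simp add: z field_simps)
    finally show ?thesis by simp
  qed
  then show ?thesis by (auto simp: tile_def idx_def vec_eq_iff)
qed

lemma mem_tile_idx: "\<eta> > 0 \<Longrightarrow> x \<in> tile c \<eta> (idx c \<eta> x)"
  by (subst tile_iff_idx) simp_all

lemma tile_disjoint: "\<eta> > 0 \<Longrightarrow> i \<in> Z2 \<Longrightarrow> j \<in> Z2 \<Longrightarrow> i \<noteq> j \<Longrightarrow> tile c \<eta> i \<inter> tile c \<eta> j = {}"
  by (auto simp: tile_iff_idx)

lemma tile_borel: "tile c \<eta> j \<in> sets borel"
proof -
  have "tile c \<eta> j = (\<Inter>k. {x. c + \<eta> * j$k \<le> x$k} \<inter> {x. x$k < c + \<eta> * j$k + \<eta>})"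
    by (auto simp: tile_def)
  also have "\<dots> \<in> sets borel"
    by (intro sets.finite_INT sets.Int borel_closed borel_open closed_Collect_le open_Collect_less continuous_intros) auto
  finally show ?thesis .
qed

lemma tile_lmeasurable [simp]: "tile c \<eta> j \<in> lmeasurable"
  and measure_tile: "\<eta> > 0 \<Longrightarrow> measure lebesgue (tile c \<eta> j) = \<eta>\<^sup>2"
proof -
  define a b :: vec2 where "a = (\<chi> k. c + \<eta> * j$k)" and "b = (\<chi> k. c + \<eta> * j$k + \<eta>)"
  have sub: "box a b \<subseteq> tile c \<eta> j" "tile c \<eta> j \<subseteq> cbox a b"
    by (auto simp: tile_def mem_box_cart a_def b_def less_imp_le)
  show m: "tile c \<eta> j \<in> lmeasurable"
    using sub tile_borel by (intro fmeasurableI2[OF lmeasurable_cbox[of a b]]) auto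
  assume "\<eta> > 0"
  have "negligible (cbox a b - tile c \<eta> j)"
    using negligible_frontier_interval[of a b] by (rule negligible_subset) (use sub in blast)
  moreover have "sym_diff (cbox a b) (tile c \<eta> j) = cbox a b - tile c \<eta> j" using sub by blast
  ultimately have "measure lebesgue (tile c \<eta> j) = measure lebesgue (cbox a b)"
    using measure_negligible_symdiff[OF lmeasurable_cbox, of a b "tile c \<eta> j"] by simp
  also have "\<dots> = \<eta>\<^sup>2"
  proof -
    have "cbox a b \<noteq> {}" using \<open>\<eta> > 0\<close> by (simp add: interval_ne_empty_cart a_def b_def)
    then show ?thesis by (simp add: content_cbox_cart a_def b_def power2_eq_square UNIV_2)
  qed
  finally show "measure lebesgue (tile c \<eta> j) = \<eta>\<^sup>2" .
qed

lemma dist_tile: assumes "x \<in> tile c \<eta> j" "y \<in> tile c \<eta> j" shows "dist x y \<le> 2 * \<eta>"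
proof -
  have "\<bar>(x - y)$k\<bar> \<le> \<eta>" for k
  proof -
    have "c + \<eta> * j$k \<le> x$k \<and> x$k < c + \<eta> * j$k + \<eta>" "c + \<eta> * j$k \<le> y$k \<and> y$k < c + \<eta> * j$k + \<eta>"
      using assms by (auto simp: tile_def)
    then show ?thesis by (simp add: abs_le_iff)
  qed
  then have "(\<Sum>k\<in>UNIV. \<bar>(x - y)$k\<bar>) \<le> (\<Sum>k\<in>(UNIV :: 2 set). \<eta>)" by (intro sum_mono)
  then show ?thesis using norm_le_l1_cart[of "x - y"] by (simp add: dist_norm)
qed

lemma finite_Z2_bounded: "finite {i \<in> Z2. norm i \<le> R}"
proof (rule finite_subset)
  show "{i \<in> Z2. norm i \<le> R} \<subseteq> (\<lambda>(x, y). site x y) ` ({- \<lceil>R\<rceil>..\<lceil>R\<rceil>} \<times> {- \<lceil>R\<rceil>..\<lceil>R\<rceil>})"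
  proof
    fix i assume i: "i \<in> {i \<in> Z2. norm i \<le> R}"
    have "\<lfloor>i$k\<rfloor> \<in> {- \<lceil>R\<rceil>..\<lceil>R\<rceil>}" for k
    proof -
      have "\<bar>i$k\<bar> \<le> R" using i component_le_norm_cart[of i k] by simp
      then have "- real_of_int \<lceil>R\<rceil> \<le> i$k" "i$k \<le> real_of_int \<lceil>R\<rceil>" by linarith+
      then show ?thesis by (simp add: le_floor_iff floor_le_iff)
    qed
    then show "i \<in> (\<lambda>(x, y). site x y) ` ({- \<lceil>R\<rceil>..\<lceil>R\<rceil>} \<times> {- \<lceil>R\<rceil>..\<lceil>R\<rceil>})"
      using i Z2_site[of i] by (intro rev_image_eqI[of "(\<lfloor>i$1\<rfloor>, \<lfloor>i$2\<rfloor>)"]) auto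
  qed
qed auto

lemma finite_tiles:
  assumes "bounded S" "\<eta> > 0" shows "finite {j \<in> Z2. tile c \<eta> j \<inter> S \<noteq> {}}"
proof -
  obtain R where R: "\<And>x. x \<in> S \<Longrightarrow> norm x \<le> R" using assms(1) by (auto simp: bounded_iff)
  have "norm j \<le> 2 * ((R + \<bar>c\<bar> + \<eta>) / \<eta>)" if j: "j \<in> Z2" "x \<in> tile c \<eta> j" "x \<in> S" for j x
  proof -
    have "\<bar>j$k\<bar> \<le> (R + \<bar>c\<bar> + \<eta>) / \<eta>" for k
    proof -
      have "c + \<eta> * j$k \<le> x$k" "x$k < c + \<eta> * j$k + \<eta>" "\<bar>x$k\<bar> \<le> R"
        using j R[of x] component_le_norm_cart[of x k] by (auto simp: tile_def)
      then have "\<bar>\<eta> * j$k\<bar> \<le> R + \<bar>c\<bar> + \<eta>" using assms(2) by linarith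
      then show ?thesis using assms(2) by (simp add: abs_mult field_simps)
    qed
    then have "(\<Sum>k\<in>UNIV. \<bar>j$k\<bar>) \<le> (\<Sum>k\<in>(UNIV :: 2 set). (R + \<bar>c\<bar> + \<eta>) / \<eta>)" by (intro sum_mono)
    then show ?thesis using norm_le_l1_cart[of j] by simp
  qed
  then have "{j \<in> Z2. tile c \<eta> j \<inter> S \<noteq> {}} \<subseteq> {j \<in> Z2. norm j \<le> 2 * ((R + \<bar>c\<bar> + \<eta>) / \<eta>)}" by auto
  then show ?thesis using finite_Z2_bounded finite_subset by blast
qed

text \<open>Counting by area converts the number of bad cells into the measure of the layer.\<close>

lemma card_tiles_le:
  assumes "\<eta> > 0" "finite J" "J \<subseteq> Z2" "\<And>j. j \<in> J \<Longrightarrow> tile c \<eta> j \<subseteq> V" "V \<in> lmeasurable"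
  shows "real (card J) * \<eta>\<^sup>2 \<le> measure lebesgue V"
proof -
  have "measure lebesgue (\<Union>j\<in>J. tile c \<eta> j) = (\<Sum>j\<in>J. measure lebesgue (tile c \<eta> j))"
    using assms(1-3) tile_disjoint by (intro measure_UNION') (force simp: pairwise_def disjnt_def)+
  also have "\<dots> = real (card J) * \<eta>\<^sup>2" using assms(1) by (simp add: measure_tile)
  moreover have "measure lebesgue (\<Union>j\<in>J. tile c \<eta> j) \<le> measure lebesgue V"
    using assms by (intro measure_mono_fmeasurable) (auto intro!: sets.finite_UN fmeasurableD[OF tile_lmeasurable])
  ultimately show ?thesis by simp
qed

section \<open>Integrals over tiles and continuous approximation\<close>

lemma lmeasurable_open_bounded: "open \<Omega> \<Longrightarrow> bounded \<Omega> \<Longrightarrow> \<Omega> \<in> lmeasurable"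
  by (rule bounded_set_imp_lmeasurable) auto

lemma finite_measure_lebesgue_on: "S \<in> lmeasurable \<Longrightarrow> finite_measure (lebesgue_on S)"
  by (rule finite_measureI) (auto simp: emeasure_restrict_space fmeasurable_def less_top)

text \<open>The tiles are disjoint, so the difference is the integral over the uncovered part, which
  lies in V.\<close>

lemma integral_tiles:
  fixes g :: "vec2 \<Rightarrow> real"
  assumes \<Omega>: "\<Omega> \<in> lmeasurable" and g: "g \<in> borel_measurable (lebesgue_on \<Omega>)" "AE x in lebesgue_on \<Omega>. \<bar>g x\<bar> \<le> S"
    and J: "finite J" "J \<subseteq> Z2" "\<eta> > 0" and V: "V \<in> lmeasurable" "\<Omega> - (\<Union>j\<in>J. tile c \<eta> j) \<subseteq> V" and "S \<ge> 0"
  shows "\<bar>(LINT x|lebesgue_on \<Omega>. g x) - (\<Sum>j\<in>J. LINT x|lebesgue_on \<Omega>. indicator (tile c \<eta> j) x * g x)\<bar>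
    \<le> S * measure lebesgue V"
proof -
  interpret finite_measure "lebesgue_on \<Omega>" by (rule finite_measure_lebesgue_on[OF \<Omega>])
  let ?R = "\<Omega> - (\<Union>j\<in>J. tile c \<eta> j)"
  have \<Omega>s: "\<Omega> \<in> sets lebesgue" using \<Omega> by auto
  have ts: "tile c \<eta> j \<in> sets lebesgue" for j by (rule fmeasurableD[OF tile_lmeasurable])
  have Rs: "?R \<in> sets lebesgue" using \<Omega>s ts J by (intro sets.Diff sets.finite_UN) auto
  have ms: "indicator A \<in> borel_measurable (lebesgue_on \<Omega>)" if "A \<in> sets lebesgue" for A
    using that by (intro measurable_restrict_space1) simp
  have int: "integrable (lebesgue_on \<Omega>) (\<lambda>x. indicator A x * g x)" if "A \<in> sets lebesgue" for A
  proof (rule integrable_const_bound[where B = S])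
    show "AE x in lebesgue_on \<Omega>. norm (indicator A x * g x) \<le> S"
      using g(2) by eventually_elim (use \<open>S \<ge> 0\<close> in \<open>auto simp: indicator_def\<close>)
    show "(\<lambda>x. indicator A x * g x) \<in> borel_measurable (lebesgue_on \<Omega>)"
      using g(1) ms[OF that] by (intro borel_measurable_times) auto
  qed
  have "(LINT x|lebesgue_on \<Omega>. g x)
    = (LINT x|lebesgue_on \<Omega>. (\<Sum>j\<in>J. indicator (tile c \<eta> j) x * g x) + indicator ?R x * g x)"
  proof (rule Bochner_Integration.integral_cong)
    fix x assume "x \<in> space (lebesgue_on \<Omega>)"
    then have x: "x \<in> \<Omega>" by simp
    have "(\<Sum>j\<in>J. indicator (tile c \<eta> j) x * g x) = (if idx c \<eta> x \<in> J then g x else 0)"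
    proof -
      have "(\<Sum>j\<in>J. indicator (tile c \<eta> j) x * g x) = (\<Sum>j\<in>J. if idx c \<eta> x = j then g x else 0)"
        using J by (intro sum.cong refl) (auto simp: indicator_def tile_iff_idx)
      then show ?thesis using J(1) by (simp add: sum.delta')
    qed
    moreover have "x \<in> ?R \<longleftrightarrow> idx c \<eta> x \<notin> J"
    proof -
      have "x \<in> tile c \<eta> j \<longleftrightarrow> idx c \<eta> x = j" if "j \<in> J" for j
        using that J by (intro tile_iff_idx) auto
      then show ?thesis using x by auto
    qed
    ultimately show "g x = (\<Sum>j\<in>J. indicator (tile c \<eta> j) x * g x) + indicator ?R x * g x"
      by (simp add: indicator_def)
  qed simp
  also have "\<dots> = (\<Sum>j\<in>J. LINT x|lebesgue_on \<Omega>. indicator (tile c \<eta> j) x * g x) + (LINT x|lebesgue_on \<Omega>. indicator ?R x * g x)"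
    using int[OF ts] int[OF Rs] by (simp add: Bochner_Integration.integral_add Bochner_Integration.integral_sum)
  finally have eq: "(LINT x|lebesgue_on \<Omega>. g x) - (\<Sum>j\<in>J. LINT x|lebesgue_on \<Omega>. indicator (tile c \<eta> j) x * g x)
    = (LINT x|lebesgue_on \<Omega>. indicator ?R x * g x)" by simp
  have "\<bar>LINT x|lebesgue_on \<Omega>. indicator ?R x * g x\<bar> \<le> (LINT x|lebesgue_on \<Omega>. \<bar>indicator ?R x * g x\<bar>)"
    by (rule integral_abs_bound)
  also have "\<dots> \<le> (LINT x|lebesgue_on \<Omega>. indicator ?R x * S)"
  proof (rule integral_mono_AE)
    show "integrable (lebesgue_on \<Omega>) (\<lambda>x. indicator ?R x * S)"
    proof (rule integrable_const_bound[where B = S])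
      show "(\<lambda>x. indicator ?R x * S) \<in> borel_measurable (lebesgue_on \<Omega>)"
        using ms[OF Rs] by (intro borel_measurable_times) auto
      show "AE x in lebesgue_on \<Omega>. norm (indicator ?R x * S) \<le> S"
        using \<open>S \<ge> 0\<close> by (intro always_eventually) (auto simp: indicator_def)
    qed
    show "AE x in lebesgue_on \<Omega>. \<bar>indicator ?R x * g x\<bar> \<le> indicator ?R x * S"
      using g(2) by eventually_elim (auto simp: indicator_def)
  qed (use int[OF Rs] in auto)
  also have "\<dots> = S * measure lebesgue ?R"
    using \<Omega>s by (simp add: measure_restrict_space Int_absorb2)
  also have "\<dots> \<le> S * measure lebesgue V"
    using \<open>S \<ge> 0\<close> V Rs by (intro mult_left_mono measure_mono_fmeasurable) auto
  finally show ?thesis by (simp add: eq)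
qed

lemma integral_tile_const:
  assumes \<Omega>: "\<Omega> \<in> lmeasurable" and "tile c \<eta> j \<subseteq> \<Omega>" "\<eta> > 0"
  shows "(LINT x|lebesgue_on \<Omega>. indicator (tile c \<eta> j) x * a) = a * \<eta>\<^sup>2"
proof -
  have "measure (lebesgue_on \<Omega>) (tile c \<eta> j) = \<eta>\<^sup>2"
    using assms by (subst measure_restrict_space) (auto simp: measure_tile dest: fmeasurableD)
  then show ?thesis using assms(2) by (simp add: Int_absorb2)
qed

lemma integral_tile_approx:
  fixes g h :: "vec2 \<Rightarrow> real"
  assumes \<Omega>: "\<Omega> \<in> lmeasurable" and j: "tile c \<eta> j \<subseteq> \<Omega>" "\<eta> > 0"
    and g: "g \<in> borel_measurable (lebesgue_on \<Omega>)" "AE x in lebesgue_on \<Omega>. \<bar>g x\<bar> \<le> S"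
    and h: "h \<in> borel_measurable (lebesgue_on \<Omega>)" "AE x in lebesgue_on \<Omega>. \<bar>h x\<bar> \<le> S" and "S \<ge> 0"
    and w: "AE x in lebesgue_on \<Omega>. x \<in> tile c \<eta> j \<longrightarrow> g x \<le> h x + w"
  shows "(LINT x|lebesgue_on \<Omega>. indicator (tile c \<eta> j) x * g x)
    \<le> (LINT x|lebesgue_on \<Omega>. indicator (tile c \<eta> j) x * h x) + w * \<eta>\<^sup>2"
proof -
  interpret finite_measure "lebesgue_on \<Omega>" by (rule finite_measure_lebesgue_on[OF \<Omega>])
  have ms: "indicator (tile c \<eta> j) \<in> borel_measurable (lebesgue_on \<Omega>)"
    using fmeasurableD[OF tile_lmeasurable] by (intro measurable_restrict_space1) simp
  have int: "integrable (lebesgue_on \<Omega>) (\<lambda>x. indicator (tile c \<eta> j) x * g x)"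
    if "g \<in> borel_measurable (lebesgue_on \<Omega>)" "AE x in lebesgue_on \<Omega>. \<bar>g x\<bar> \<le> S" "S \<ge> 0"
    for g :: "vec2 \<Rightarrow> real" and S :: real
  proof (rule integrable_const_bound[where B = S])
    show "AE x in lebesgue_on \<Omega>. norm (indicator (tile c \<eta> j) x * g x) \<le> S"
      using that(2) by eventually_elim (use that(3) in \<open>auto simp: indicator_def\<close>)
    show "(\<lambda>x. indicator (tile c \<eta> j) x * g x) \<in> borel_measurable (lebesgue_on \<Omega>)"
      using that(1) ms by (intro borel_measurable_times) auto
  qed
  have intw: "integrable (lebesgue_on \<Omega>) (\<lambda>x. indicator (tile c \<eta> j) x * w)"
    by (rule int[of _ "\<bar>w\<bar>"]) auto
  have "(LINT x|lebesgue_on \<Omega>. indicator (tile c \<eta> j) x * g x)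
    \<le> (LINT x|lebesgue_on \<Omega>. indicator (tile c \<eta> j) x * h x + indicator (tile c \<eta> j) x * w)"
  proof (rule integral_mono_AE)
    show "AE x in lebesgue_on \<Omega>. indicator (tile c \<eta> j) x * g x
      \<le> indicator (tile c \<eta> j) x * h x + indicator (tile c \<eta> j) x * w"
      using w by eventually_elim (auto simp: indicator_def)
  qed (use int[OF g] int[OF h] intw \<open>S \<ge> 0\<close> in auto)
  also have "\<dots> = (LINT x|lebesgue_on \<Omega>. indicator (tile c \<eta> j) x * h x) + w * \<eta>\<^sup>2"
    using int[OF h] intw \<open>S \<ge> 0\<close> integral_tile_const[OF \<Omega> j] by simp
  finally show ?thesis .
qed

text \<open>A measurable function is an almost everywhere limit of continuous ones. Composing these
  with the nearest-point map onto \<Gamma> keeps them continuous, moves their values into \<Gamma>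
  and leaves the limit alone.\<close>

lemma continuous_approximation:
  fixes s :: "'a::euclidean_space \<Rightarrow> 'b::euclidean_space"
  assumes \<Omega>: "\<Omega> \<in> sets lebesgue" and s: "s \<in> borel_measurable (lebesgue_on \<Omega>)" "AE x in lebesgue_on \<Omega>. s x \<in> \<Gamma>"
    and \<Gamma>: "convex \<Gamma>" "closed \<Gamma>" "\<Gamma> \<noteq> {}"
  obtains g where "\<And>n. continuous_on UNIV (g n)" "\<And>n x. g n x \<in> \<Gamma>"
    "AE x in lebesgue_on \<Omega>. (\<lambda>n::nat. g n x) \<longlonglongrightarrow> s x"
proof -
  have "(\<lambda>x. if x \<in> \<Omega> then s x else 0) \<in> borel_measurable lebesgue"
    using s(1) \<Omega> by (simp add: borel_measurable_if)
  then have "(\<lambda>x. if x \<in> \<Omega> then s x else 0) measurable_on \<Omega>"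
    using \<Omega> by (rule lebesgue_measurable_imp_measurable_on)
  then obtain N g where N: "negligible N" "\<And>n. continuous_on UNIV (g n)"
    "\<And>x. x \<notin> N \<Longrightarrow> (\<lambda>n::nat. g n x) \<longlonglongrightarrow> (if x \<in> \<Omega> then s x else 0)"
    unfolding measurable_on_def by (auto cong: if_cong)
  define g' where "g' = (\<lambda>n x. closest_point \<Gamma> (g n x))"
  show ?thesis
  proof (rule that)
    show "continuous_on UNIV (g' n)" for n
      unfolding g'_def using continuous_on_closest_point[OF \<Gamma>] N(2) by (rule continuous_on_compose2) auto
    show "g' n x \<in> \<Gamma>" for n x unfolding g'_def using \<Gamma> by (simp add: closest_point_in_set)
    have "AE x in lebesgue. x \<notin> N" using N(1) by (simp add: AE_not_in negligible_iff_null_sets)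
    then have "AE x in lebesgue_on \<Omega>. x \<in> \<Omega> \<and> x \<notin> N"
      using \<Omega> by (auto simp: AE_restrict_space_iff elim: eventually_mono)
    then show "AE x in lebesgue_on \<Omega>. (\<lambda>n. g' n x) \<longlonglongrightarrow> s x"
      using s(2)
    proof eventually_elim
      case (elim x)
      have "(\<lambda>n. closest_point \<Gamma> (g n x)) \<longlonglongrightarrow> closest_point \<Gamma> (s x)"
        using N(3)[of x] elim by (intro isCont_tendsto_compose[OF continuous_at_closest_point[OF \<Gamma>]]) auto
      then show ?case using elim by (simp add: g'_def closest_point_self)
    qed
  qed
qed

section \<open>The lower bound\<close>

locale spin_domain = spin_interaction f C for f C +
  fixes \<Omega> :: "vec2 set"
  assumes open_\<Omega>: "open \<Omega>" and bounded_\<Omega>: "bounded \<Omega>" and negl_frontier: "negligible (frontier \<Omega>)"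
begin

lemma lmeas_\<Omega>: "\<Omega> \<in> lmeasurable"
  using open_\<Omega> bounded_\<Omega> by (rule lmeasurable_open_bounded)

lemma sets_\<Omega>: "\<Omega> \<in> sets lebesgue"
  using lmeas_\<Omega> by (rule fmeasurableD)

abbreviation \<mu> :: "vec2 measure" where
  "\<mu> \<equiv> lebesgue_on \<Omega>"

sublocale finite_measure "\<mu>"
  by (rule finite_measure_lebesgue_on[OF lmeas_\<Omega>])

lemma measure_space_\<Omega>: "measure \<mu> \<Omega> = measure lebesgue \<Omega>"
  using sets_\<Omega> by (simp add: measure_restrict_space)

lemma AE_\<Omega>: "AE x in \<mu>. x \<in> \<Omega>"
  by (rule AE_I2) simp

lemma continuous_measurable: "continuous_on UNIV g \<Longrightarrow> g \<in> borel_measurable \<mu>"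
  by (intro measurable_restrict_space1 measurable_completion) (simp add: borel_measurable_continuous_onI)

text \<open>Q takes values in K only almost everywhere; the value 0 elsewhere gives a bounded Borel
  function to compose with Q.\<close>

definition envK :: "mat2 \<Rightarrow> real" where
  "envK X = (if X \<in> K_set then env f X else 0)"

text \<open>Lower semicontinuity: inside K, a strict superlevel set of \<open>env\<close> is cut out
  by a union of open sets, one per minorant.\<close>

lemma envK_borel: "envK \<in> borel_measurable borel"
  unfolding borel_measurable_iff_greater
proof
  fix t :: real
  have "{X. t < envK X} = (K_set \<inter> (\<Union>p \<in> affs f. {Y. t < fst p + snd p \<bullet> Y})) \<union> (if t < 0 then - K_set else {})"
    using less_env_iff by (force simp: envK_def split: if_splits)
  moreover have "open (\<Union>p \<in> affs f. {Y. t < fst p + snd p \<bullet> Y})"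
    by (intro open_UN ballI open_Collect_less continuous_intros)
  moreover have "K_set \<in> sets borel" using closed_K by simp
  ultimately show "{w \<in> space borel. t < envK w} \<in> sets borel" by auto
qed

lemma envK_bound: "\<bar>envK X\<bar> \<le> C"
  using env_bounds C_nonneg by (simp add: envK_def)

lemma bounded_integrable:
  fixes g :: "vec2 \<Rightarrow> real"
  shows "g \<in> borel_measurable \<mu> \<Longrightarrow> AE x in \<mu>. \<bar>g x\<bar> \<le> S \<Longrightarrow> integrable \<mu> g"
  by (rule integrable_const_bound[where B = S]) auto

lemma affine_field_bound:
  assumes "\<bar>a\<bar> + norm M \<le> S" "norm X \<le> 1" shows "\<bar>a + M \<bullet> X\<bar> \<le> S"
proof -
  have "\<bar>M \<bullet> X\<bar> \<le> norm M * norm X" by (rule Cauchy_Schwarz_ineq2)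
  also have "\<dots> \<le> norm M * 1" using assms by (intro mult_left_mono) auto
  finally show ?thesis using assms by linarith
qed

text \<open>Countably many affine minorants suffice to recover \<^const>\<open>env\<close>; choosing measurably one of them at each
  point, almost optimal at \<open>Q x\<close>, and regularising the choice inside the convex hull of finitely many
  minorants gives a continuous field of minorants.\<close>

lemma affine_minorant_field:
  assumes Q: "Q \<in> borel_measurable \<mu>" "AE x in \<mu>. Q x \<in> K_set"
    and t: "t < (LINT x|\<mu>. envK (Q x))"
  obtains p :: "vec2 \<Rightarrow> real \<times> mat2" and S where "continuous_on UNIV p" "\<And>x. p x \<in> affs f"
    "\<And>x. \<bar>fst (p x)\<bar> + norm (snd (p x)) \<le> S" "t < (LINT x|\<mu>. fst (p x) + snd (p x) \<bullet> Q x)"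
proof -
  let ?I = "LINT x|\<mu>. envK (Q x)"
  define A where "A = measure lebesgue \<Omega>"
  \<comment> \<open>Small enough that losing \<delta> at every point of \<Omega> costs less than the
    gap \<open>?I - t\<close>.\<close>
  define \<delta> where "\<delta> = (?I - t) / (2 * (A + 1))"
  have "A \<ge> 0" by (simp add: A_def)
  then have "\<delta> > 0" using t by (simp add: \<delta>_def)
  have "\<delta> * A < ?I - t"
  proof -
    have "\<delta> * (2 * (A + 1)) = ?I - t" using \<open>A \<ge> 0\<close> by (simp add: \<delta>_def)
    moreover have "\<delta> * A < \<delta> * (2 * (A + 1))" using \<open>\<delta> > 0\<close> \<open>A \<ge> 0\<close> by (intro mult_strict_left_mono) auto
    ultimately show ?thesis by simp
  qed
  define l where "l = (\<lambda>(p :: real \<times> mat2) X. fst p + snd p \<bullet> X)"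
  \<comment> \<open>Being almost optimal at a given X is an open condition on the minorant, so a
    dense countable set contains a minorant that satisfies it.\<close>
  obtain D where D: "countable D" "D \<subseteq> affs f" "affs f \<subseteq> closure D" by (rule separable)
  have "D \<noteq> {}" using D(3) const_in_affs by auto
  define d where "d = from_nat_into D"
  have d_affs: "d n \<in> affs f" for n using from_nat_into[OF \<open>D \<noteq> {}\<close>] D(2) by (auto simp: d_def)
  have d_opt: "\<exists>n. env f X - \<delta> < l (d n) X" if X: "X \<in> K_set" for X
  proof -
    obtain q where q: "q \<in> affs f" "env f X - \<delta> < l q X"
      using less_env_iff[OF X, of "env f X - \<delta>"] \<open>\<delta> > 0\<close> by (auto simp: l_def)
    have "open {q. env f X - \<delta> < l q X}" unfolding l_def by (intro open_Collect_less continuous_intros)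
    then have "D \<inter> {q. env f X - \<delta> < l q X} \<noteq> {}"
      using q D(3) open_Int_closure_eq_empty[of "{q. env f X - \<delta> < l q X}" D] by blast
    then obtain q' where "q' \<in> D" "env f X - \<delta> < l q' X" by blast
    then show ?thesis using from_nat_into_surj[OF D(1)] by (metis d_def)
  qed
  have Qm: "(\<lambda>x. envK (Q x)) \<in> borel_measurable \<mu>" using measurable_compose[OF Q(1) envK_borel] .
  have lm: "(\<lambda>x. l (q x) (Q x)) \<in> borel_measurable \<mu>" if "q \<in> borel_measurable \<mu>" for q
  proof -
    have "(\<lambda>x. fst (q x)) \<in> borel_measurable \<mu>" "(\<lambda>x. snd (q x)) \<in> borel_measurable \<mu>"
      using that measurable_compose[OF that, of fst borel] measurable_compose[OF that, of snd borel]
      by (simp_all add: borel_measurable_continuous_onI continuous_on_fst continuous_on_snd)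
    then show ?thesis unfolding l_def using Q(1) by (intro borel_measurable_add borel_measurable_inner)
  qed
  \<comment> \<open>The least good index makes the choice measurable.\<close>
  define N where "N = (\<lambda>x. LEAST n. envK (Q x) - \<delta> < l (d n) (Q x))"
  have N_meas: "N \<in> measurable \<mu> (count_space UNIV)"
    unfolding N_def
  proof (rule measurable_Least)
    fix n
    have "(\<lambda>x. l (d n) (Q x)) \<in> borel_measurable \<mu>" by (rule lm) simp
    then show "Measurable.pred \<mu> (\<lambda>x. envK (Q x) - \<delta> < l (d n) (Q x))"
      using Qm by (intro borel_measurable_pred_less borel_measurable_diff) auto
  qed
  have N: "env f (Q x) - \<delta> < l (d (N x)) (Q x)" if "Q x \<in> K_set" for x
    using LeastI_ex[OF d_opt[OF that]] that by (simp add: N_def envK_def)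
  \<comment> \<open>Truncation at the index m leaves finitely many minorants, whose convex hull is
    compact; where the index is larger, the constant minorant - C takes over.\<close>
  define s where "s = (\<lambda>m x. if N x \<le> m then d (N x) else (- C, 0))"
  have s_meas: "s m \<in> borel_measurable \<mu>" for m
    unfolding s_def using measurable_compose[OF N_meas, of "\<lambda>n. if n \<le> m then d n else (- C, 0)" borel] by simp
  have dN_meas: "(\<lambda>x. d (N x)) \<in> borel_measurable \<mu>"
    using measurable_compose[OF N_meas, of d borel] by simp
  have "(\<lambda>m. LINT x|\<mu>. l (s m x) (Q x)) \<longlonglongrightarrow> (LINT x|\<mu>. l (d (N x)) (Q x))"
  proof (rule integral_dominated_convergence[where w = "\<lambda>_. C + \<delta>"])
    show "AE x in \<mu>. (\<lambda>m. l (s m x) (Q x)) \<longlonglongrightarrow> l (d (N x)) (Q x)"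
    proof (rule AE_I2)
      fix x
      have "\<forall>\<^sub>F m in sequentially. l (s m x) (Q x) = l (d (N x)) (Q x)"
        using eventually_ge_at_top[of "N x"] by eventually_elim (simp add: s_def)
      then show "(\<lambda>m. l (s m x) (Q x)) \<longlonglongrightarrow> l (d (N x)) (Q x)" by (rule tendsto_eventually)
    qed
    \<comment> \<open>The bound C from above holds for all minorants on K; from below, - C -
      \<delta> comes from the choice of N.\<close>
    show "AE x in \<mu>. norm (l (s m x) (Q x)) \<le> C + \<delta>" for m
      using Q(2)
    proof eventually_elim
      case (elim x)
      have "l (d (N x)) (Q x) \<le> C" using affs_le_C[of "fst (d (N x))" "snd (d (N x))"] d_affs elim by (simp add: l_def)
      then show ?case
        using N[OF elim] env_bounds[OF elim] C_nonneg \<open>\<delta> > 0\<close> by (auto simp: s_def l_def abs_le_iff)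
    qed
  qed (use lm[OF dN_meas] lm[OF s_meas] in auto)
  moreover have "t < (LINT x|\<mu>. l (d (N x)) (Q x))"
  proof -
    have "?I - \<delta> * A = (LINT x|\<mu>. envK (Q x) - \<delta>)"
      using bounded_integrable[OF Qm, of C] envK_bound by (simp add: measure_space_\<Omega> A_def)
    also have "\<dots> \<le> (LINT x|\<mu>. l (d (N x)) (Q x))"
    proof (rule integral_mono_AE)
      show "integrable \<mu> (\<lambda>x. envK (Q x) - \<delta>)"
        using bounded_integrable[OF Qm, of C] envK_bound by simp
      show "AE x in \<mu>. envK (Q x) - \<delta> \<le> l (d (N x)) (Q x)"
        using Q(2) by eventually_elim (use N in \<open>simp add: envK_def less_imp_le\<close>)
      show "integrable \<mu> (\<lambda>x. l (d (N x)) (Q x))"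
      proof (rule bounded_integrable[OF lm[OF dN_meas], of "C + \<delta>"])
        show "AE x in \<mu>. \<bar>l (d (N x)) (Q x)\<bar> \<le> C + \<delta>"
          using Q(2)
        proof eventually_elim
          case (elim x)
          have "l (d (N x)) (Q x) \<le> C" using affs_le_C[of "fst (d (N x))" "snd (d (N x))"] d_affs elim by (simp add: l_def)
          then show ?case using N[OF elim] env_bounds[OF elim] \<open>\<delta> > 0\<close> by (auto simp: abs_le_iff)
        qed
      qed
    qed
    finally show ?thesis using \<open>\<delta> * A < ?I - t\<close> by simp
  qed
  ultimately have "\<forall>\<^sub>F m in sequentially. t < (LINT x|\<mu>. l (s m x) (Q x))" by (rule order_tendstoD(1))
  then obtain m where m: "t < (LINT x|\<mu>. l (s m x) (Q x))" using eventually_happens'[OF sequentially_bot] by blast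
  define \<Gamma> where "\<Gamma> = convex hull (insert (- C, 0) (d ` {..m}))"
  have \<Gamma>: "compact \<Gamma>" "convex \<Gamma>" "\<Gamma> \<noteq> {}"
    unfolding \<Gamma>_def by (rule compact_convex_hull[OF finite_imp_compact]) auto
  have \<Gamma>_affs: "\<Gamma> \<subseteq> affs f" unfolding \<Gamma>_def using d_affs const_in_affs convex_affs by (intro hull_minimal) auto
  have "s m x \<in> \<Gamma>" for x unfolding \<Gamma>_def s_def by (intro hull_inc) auto
  then obtain g where g: "\<And>n. continuous_on UNIV (g n)" "\<And>n x. g n x \<in> \<Gamma>" "AE x in \<mu>. (\<lambda>n::nat. g n x) \<longlonglongrightarrow> s m x"
    using continuous_approximation[OF sets_\<Omega> s_meas[of m] _ \<Gamma>(2) compact_imp_closed[OF \<Gamma>(1)] \<Gamma>(3)] by auto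
  obtain R where R: "\<And>q. q \<in> \<Gamma> \<Longrightarrow> norm q \<le> R" using compact_imp_bounded[OF \<Gamma>(1)] by (auto simp: bounded_iff)
  have R2: "\<bar>fst q\<bar> + norm (snd q) \<le> 2 * R" if "q \<in> \<Gamma>" for q
    using R[OF that] norm_fst_le[of "fst q" "snd q"] norm_snd_le[of "snd q" "fst q"] by simp
  have "(\<lambda>n. LINT x|\<mu>. l (g n x) (Q x)) \<longlonglongrightarrow> (LINT x|\<mu>. l (s m x) (Q x))"
  proof (rule integral_dominated_convergence[where w = "\<lambda>_. 2 * R"])
    show "AE x in \<mu>. (\<lambda>n. l (g n x) (Q x)) \<longlonglongrightarrow> l (s m x) (Q x)"
      using g(3) by eventually_elim (auto simp: l_def intro!: tendsto_intros)
    show "AE x in \<mu>. norm (l (g n x) (Q x)) \<le> 2 * R" for n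
      using Q(2) by eventually_elim (use R2 g(2) norm_K_le_1 in \<open>simp add: l_def affine_field_bound\<close>)
  qed (use lm[OF continuous_measurable[OF g(1)]] lm[OF s_meas] in auto)
  then have "\<forall>\<^sub>F n in sequentially. t < (LINT x|\<mu>. l (g n x) (Q x))" using m by (rule order_tendstoD(1))
  then obtain n where "t < (LINT x|\<mu>. l (g n x) (Q x))" using eventually_happens'[OF sequentially_bot] by blast
  then show ?thesis using that[of "g n" "2 * R"] g \<Gamma>_affs R2 by (auto simp: l_def)
qed

text \<open>The diameter of a tile is at most 2 \<eta>, so all its points are close to both sides of
  the boundary.\<close>

lemma tile_in_layer:
  assumes V: "\<forall>x y z. y \<in> \<Omega> \<longrightarrow> z \<notin> \<Omega> \<longrightarrow> dist x y < r \<longrightarrow> dist x z < r \<longrightarrow> x \<in> V"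
    and "2 * \<eta> < r" "tile c \<eta> j \<inter> \<Omega> \<noteq> {}" "\<not> tile c \<eta> j \<subseteq> \<Omega>"
  shows "tile c \<eta> j \<subseteq> V"
proof
  fix x assume x: "x \<in> tile c \<eta> j"
  obtain y z where "y \<in> tile c \<eta> j" "y \<in> \<Omega>" "z \<in> tile c \<eta> j" "z \<notin> \<Omega>" using assms(3,4) by blast
  then show "x \<in> V" using V[rule_format, of y z x] dist_tile[OF x, of y] dist_tile[OF x, of z] assms(2) by linarith
qed

lemma cell_eq:
  assumes "\<epsilon> > 0" shows "tile (- \<epsilon> / 2) \<epsilon> i = (\<lambda>y. \<epsilon> *\<^sub>R (i + y)) ` W"
proof (intro equalityI subsetI)
  fix x assume x: "x \<in> tile (- \<epsilon> / 2) \<epsilon> i"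
  have "(1 / \<epsilon>) *\<^sub>R x - i \<in> W" using x assms by (auto simp: tile_def W_def field_simps)
  then show "x \<in> (\<lambda>y. \<epsilon> *\<^sub>R (i + y)) ` W" using assms by (intro rev_image_eqI) auto
next
  fix x assume "x \<in> (\<lambda>y. \<epsilon> *\<^sub>R (i + y)) ` W"
  then obtain y where y: "y \<in> W" "x = \<epsilon> *\<^sub>R (i + y)" by blast
  have "\<epsilon> * (- 1/2) \<le> \<epsilon> * y$k" "\<epsilon> * y$k < \<epsilon> * (1/2)" for k
    using y(1) assms mult_left_mono[of "- 1/2" "y$k" \<epsilon>] mult_strict_left_mono[of "y$k" "1/2" \<epsilon>] by (auto simp: W_def)
  note b = this
  show "x \<in> tile (- \<epsilon> / 2) \<epsilon> i"
    unfolding tile_def y(2) mem_Collect_eq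
  proof
    fix k
    show "- \<epsilon> / 2 + \<epsilon> * i $ k \<le> (\<epsilon> *\<^sub>R (i + y)) $ k \<and> (\<epsilon> *\<^sub>R (i + y)) $ k < - \<epsilon> / 2 + \<epsilon> * i $ k + \<epsilon>"
      using b[of k] by (simp add: distrib_left)
  qed
qed

lemma center_in_cell: "\<epsilon> > 0 \<Longrightarrow> \<epsilon> *\<^sub>R i \<in> tile (- \<epsilon> / 2) \<epsilon> i"
  by (simp add: tile_def)

lemma finite_Z_eps: "\<epsilon> > 0 \<Longrightarrow> finite (Z_eps \<epsilon> \<Omega>)" and Z_eps_Z2: "Z_eps \<epsilon> \<Omega> \<subseteq> Z2"
proof -
  show "Z_eps \<epsilon> \<Omega> \<subseteq> Z2" by (auto simp: Z_eps_def)
  assume e: "\<epsilon> > 0"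
  then have "Z_eps \<epsilon> \<Omega> \<subseteq> {j \<in> Z2. tile (- \<epsilon> / 2) \<epsilon> j \<inter> \<Omega> \<noteq> {}}"
    using center_in_cell by (auto simp: Z_eps_def)
  then show "finite (Z_eps \<epsilon> \<Omega>)" using finite_tiles[OF bounded_\<Omega> e] finite_subset by blast
qed

lemma spin_field_AE:
  assumes "spin_field \<epsilon> \<Omega> P u" "\<epsilon> > 0"
  shows "AE x in \<mu>. P x \<in> S1_tensor"
    "AE x in \<mu>. \<forall>i \<in> Z_eps \<epsilon> \<Omega>. x \<in> tile (- \<epsilon> / 2) \<epsilon> i \<longrightarrow> P x = tensor (u i) (u i)"
proof -
  obtain P0 where P0: "P0 \<in> C_eps \<epsilon> \<Omega>" "AE x in \<mu>. P x = P0 x"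
    "\<And>i. i \<in> Z_eps \<epsilon> \<Omega> \<Longrightarrow> P0 (\<epsilon> *\<^sub>R i) = tensor (u i) (u i)"
    using assms(1) unfolding spin_field_def by blast
  have P0': "P0 x = tensor (u i) (u i)" if "x \<in> \<Omega>" "i \<in> Z_eps \<epsilon> \<Omega>" "x \<in> tile (- \<epsilon> / 2) \<epsilon> i" for x i
    using that P0(1,3) cell_eq[OF assms(2), of i] by (auto simp: C_eps_def)
  show "AE x in \<mu>. P x \<in> S1_tensor"
    using P0(2) AE_\<Omega> by eventually_elim (use P0(1) in \<open>auto simp: C_eps_def\<close>)
  show "AE x in \<mu>. \<forall>i \<in> Z_eps \<epsilon> \<Omega>. x \<in> tile (- \<epsilon> / 2) \<epsilon> i \<longrightarrow> P x = tensor (u i) (u i)"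
    using P0(2) AE_\<Omega> by eventually_elim (use P0' in auto)
qed

lemma spin_field_S1: "spin_field \<epsilon> \<Omega> P u \<Longrightarrow> i \<in> Z_eps \<epsilon> \<Omega> \<Longrightarrow> u i \<in> S1"
  by (auto simp: spin_field_def)

lemma S1_tensor_K: "X \<in> S1_tensor \<Longrightarrow> X \<in> K_set" and norm_S1_tensor: "X \<in> S1_tensor \<Longrightarrow> norm X = 1"
  using tensor_in_K norm_tensor_S1 by (auto simp: S1_tensor_def)

text \<open>The threshold for \<epsilon> serves all P and u at once, and no convergence of P is
  involved; this is what lets the estimate pass to an infimum over a neighbourhood. The field p is
  frozen at the centre of each cell, and the cells near the boundary are charged to V.\<close>

lemma energy_liminf:
  fixes p :: "vec2 \<Rightarrow> real \<times> mat2"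
  assumes p: "continuous_on UNIV p" "\<And>x. p x \<in> affs f" "\<And>x. \<bar>fst (p x)\<bar> + norm (snd (p x)) \<le> S" and "e > 0"
  shows "\<forall>\<^sub>F \<epsilon> in at_right 0. \<forall>P u. P \<in> borel_measurable \<mu> \<longrightarrow> spin_field \<epsilon> \<Omega> P u \<longrightarrow>
    4 * (LINT x|\<mu>. fst (p x) + snd (p x) \<bullet> P x) - e \<le> \<epsilon>\<^sup>2 * energy f (Z_eps \<epsilon> \<Omega>) u"
proof -
  define A where "A = measure lebesgue \<Omega>"
  have "A \<ge> 0" by (simp add: A_def)
  have "S \<ge> 0" using p(3)[of 0] by (meson abs_ge_zero add_nonneg_nonneg norm_ge_zero order_trans)
  \<comment> \<open>Of the 12 S \<delta> in \<open>small\<close>, 4 come from outgoing bonds, 4 from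
    the integral outside the interior cells and 4 from the sites of boundary cells. The oscillation
    w is paid on the cells (4 w A) and on the bonds (2 w (A + \<delta>)).\<close>
  define \<delta> where "\<delta> = min 1 (e / (24 * (S + 1)))"
  define w where "w = e / (2 * (6 * A + 2))"
  have "\<delta> > 0" "w > 0" "\<delta> \<le> 1" using \<open>e > 0\<close> \<open>S \<ge> 0\<close> \<open>A \<ge> 0\<close> by (simp_all add: \<delta>_def w_def)
  have small: "12 * S * \<delta> + 2 * w * (A + \<delta>) + 4 * w * A \<le> e"
  proof -
    have "(S + 1) * \<delta> \<le> (S + 1) * (e / (24 * (S + 1)))" using \<open>S \<ge> 0\<close> by (intro mult_left_mono) (auto simp: \<delta>_def)
    also have "\<dots> = e / 24" using \<open>S \<ge> 0\<close> by (simp add: divide_simps)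
    finally have 1: "12 * S * \<delta> \<le> e / 2" using \<open>\<delta> > 0\<close> by (simp add: algebra_simps)
    have "2 * w * (A + \<delta>) + 4 * w * A = w * (6 * A + 2 * \<delta>)" by (simp add: algebra_simps)
    also have "\<dots> \<le> w * (6 * A + 2)" using \<open>w > 0\<close> \<open>\<delta> \<le> 1\<close> by (intro mult_left_mono) auto
    also have "\<dots> = e / 2" using \<open>A \<ge> 0\<close> by (simp add: w_def divide_simps)
    finally show ?thesis using 1 by linarith
  qed
  obtain r V where r: "r > 0" and V: "V \<in> lmeasurable" "measure lebesgue V < \<delta>"
    and layer: "\<And>x y z. y \<in> \<Omega> \<Longrightarrow> z \<notin> \<Omega> \<Longrightarrow> dist x y < r \<Longrightarrow> dist x z < r \<Longrightarrow> x \<in> V"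
    using thin_layer[OF bounded_\<Omega> negl_frontier \<open>\<delta> > 0\<close>] by metis
  have layer': "\<forall>x y z. y \<in> \<Omega> \<longrightarrow> z \<notin> \<Omega> \<longrightarrow> dist x y < r \<longrightarrow> dist x z < r \<longrightarrow> x \<in> V"
    using layer by blast
  have "uniformly_continuous_on (closure \<Omega>) p"
    using bounded_\<Omega> continuous_on_subset[OF p(1)] by (intro compact_uniformly_continuous) auto
  then obtain d where d: "d > 0" "\<And>x y. x \<in> closure \<Omega> \<Longrightarrow> y \<in> closure \<Omega> \<Longrightarrow> dist x y < d \<Longrightarrow> dist (p x) (p y) < w / 2"
    unfolding uniformly_continuous_on_def using \<open>w > 0\<close> by (metis half_gt_zero)
  have pw: "\<bar>fst (p x) - fst (p y)\<bar> + norm (snd (p x) - snd (p y)) \<le> w" if "x \<in> \<Omega>" "y \<in> \<Omega>" "dist x y < d" for x y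
  proof -
    have "dist (p x) (p y) < w / 2" using d(2) that closure_subset by blast
    then have "dist (fst (p x)) (fst (p y)) < w / 2" "dist (snd (p x)) (snd (p y)) < w / 2"
      using dist_fst_le dist_snd_le by (meson le_less_trans)+
    then show ?thesis by (simp add: dist_norm)
  qed
  have "\<forall>\<^sub>F \<epsilon> in at_right (0::real). \<epsilon> \<in> {0<..<min (d / 2) (r / 3)}"
    using d(1) r by (intro eventually_at_right_real) auto
  then show ?thesis
  proof eventually_elim
    case (elim \<epsilon>)
    \<comment> \<open>2 \<epsilon> bounds the diameter of a cell, and 3 \<epsilon> also reaches the
      neighbouring sites.\<close>
    then have \<epsilon>: "\<epsilon> > 0" "2 * \<epsilon> < d" "3 * \<epsilon> < r" by auto
    let ?B = "Z_eps \<epsilon> \<Omega>" and ?t = "tile (- \<epsilon> / 2) \<epsilon>"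
    define G where "G = {i \<in> ?B. ?t i \<subseteq> \<Omega>}"
    have fB: "finite ?B" and BZ: "?B \<subseteq> Z2" using finite_Z_eps[OF \<epsilon>(1)] Z_eps_Z2 by auto
    have fG: "finite G" and GB: "G \<subseteq> ?B" and GZ: "G \<subseteq> Z2" using fB BZ by (auto simp: G_def)
    have inB: "\<epsilon> *\<^sub>R i \<in> \<Omega>" if "i \<in> ?B" for i using that by (simp add: Z_eps_def)
    have bad: "?t i \<subseteq> V" if "i \<in> ?B - G" for i
      using that \<epsilon> inB center_in_cell[OF \<epsilon>(1)] by (intro tile_in_layer[OF layer']) (auto simp: G_def)
    have card_bad: "real (card (?B - G)) * \<epsilon>\<^sup>2 \<le> \<delta>"
    proof -
      have "real (card (?B - G)) * \<epsilon>\<^sup>2 \<le> measure lebesgue V"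
        using fB BZ bad V(1) by (intro card_tiles_le[OF \<epsilon>(1), of _ "- \<epsilon> / 2"]) auto
      then show ?thesis using V(2) by simp
    qed
    have card_G: "real (card G) * \<epsilon>\<^sup>2 \<le> A"
      unfolding A_def using fG GZ lmeas_\<Omega> by (intro card_tiles_le[OF \<epsilon>(1), of G "- \<epsilon> / 2"]) (auto simp: G_def)
    have card_B: "real (card ?B) * \<epsilon>\<^sup>2 \<le> A + \<delta>"
    proof -
      have "card ?B = card G + card (?B - G)" using fB GB card_mono[OF fB GB] by (simp add: card_Diff_subset[OF fG GB])
      then show ?thesis using card_bad card_G by (simp add: distrib_right)
    qed
    \<comment> \<open>A site that starts an outgoing bond has a neighbour outside \<Omega>, so its
      whole cell lies in V; it has four directions.\<close>
    have card_out: "real (card (outp ?B)) * \<epsilon>\<^sup>2 \<le> 4 * \<delta>"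
    proof -
      define E where "E = {i \<in> ?B. ?t i \<subseteq> V}"
      have "outp ?B \<subseteq> E \<times> nbs"
      proof clarify
        fix i \<xi> assume "(i, \<xi>) \<in> outp ?B"
        then have i: "i \<in> ?B" "\<xi> \<in> nbs" "i + \<xi> \<notin> ?B" by (auto simp: outp_def)
        have out: "\<epsilon> *\<^sub>R (i + \<xi>) \<notin> \<Omega>" using i BZ nbs_Z2 Z2_add by (auto simp: Z_eps_def)
        have "?t i \<subseteq> V"
        proof
          fix x assume x: "x \<in> ?t i"
          have 1: "dist x (\<epsilon> *\<^sub>R i) \<le> 2 * \<epsilon>" by (rule dist_tile[OF x center_in_cell[OF \<epsilon>(1)]])
          have "dist (\<epsilon> *\<^sub>R i) (\<epsilon> *\<^sub>R (i + \<xi>)) = \<epsilon>" using norm_nbs[OF i(2)] \<epsilon>(1) by (simp add: dist_norm scaleR_add_right)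
          then have "dist x (\<epsilon> *\<^sub>R (i + \<xi>)) \<le> 3 * \<epsilon>" using 1 dist_triangle[of x "\<epsilon> *\<^sub>R (i + \<xi>)" "\<epsilon> *\<^sub>R i"] by linarith
          then show "x \<in> V" using layer[OF inB[OF i(1)] out, of x] 1 \<epsilon> by linarith
        qed
        then show "i \<in> E \<and> \<xi> \<in> nbs" using i by (simp add: E_def)
      qed
      then have "card (outp ?B) \<le> card (E \<times> nbs)" using fB finite_nbs by (intro card_mono) (auto simp: E_def)
      then have "real (card (outp ?B)) \<le> 4 * real (card E)" by (simp add: card_cartesian_product card_nbs)
      then have "real (card (outp ?B)) * \<epsilon>\<^sup>2 \<le> 4 * real (card E) * \<epsilon>\<^sup>2" by (intro mult_right_mono) auto
      moreover have "real (card E) * \<epsilon>\<^sup>2 \<le> measure lebesgue V"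
        using fB BZ V by (intro card_tiles_le[OF \<epsilon>(1), of E "- \<epsilon> / 2"]) (auto simp: E_def)
      ultimately show ?thesis using V(2) by linarith
    qed
    show ?case
    proof (intro allI impI)
      fix P u assume Pm: "P \<in> borel_measurable \<mu>" and u: "spin_field \<epsilon> \<Omega> P u"
      define g where "g = (\<lambda>x. fst (p x) + snd (p x) \<bullet> P x)"
      define s where "s = (\<lambda>i. fst (p (\<epsilon> *\<^sub>R i)) + snd (p (\<epsilon> *\<^sub>R i)) \<bullet> tensor (u i) (u i))"
      note uS = spin_field_S1[OF u]
      have s_bd: "\<bar>s i\<bar> \<le> S" if "i \<in> ?B" for i
        unfolding s_def using p(3) uS[OF that] norm_tensor_S1 by (intro affine_field_bound) auto
      have "(\<lambda>x. fst (p x)) \<in> borel_measurable \<mu>" "(\<lambda>x. snd (p x)) \<in> borel_measurable \<mu>"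
        using p(1) by (auto intro!: continuous_measurable continuous_intros)
      then have gm: "g \<in> borel_measurable \<mu>"
        unfolding g_def using Pm by (intro borel_measurable_add borel_measurable_inner)
      have g_bd: "AE x in \<mu>. \<bar>g x\<bar> \<le> S"
        using spin_field_AE(1)[OF u \<epsilon>(1)]
        by eventually_elim (use p(3) norm_S1_tensor in \<open>simp add: g_def affine_field_bound\<close>)
      have tile_le: "(LINT x|\<mu>. indicator (?t i) x * g x) \<le> s i * \<epsilon>\<^sup>2 + w * \<epsilon>\<^sup>2" if i: "i \<in> G" for i
      proof -
        have iB: "i \<in> ?B" and ti: "?t i \<subseteq> \<Omega>" using i by (auto simp: G_def)
        have "(LINT x|\<mu>. indicator (?t i) x * g x) \<le> (LINT x|\<mu>. indicator (?t i) x * s i) + w * \<epsilon>\<^sup>2"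
        proof (rule integral_tile_approx[OF lmeas_\<Omega> ti \<epsilon>(1) gm g_bd _ _ \<open>S \<ge> 0\<close>])
          show "AE x in \<mu>. x \<in> ?t i \<longrightarrow> g x \<le> s i + w"
            using spin_field_AE(2)[OF u \<epsilon>(1)] AE_\<Omega>
          proof eventually_elim
            case (elim x)
            show ?case
            proof
              assume x: "x \<in> ?t i"
              then have Px: "P x = tensor (u i) (u i)" using elim iB by blast
              have "dist x (\<epsilon> *\<^sub>R i) < d" using dist_tile[OF x center_in_cell[OF \<epsilon>(1)]] \<epsilon>(2) by linarith
              then have "\<bar>fst (p x) - fst (p (\<epsilon> *\<^sub>R i))\<bar> + norm (snd (p x) - snd (p (\<epsilon> *\<^sub>R i))) \<le> w"
                using pw elim inB[OF iB] by blast
              then have "\<bar>(fst (p x) - fst (p (\<epsilon> *\<^sub>R i))) + (snd (p x) - snd (p (\<epsilon> *\<^sub>R i))) \<bullet> tensor (u i) (u i)\<bar> \<le> w"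
                using uS[OF iB] norm_tensor_S1 by (intro affine_field_bound) auto
              then show "g x \<le> s i + w" by (simp add: g_def s_def Px inner_diff_left abs_le_iff)
            qed
          qed
        qed (use s_bd[OF iB] in auto)
        then show ?thesis by (simp only: integral_tile_const[OF lmeas_\<Omega> ti \<epsilon>(1)])
      qed
      have "\<bar>(LINT x|\<mu>. g x) - (\<Sum>i\<in>G. LINT x|\<mu>. indicator (?t i) x * g x)\<bar> \<le> S * measure lebesgue V"
      proof (rule integral_tiles[OF lmeas_\<Omega> gm g_bd fG GZ \<epsilon>(1) V(1) _ \<open>S \<ge> 0\<close>])
        show "\<Omega> - (\<Union>j\<in>G. ?t j) \<subseteq> V"
        proof
          fix x assume x: "x \<in> \<Omega> - (\<Union>j\<in>G. ?t j)"
          define i where "i = idx (- \<epsilon> / 2) \<epsilon> x"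
          have xi: "x \<in> ?t i" unfolding i_def using mem_tile_idx[OF \<epsilon>(1)] .
          have "\<not> ?t i \<subseteq> \<Omega>"
          proof
            assume "?t i \<subseteq> \<Omega>"
            then have "i \<in> G" using center_in_cell[OF \<epsilon>(1), of i] by (auto simp: G_def Z_eps_def i_def)
            then show False using x xi by blast
          qed
          then show "x \<in> V" using tile_in_layer[OF layer', of \<epsilon> "- \<epsilon> / 2" i] xi x \<epsilon> by auto
        qed
      qed
      moreover have "S * measure lebesgue V \<le> S * \<delta>" using V(2) \<open>S \<ge> 0\<close> by (intro mult_left_mono) auto
      moreover have "(\<Sum>i\<in>G. LINT x|\<mu>. indicator (?t i) x * g x) \<le> (\<Sum>i\<in>G. s i * \<epsilon>\<^sup>2 + w * \<epsilon>\<^sup>2)"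
        by (intro sum_mono tile_le)
      moreover have "(\<Sum>i\<in>G. s i * \<epsilon>\<^sup>2 + w * \<epsilon>\<^sup>2) = \<epsilon>\<^sup>2 * (\<Sum>i\<in>G. s i) + w * (real (card G) * \<epsilon>\<^sup>2)"
        by (simp add: sum.distrib sum_distrib_right mult.commute[of "\<epsilon>\<^sup>2"])
      moreover have "w * (real (card G) * \<epsilon>\<^sup>2) \<le> w * A" using card_G \<open>w > 0\<close> by (intro mult_left_mono) auto
      ultimately have int_le: "(LINT x|\<mu>. g x) \<le> \<epsilon>\<^sup>2 * (\<Sum>i\<in>G. s i) + w * A + S * \<delta>" by linarith
      \<comment> \<open>The sites of boundary cells rejoin the sum at the price S each.\<close>
      have sum_split: "\<epsilon>\<^sup>2 * (\<Sum>i\<in>G. s i) \<le> \<epsilon>\<^sup>2 * (\<Sum>i\<in>?B. s i) + S * \<delta>"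
      proof -
        have "(\<Sum>i\<in>?B. s i) = (\<Sum>i\<in>?B - G. s i) + (\<Sum>i\<in>G. s i)" by (rule sum.subset_diff[OF GB fB])
        moreover have "(\<Sum>i\<in>?B - G. - S) \<le> (\<Sum>i\<in>?B - G. s i)" using s_bd by (intro sum_mono) (force simp: abs_le_iff)
        ultimately have "\<epsilon>\<^sup>2 * ((\<Sum>i\<in>G. s i) - real (card (?B - G)) * S) \<le> \<epsilon>\<^sup>2 * (\<Sum>i\<in>?B. s i)"
          by (intro mult_left_mono) auto
        moreover have "S * (real (card (?B - G)) * \<epsilon>\<^sup>2) \<le> S * \<delta>" using card_bad \<open>S \<ge> 0\<close> by (intro mult_left_mono)
        ultimately show ?thesis by (simp add: algebra_simps)
      qed
      have "4 * (\<Sum>i\<in>?B. s i) - S * card (outp ?B) - 2 * w * card ?B \<le> energy f ?B u"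
        unfolding s_def
      proof (rule energy_lower[OF fB BZ uS])
        show "(fst (p (\<epsilon> *\<^sub>R i)), snd (p (\<epsilon> *\<^sub>R i))) \<in> affs f" for i using p(2) by simp
        show "norm (snd (p (\<epsilon> *\<^sub>R i)) - snd (p (\<epsilon> *\<^sub>R j))) \<le> w" if "i \<in> ?B" "j \<in> ?B" "norm (i - j) = 1" for i j
        proof -
          have "dist (\<epsilon> *\<^sub>R i) (\<epsilon> *\<^sub>R j) = \<epsilon>" using that(3) \<epsilon>(1) by (simp add: dist_norm flip: scaleR_diff_right)
          then show ?thesis using pw[OF inB[OF that(1)] inB[OF that(2)]] \<epsilon> by force
        qed
        show "\<bar>fst (p (\<epsilon> *\<^sub>R i)) + snd (p (\<epsilon> *\<^sub>R i)) \<bullet> tensor (u i) (u i)\<bar> \<le> S" if "i \<in> ?B" for i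
          using s_bd[OF that] by (simp add: s_def)
      qed (use \<open>w > 0\<close> in auto)
      then have "\<epsilon>\<^sup>2 * (4 * (\<Sum>i\<in>?B. s i) - S * card (outp ?B) - 2 * w * card ?B) \<le> \<epsilon>\<^sup>2 * energy f ?B u"
        by (intro mult_left_mono) auto
      moreover have "S * (real (card (outp ?B)) * \<epsilon>\<^sup>2) \<le> S * (4 * \<delta>)" using card_out \<open>S \<ge> 0\<close> by (intro mult_left_mono)
      moreover have "2 * w * (real (card ?B) * \<epsilon>\<^sup>2) \<le> 2 * w * (A + \<delta>)" using card_B \<open>w > 0\<close> by (intro mult_left_mono) auto
      ultimately have "4 * (\<epsilon>\<^sup>2 * (\<Sum>i\<in>?B. s i)) - 4 * S * \<delta> - 2 * w * (A + \<delta>) \<le> \<epsilon>\<^sup>2 * energy f ?B u"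
        by (simp add: algebra_simps)
      then have "4 * (LINT x|\<mu>. g x) - (12 * S * \<delta> + 2 * w * (A + \<delta>) + 4 * w * A) \<le> \<epsilon>\<^sup>2 * energy f ?B u"
        using int_le sum_split by (simp add: algebra_simps)
      then show "4 * (LINT x|\<mu>. fst (p x) + snd (p x) \<bullet> P x) - e \<le> \<epsilon>\<^sup>2 * energy f ?B u"
        using small by (simp add: g_def)
    qed
  qed
qed

end

section \<open>Recovery sequences\<close>

context spin_domain begin

text \<open>Two spin fields of the same class have equal tensors at every site, because both tensors
  agree with P almost everywhere on the part of the cell in \<Omega>, which has positive measure.
  Hence the value of the \<open>SOME\<close> in \<open>F_eps\<close> does not matter.\<close>

lemma F_eps_spin_field:
  assumes u: "spin_field \<epsilon> \<Omega> P u" and \<epsilon>: "\<epsilon> > 0"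
  shows "F_eps f \<Omega> \<epsilon> P = ereal (\<epsilon>\<^sup>2 * energy f (Z_eps \<epsilon> \<Omega>) u)"
proof -
  define v where "v = (SOME u. spin_field \<epsilon> \<Omega> P u)"
  have v: "spin_field \<epsilon> \<Omega> P v" using someI[of "spin_field \<epsilon> \<Omega> P" u] u by (simp add: v_def)
  have T: "tensor (v i) (v i) = tensor (u i) (u i)" if i: "i \<in> Z_eps \<epsilon> \<Omega>" for i
  proof (rule ccontr)
    assume ne: "tensor (v i) (v i) \<noteq> tensor (u i) (u i)"
    have "AE x in \<mu>. x \<notin> tile (- \<epsilon> / 2) \<epsilon> i"
      using spin_field_AE(2)[OF u \<epsilon>] spin_field_AE(2)[OF v \<epsilon>] by eventually_elim (use ne i in metis)
    then have AE: "AE x in lebesgue. x \<in> \<Omega> \<longrightarrow> x \<notin> tile (- \<epsilon> / 2) \<epsilon> i"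
      using sets_\<Omega> by (simp add: AE_restrict_space_iff)
    \<comment> \<open>The ball stays inside the cell, and its intersection with \<Omega> is open and
      contains the centre, so it is not negligible.\<close>
    define Oi where "Oi = \<Omega> \<inter> ball (\<epsilon> *\<^sub>R i) (\<epsilon> / 4)"
    have near: "x \<in> tile (- \<epsilon> / 2) \<epsilon> i" if "x \<in> ball (\<epsilon> *\<^sub>R i) (\<epsilon> / 4)" for x
    proof -
      have "\<bar>x$k - \<epsilon> * i$k\<bar> < \<epsilon> / 4" for k
        using that component_le_norm_cart[of "\<epsilon> *\<^sub>R i - x" k] by (simp add: dist_norm abs_minus_commute)
      then show ?thesis using \<epsilon> unfolding tile_def by (simp add: abs_less_iff) (smt (verit) field_sum_of_halves)
    qed
    have "AE x in lebesgue. x \<notin> Oi" using AE by eventually_elim (use near in \<open>auto simp: Oi_def\<close>)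
    moreover have "open Oi" using open_\<Omega> by (auto simp: Oi_def)
    ultimately have "negligible Oi" by (simp add: negligible_iff_null_sets AE_iff_null_sets borel_open)
    moreover have "Oi \<noteq> {}" using i \<epsilon> by (auto simp: Oi_def Z_eps_def)
    ultimately show False using open_not_negligible \<open>open Oi\<close> by blast
  qed
  have "(\<Sum>(i, j) \<in> bonds (Z_eps \<epsilon> \<Omega>). \<epsilon>\<^sup>2 * f (v i) (v j)) = (\<Sum>(i, j) \<in> bonds (Z_eps \<epsilon> \<Omega>). \<epsilon>\<^sup>2 * f (u i) (u j))"
  proof (rule sum.cong, simp, clarify)
    fix i j assume "(i, j) \<in> bonds (Z_eps \<epsilon> \<Omega>)"
    then have ij: "i \<in> Z_eps \<epsilon> \<Omega>" "j \<in> Z_eps \<epsilon> \<Omega>" by (auto simp: bonds_def)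
    have "f (v i) (v j) = f (u i) (u j)"
      using ij T spin_field_S1[OF u] spin_field_S1[OF v] by (intro f_tensor_cong) auto
    then show "\<epsilon>\<^sup>2 * f (v i) (v j) = \<epsilon>\<^sup>2 * f (u i) (u j)" by simp
  qed
  also have "\<dots> = \<epsilon>\<^sup>2 * energy f (Z_eps \<epsilon> \<Omega>) u"
    by (simp add: energy_def sum_distrib_left case_prod_unfold)
  finally show ?thesis using u unfolding F_eps_def v_def bonds_def by (auto simp: Let_def)
qed

lemma F_eps_infinite: "\<not> (\<exists>u. spin_field \<epsilon> \<Omega> P u) \<Longrightarrow> F_eps f \<Omega> \<epsilon> P = \<infinity>"
  by (simp add: F_eps_def)

text \<open>Membership in K and Jensen's inequality are both obtained by testing: K is given by
  linear conditions, and \<open>env\<close> is a supremum of affine functions, each of which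
  commutes with the average.\<close>

lemma tile_average:
  fixes Q :: "vec2 \<Rightarrow> mat2"
  assumes Q: "Q \<in> borel_measurable \<mu>" "AE x in \<mu>. Q x \<in> K_set"
    and t: "tile c \<eta> j \<subseteq> \<Omega>" "\<eta> > 0"
  defines "X \<equiv> (1 / \<eta>\<^sup>2) *\<^sub>R (LINT x|\<mu>. indicator (tile c \<eta> j) x *\<^sub>R Q x)"
  shows "\<And>v. (LINT x|\<mu>. indicator (tile c \<eta> j) x * (Q x \<bullet> v)) = (X \<bullet> v) * \<eta>\<^sup>2"
    and "X \<in> K_set"
    and "env f X * \<eta>\<^sup>2 \<le> (LINT x|\<mu>. indicator (tile c \<eta> j) x * envK (Q x))"
proof -
  let ?i = "indicator (tile c \<eta> j) :: vec2 \<Rightarrow> real"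
  have im: "?i \<in> borel_measurable \<mu>"
    using fmeasurableD[OF tile_lmeasurable] by (intro measurable_restrict_space1) simp
  have bi: "integrable \<mu> (\<lambda>x. ?i x * g x)" if "g \<in> borel_measurable \<mu>" "AE x in \<mu>. \<bar>g x\<bar> \<le> S" for g S
  proof (rule bounded_integrable[of _ "S"])
    show "(\<lambda>x. ?i x * g x) \<in> borel_measurable \<mu>" using im that(1) by (rule borel_measurable_times)
    show "AE x in \<mu>. \<bar>?i x * g x\<bar> \<le> S"
      using that(2) by eventually_elim (auto simp: indicator_def)
  qed
  have int: "integrable \<mu> (\<lambda>x. ?i x *\<^sub>R Q x)"
  proof (rule integrable_const_bound[where B = 1])
    show "AE x in \<mu>. norm (?i x *\<^sub>R Q x) \<le> 1"
      using Q(2) by eventually_elim (use norm_K_le_1 in \<open>auto simp: indicator_def\<close>)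
    show "(\<lambda>x. ?i x *\<^sub>R Q x) \<in> borel_measurable \<mu>" using im Q(1) by (rule borel_measurable_scaleR)
  qed
  show avg: "(LINT x|\<mu>. ?i x * (Q x \<bullet> v)) = (X \<bullet> v) * \<eta>\<^sup>2" for v
  proof -
    have "(LINT x|\<mu>. ?i x * (Q x \<bullet> v)) = (LINT x|\<mu>. (?i x *\<^sub>R Q x) \<bullet> v)" by simp
    also have "\<dots> = (LINT x|\<mu>. ?i x *\<^sub>R Q x) \<bullet> v" using int by (intro integral_inner_left) auto
    also have "\<dots> = (X \<bullet> v) * \<eta>\<^sup>2" using t(2) by (simp add: X_def)
    finally show ?thesis .
  qed
  have \<eta>2: "\<eta>\<^sup>2 > 0" using t(2) by simp
  have one: "(LINT x|\<mu>. ?i x * a) = a * \<eta>\<^sup>2" for a by (rule integral_tile_const[OF lmeas_\<Omega> t])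
  have "(X \<bullet> v) * \<eta>\<^sup>2 = a * \<eta>\<^sup>2" if "\<And>Y. Y \<in> K_set \<Longrightarrow> Y \<bullet> v = a" for v a
  proof -
    have "(LINT x|\<mu>. ?i x * (Q x \<bullet> v)) = (LINT x|\<mu>. ?i x * a)"
    proof (rule integral_cong_AE)
      show "AE x in \<mu>. ?i x * (Q x \<bullet> v) = ?i x * a"
        using Q(2) by eventually_elim (use that in simp)
      show "(\<lambda>x. ?i x * (Q x \<bullet> v)) \<in> borel_measurable \<mu>"
        using im Q(1) by (intro borel_measurable_times borel_measurable_inner) auto
    qed (use im in auto)
    then show ?thesis by (simp only: avg one)
  qed
  then have e: "X \<bullet> v = a" if "\<And>Y. Y \<in> K_set \<Longrightarrow> Y \<bullet> v = a" for v a using that \<eta>2 by (metis mult_right_cancel less_irrefl)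
  have p: "0 \<le> X \<bullet> tensor y y" for y
  proof -
    have "0 \<le> (LINT x|\<mu>. ?i x * (Q x \<bullet> tensor y y))"
      by (rule integral_nonneg_AE) (use Q(2) in \<open>eventually_elim, auto simp: K_set_iff\<close>)
    then show ?thesis unfolding avg using \<eta>2 by (simp add: zero_le_mult_iff)
  qed
  show XK: "X \<in> K_set" unfolding K_set_iff using e p by (auto simp: K_set_iff)
  show "env f X * \<eta>\<^sup>2 \<le> (LINT x|\<mu>. ?i x * envK (Q x))"
  proof -
    have Em: "(\<lambda>x. envK (Q x)) \<in> borel_measurable \<mu>" using measurable_compose[OF Q(1) envK_borel] .
    have Ei: "integrable \<mu> (\<lambda>x. ?i x * envK (Q x))" using Em envK_bound by (intro bi[of _ C]) auto
    have "env f X \<le> (LINT x|\<mu>. ?i x * envK (Q x)) / \<eta>\<^sup>2"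
    proof (rule env_le)
      fix a M assume aM: "(a, M) \<in> affs f"
      have i2: "integrable \<mu> (\<lambda>x. ?i x * (Q x \<bullet> M))"
      proof (rule bi[of _ "norm M"])
        show "AE x in \<mu>. \<bar>Q x \<bullet> M\<bar> \<le> norm M"
          using Q(2)
        proof eventually_elim
          case (elim x)
          then show ?case using Cauchy_Schwarz_ineq2[of "Q x" M] norm_K_le_1[OF elim]
            by (meson mult_left_le_one_le norm_ge_zero order_trans)
        qed
      qed (use Q(1) in \<open>intro borel_measurable_inner, auto\<close>)
      have i1: "integrable \<mu> (\<lambda>x. ?i x * a)" by (rule bi[of _ "\<bar>a\<bar>"]) auto
      have "(a + M \<bullet> X) * \<eta>\<^sup>2 = (LINT x|\<mu>. ?i x * a) + (LINT x|\<mu>. ?i x * (Q x \<bullet> M))"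
        by (simp only: avg one) (simp add: distrib_right inner_commute)
      also have "\<dots> = (LINT x|\<mu>. ?i x * a + ?i x * (Q x \<bullet> M))"
        using i1 i2 by (rule Bochner_Integration.integral_add[symmetric])
      also have "\<dots> \<le> (LINT x|\<mu>. ?i x * envK (Q x))"
      proof (rule integral_mono_AE)
        show "AE x in \<mu>. ?i x * a + ?i x * (Q x \<bullet> M) \<le> ?i x * envK (Q x)"
          using Q(2) by eventually_elim
            (use affs_le_env[OF aM] in \<open>auto simp: indicator_def envK_def inner_commute[of _ M]\<close>)
      qed (use Ei i1 i2 in auto)
      finally show "a + M \<bullet> X \<le> (LINT x|\<mu>. ?i x * envK (Q x)) / \<eta>\<^sup>2" using \<eta>2 by (simp add: field_simps)
    qed
    then show ?thesis using \<eta>2 by (simp add: field_simps)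
  qed
qed

section \<open>Fields constant on cells, and blocks of cells\<close>

lemma cell_function_borel: "\<epsilon> > 0 \<Longrightarrow> (\<lambda>x. h (idx c \<epsilon> x)) \<in> borel_measurable borel"
proof (rule measurableI)
  fix S :: "'a set" assume \<epsilon>: "\<epsilon> > 0"
  have "countable Z2"
  proof (rule countable_subset)
    show "Z2 \<subseteq> (\<lambda>(x, y). site x y) ` UNIV"
      using Z2_site by (metis (mono_tags, lifting) UNIV_I case_prod_conv image_eqI subsetI)
  qed auto
  then have "(\<Union>i \<in> {i \<in> Z2. h i \<in> S}. tile c \<epsilon> i) \<in> sets borel"
    by (intro sets.countable_UN' tile_borel) (auto intro: countable_subset tile_borel)
  moreover have "(\<lambda>x. h (idx c \<epsilon> x)) -` S \<inter> space borel = (\<Union>i \<in> {i \<in> Z2. h i \<in> S}. tile c \<epsilon> i)"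
    using tile_iff_idx[OF \<epsilon>, of _ _ c] by auto
  ultimately show "(\<lambda>x. h (idx c \<epsilon> x)) -` S \<inter> space borel \<in> sets borel" by simp
qed simp

text \<open>Defined on the whole plane, because cells that meet \<Omega> but have their centre
  outside also need a value in \<open>S1_tensor\<close>.\<close>

definition cell_field :: "real \<Rightarrow> (vec2 \<Rightarrow> vec2) \<Rightarrow> vec2 \<Rightarrow> mat2" where
  "cell_field \<epsilon> u x = tensor (u (idx (- \<epsilon> / 2) \<epsilon> x)) (u (idx (- \<epsilon> / 2) \<epsilon> x))"

lemma cell_field_props:
  assumes \<epsilon>: "\<epsilon> > 0" and u: "\<And>i. u i \<in> S1"
  shows "cell_field \<epsilon> u \<in> borel_measurable \<mu>" "cell_field \<epsilon> u \<in> Linf \<Omega>"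
    "spin_field \<epsilon> \<Omega> (cell_field \<epsilon> u) u" "cell_field \<epsilon> u x \<in> S1_tensor"
    "i \<in> Z2 \<Longrightarrow> x \<in> tile (- \<epsilon> / 2) \<epsilon> i \<Longrightarrow> cell_field \<epsilon> u x = tensor (u i) (u i)"
proof -
  have "cell_field \<epsilon> u \<in> borel_measurable borel"
    unfolding cell_field_def[abs_def] by (rule cell_function_borel[OF \<epsilon>, of "\<lambda>i. tensor (u i) (u i)"])
  then show m: "cell_field \<epsilon> u \<in> borel_measurable \<mu>"
    by (intro measurable_restrict_space1 measurable_completion) simp
  show S1: "cell_field \<epsilon> u x \<in> S1_tensor" for x using u by (auto simp: cell_field_def S1_tensor_def)
  show t: "cell_field \<epsilon> u x = tensor (u i) (u i)" if "i \<in> Z2" "x \<in> tile (- \<epsilon> / 2) \<epsilon> i" for x i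
    using tile_iff_idx[OF \<epsilon> that(1)] that(2) by (simp add: cell_field_def)
  show "cell_field \<epsilon> u \<in> Linf \<Omega>"
    unfolding Linf_def using m S1 S1_tensor_K K_sub_sym norm_S1_tensor
    by (auto intro!: AE_I2 exI[of _ 1] simp: order_eq_iff) 
  have "cell_field \<epsilon> u x = cell_field \<epsilon> u (\<epsilon> *\<^sub>R i)" if "i \<in> Z_eps \<epsilon> \<Omega>" "x \<in> (\<lambda>y. \<epsilon> *\<^sub>R (i + y)) ` W" for i x
    using that t[of i] center_in_cell[OF \<epsilon>, of i] by (auto simp: Z_eps_def simp flip: cell_eq[OF \<epsilon>])
  then have "cell_field \<epsilon> u \<in> C_eps \<epsilon> \<Omega>" using S1 by (auto simp: C_eps_def)
  then show "spin_field \<epsilon> \<Omega> (cell_field \<epsilon> u) u"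
    unfolding spin_field_def using u t center_in_cell[OF \<epsilon>]
    by (intro bexI[of _ "cell_field \<epsilon> u"]) (auto simp: Z_eps_def)
qed

definition blk :: "nat \<Rightarrow> vec2 \<Rightarrow> vec2 set" where
  "blk p j = rect (int p * \<lfloor>j$1\<rfloor>) (int p * \<lfloor>j$2\<rfloor>) p p"

text \<open>Tiles start half a cell before a site, so the edges of a block lie midway between
  neighbouring sites. The real inequalities then reduce to integer ones, and no cell straddles two
  blocks.\<close>

lemma blk_iff:
  assumes "\<epsilon> > 0" "j \<in> Z2" "i \<in> Z2"
  shows "i \<in> blk p j \<longleftrightarrow> \<epsilon> *\<^sub>R i \<in> tile (- \<epsilon> / 2) (real p * \<epsilon>) j"
    and "i \<in> blk p j \<Longrightarrow> tile (- \<epsilon> / 2) \<epsilon> i \<subseteq> tile (- \<epsilon> / 2) (real p * \<epsilon>) j"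
proof -
  obtain a b x y where ij: "j = site a b" "i = site x y" using assms Z2_site by metis
  have 1: "(- \<epsilon> / 2 + real p * \<epsilon> * of_int c \<le> \<epsilon> * of_int z \<and> \<epsilon> * of_int z < - \<epsilon> / 2 + real p * \<epsilon> * of_int c + real p * \<epsilon>)
    \<longleftrightarrow> int p * c \<le> z \<and> z < int p * c + int p" for c z :: int
  proof -
    have "- \<epsilon> / 2 + real p * \<epsilon> * of_int c = \<epsilon> * (of_int (int p * c) - 1/2)"
      "- \<epsilon> / 2 + real p * \<epsilon> * of_int c + real p * \<epsilon> = \<epsilon> * (of_int (int p * c + int p) - 1/2)"
      by (simp_all add: algebra_simps)
    then have "(- \<epsilon> / 2 + real p * \<epsilon> * of_int c \<le> \<epsilon> * of_int z \<and> \<epsilon> * of_int z < - \<epsilon> / 2 + real p * \<epsilon> * of_int c + real p * \<epsilon>)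
      \<longleftrightarrow> real_of_int (int p * c) - 1/2 \<le> of_int z \<and> of_int z < real_of_int (int p * c + int p) - 1/2"
      using assms(1) by (simp only: mult_le_cancel_left_pos mult_less_cancel_left_pos)
    also have "\<dots> \<longleftrightarrow> int p * c \<le> z \<and> z < int p * c + int p" by linarith
    finally show ?thesis .
  qed
  show "i \<in> blk p j \<longleftrightarrow> \<epsilon> *\<^sub>R i \<in> tile (- \<epsilon> / 2) (real p * \<epsilon>) j"
    using 1[of a x] 1[of b y] by (auto simp: blk_def tile_def ij forall_2)
  have 2: "- \<epsilon> / 2 + real p * \<epsilon> * of_int c \<le> t \<and> t < - \<epsilon> / 2 + real p * \<epsilon> * of_int c + real p * \<epsilon>"
    if "- \<epsilon> / 2 + \<epsilon> * of_int z \<le> t" "t < - \<epsilon> / 2 + \<epsilon> * of_int z + \<epsilon>" "int p * c \<le> z" "z < int p * c + int p" for c z :: int and t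
  proof -
    have "real_of_int (int p * c) \<le> of_int z" "real_of_int z + 1 \<le> of_int (int p * c + int p)" using that(3,4) by linarith+
    then have "\<epsilon> * real_of_int (int p * c) \<le> \<epsilon> * of_int z" "\<epsilon> * (real_of_int z + 1) \<le> \<epsilon> * of_int (int p * c + int p)"
      using assms(1) by (simp_all only: mult_le_cancel_left_pos)
    moreover have "\<epsilon> * real_of_int (int p * c) = real p * \<epsilon> * of_int c"
      "\<epsilon> * real_of_int (int p * c + int p) = real p * \<epsilon> * of_int c + real p * \<epsilon>"
      "\<epsilon> * (real_of_int z + 1) = \<epsilon> * of_int z + \<epsilon>" by (simp_all add: algebra_simps)
    ultimately show ?thesis using that(1,2) by linarith
  qed
  assume "i \<in> blk p j"
  then show "tile (- \<epsilon> / 2) \<epsilon> i \<subseteq> tile (- \<epsilon> / 2) (real p * \<epsilon>) j"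
    using 2[of x _ a] 2[of y _ b] by (auto simp: blk_def tile_def ij forall_2)
qed

lemma blk_props: "finite (blk p j)" "blk p j \<subseteq> Z2" "card (blk p j) = p * p"
  "real (card (outp (blk p j))) \<le> 4 * real p"
  using rect_props real_card_outp_rect[of "int p * \<lfloor>j$1\<rfloor>" "int p * \<lfloor>j$2\<rfloor>" p p] by (simp_all add: blk_def)

lemma tile_nonempty: "\<eta> > 0 \<Longrightarrow> (\<chi> k. c + \<eta> * j$k) \<in> tile c \<eta> j"
  by (simp add: tile_def)

lemma idx_in_blk:
  assumes "\<epsilon> > 0" "p > 0" "j \<in> Z2"
  shows "idx (- \<epsilon> / 2) \<epsilon> x \<in> blk p j \<longleftrightarrow> x \<in> tile (- \<epsilon> / 2) (real p * \<epsilon>) j"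
proof -
  define i where "i = idx (- \<epsilon> / 2) \<epsilon> x"
  have i: "i \<in> Z2" "x \<in> tile (- \<epsilon> / 2) \<epsilon> i" using mem_tile_idx[OF assms(1)] by (auto simp: i_def)
  have \<eta>: "real p * \<epsilon> > 0" using assms by simp
  define j' where "j' = idx (- \<epsilon> / 2) (real p * \<epsilon>) (\<epsilon> *\<^sub>R i)"
  have "i \<in> blk p j'" unfolding blk_iff(1)[OF assms(1) idx_Z2 i(1), of p, folded j'_def] j'_def by (rule mem_tile_idx[OF \<eta>])
  have "j' \<in> Z2" by (simp add: j'_def)
  have x: "x \<in> tile (- \<epsilon> / 2) (real p * \<epsilon>) j'"
    by (rule subsetD[OF blk_iff(2)[OF assms(1) \<open>j' \<in> Z2\<close> i(1) \<open>i \<in> blk p j'\<close>] i(2)])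
  show ?thesis
  proof
    assume "idx (- \<epsilon> / 2) \<epsilon> x \<in> blk p j"
    then show "x \<in> tile (- \<epsilon> / 2) (real p * \<epsilon>) j" using blk_iff(2)[OF assms(1,3) i(1)] i(2) by (auto simp: i_def)
  next
    assume "x \<in> tile (- \<epsilon> / 2) (real p * \<epsilon>) j"
    then have "j = j'" using x tile_disjoint[OF \<eta> \<open>j' \<in> Z2\<close> assms(3)] by blast
    then show "idx (- \<epsilon> / 2) \<epsilon> x \<in> blk p j" using \<open>i \<in> blk p j'\<close> by (simp add: i_def)
  qed
qed

text \<open>The block is the disjoint union of the cells of its sites, each of area \<epsilon>^2 and
  contained in \<Omega>.\<close>

lemma integral_cell_field:
  assumes "\<epsilon> > 0" "p > 0" "j \<in> Z2" and sub: "tile (- \<epsilon> / 2) (real p * \<epsilon>) j \<subseteq> \<Omega>" and u: "\<And>i. u i \<in> S1"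
  shows "(LINT x|\<mu>. indicator (tile (- \<epsilon> / 2) (real p * \<epsilon>) j) x * (cell_field \<epsilon> u x \<bullet> v))
    = \<epsilon>\<^sup>2 * ((\<Sum>i \<in> blk p j. tensor (u i) (u i)) \<bullet> v)"
proof -
  let ?t = "tile (- \<epsilon> / 2) \<epsilon>" and ?R = "tile (- \<epsilon> / 2) (real p * \<epsilon>) j"
  have "indicator ?R x * (cell_field \<epsilon> u x \<bullet> v) = (\<Sum>i \<in> blk p j. indicator (?t i) x * (tensor (u i) (u i) \<bullet> v))" for x
  proof -
    have "(\<Sum>i \<in> blk p j. indicator (?t i) x * (tensor (u i) (u i) \<bullet> v))
      = (\<Sum>i \<in> blk p j. if idx (- \<epsilon> / 2) \<epsilon> x = i then cell_field \<epsilon> u x \<bullet> v else 0)"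
      using blk_props(2) assms(1) by (intro sum.cong refl) (auto simp: indicator_def tile_iff_idx cell_field_def subset_iff)
    then show ?thesis using idx_in_blk[OF assms(1-3), of x] by (simp add: sum.delta' blk_props)
  qed
  then have "(LINT x|\<mu>. indicator ?R x * (cell_field \<epsilon> u x \<bullet> v))
    = (LINT x|\<mu>. (\<Sum>i \<in> blk p j. indicator (?t i) x * (tensor (u i) (u i) \<bullet> v)))" by simp
  also have "\<dots> = (\<Sum>i \<in> blk p j. LINT x|\<mu>. indicator (?t i) x * (tensor (u i) (u i) \<bullet> v))"
  proof (rule Bochner_Integration.integral_sum)
    fix i
    have "(indicator (?t i) :: vec2 \<Rightarrow> real) \<in> borel_measurable \<mu>"
      using fmeasurableD[OF tile_lmeasurable] by (intro measurable_restrict_space1) simp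
    then have "(\<lambda>x. indicator (?t i) x * (tensor (u i) (u i) \<bullet> v)) \<in> borel_measurable \<mu>"
      by (rule borel_measurable_times) simp
    then show "integrable \<mu> (\<lambda>x. indicator (?t i) x * (tensor (u i) (u i) \<bullet> v))"
      by (rule bounded_integrable[of _ "\<bar>tensor (u i) (u i) \<bullet> v\<bar>"]) (auto intro!: AE_I2 simp: indicator_def)
  qed
  also have "\<dots> = (\<Sum>i \<in> blk p j. (tensor (u i) (u i) \<bullet> v) * \<epsilon>\<^sup>2)"
  proof (intro sum.cong refl integral_tile_const[OF lmeas_\<Omega> _ assms(1)])
    fix i assume "i \<in> blk p j"
    then show "?t i \<subseteq> \<Omega>" using blk_iff(2)[OF assms(1,3)] blk_props(2) sub by (meson subset_iff)
  qed
  finally show ?thesis by (simp add: inner_sum_left sum_distrib_left mult.commute)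
qed

lemma pattern_cong:
  assumes "pattern \<delta> X t B u" "\<And>i. i \<in> B \<Longrightarrow> u' i = u i" "\<And>i. u' i \<in> S1"
  shows "pattern \<delta> X t B u'"
proof -
  have "(\<Sum>i \<in> B. tensor (u' i) (u' i)) = (\<Sum>i \<in> B. tensor (u i) (u i))" using assms(2) by (intro sum.cong) auto
  moreover have "energy f B u' = energy f B u" using assms(2) by (rule energy_cong)
  ultimately show ?thesis using assms(1,3) by (simp add: pattern_def)
qed

text \<open>On each mesoscopic block of \<open>p \<times> p\<close> cells inside \<open>\<Omega>\<close> the recovery field is a pattern for the
  average of \<open>Q\<close> over the block; Jensen's inequality controls its energy.\<close>

lemma recovery_fields:
  fixes Q :: "vec2 \<Rightarrow> mat2"
  assumes Q: "Q \<in> borel_measurable \<mu>" "AE x in \<mu>. Q x \<in> K_set" and "\<delta> > 0"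
  obtains u :: "real \<Rightarrow> vec2 \<Rightarrow> vec2" where "\<And>\<epsilon> i. u \<epsilon> i \<in> S1"
    "\<forall>\<^sub>F \<epsilon> in at_right 0. \<epsilon>\<^sup>2 * energy f (Z_eps \<epsilon> \<Omega>) (u \<epsilon>) \<le> 4 * (LINT x|\<mu>. envK (Q x)) + \<delta>"
    "\<And>\<psi> S. continuous_on UNIV \<psi> \<Longrightarrow> (\<And>x. norm (\<psi> x) \<le> S) \<Longrightarrow>
      \<forall>\<^sub>F \<epsilon> in at_right 0. (LINT x|\<mu>. (cell_field \<epsilon> (u \<epsilon>) x - Q x) \<bullet> \<psi> x) \<le> \<delta> * (S + 1)"
proof -
  define A where "A = measure lebesgue \<Omega>"
  have "A \<ge> 0" by (simp add: A_def)
  \<comment> \<open>\<delta>1 is the tolerance of the patterns, charged to the whole area A;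
    \<delta>2 bounds the measure of the boundary layer, charged at 8 C per unit.\<close>
  define \<delta>1 where "\<delta>1 = \<delta> / (4 * (A + 1))"
  define \<delta>2 where "\<delta>2 = \<delta> / (32 * (C + 1))"
  have \<delta>1: "\<delta>1 > 0" "\<delta>1 * A \<le> \<delta> / 4"
  proof -
    show "\<delta>1 > 0" using \<open>\<delta> > 0\<close> \<open>A \<ge> 0\<close> by (simp add: \<delta>1_def)
    then have "\<delta>1 * A \<le> \<delta>1 * (A + 1)" by simp
    also have "\<dots> = \<delta> / 4" using \<open>A \<ge> 0\<close> by (simp add: \<delta>1_def divide_simps)
    finally show "\<delta>1 * A \<le> \<delta> / 4" .
  qed
  have \<delta>2: "\<delta>2 > 0" "8 * C * \<delta>2 \<le> \<delta> / 4" "2 * \<delta>2 \<le> \<delta> / 4"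
  proof -
    show p: "\<delta>2 > 0" using \<open>\<delta> > 0\<close> C_nonneg by (simp add: \<delta>2_def)
    have "8 * (C + 1) * \<delta>2 = \<delta> / 4" using C_nonneg by (simp add: \<delta>2_def divide_simps)
    moreover have "8 * (C + 1) * \<delta>2 = 8 * C * \<delta>2 + 8 * \<delta>2" by (simp add: algebra_simps)
    moreover have "0 \<le> 8 * C * \<delta>2" using p C_nonneg by simp
    ultimately show "8 * C * \<delta>2 \<le> \<delta> / 4" "2 * \<delta>2 \<le> \<delta> / 4" using p by linarith+
  qed
  \<comment> \<open>The block averages change with \<epsilon> while p stays fixed, hence a size that
    is uniform in X.\<close>
  obtain N where N: "\<forall>X \<in> K_set. \<forall>n\<ge>N. \<forall>m\<ge>N. \<forall>a b. \<exists>u. pattern \<delta>1 X (env f X) (rect a b n m) u"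
    using uniform_patterns[OF \<delta>1(1)] by blast
  \<comment> \<open>The last bound makes the interfaces cheap: at most A / (p \<epsilon>)^2 blocks
    with at most 4 p outgoing bonds each cost, after scaling by \<epsilon>^2, no more than 4 C A /
    p, which is at most \<delta>/4.\<close>
  define p where "p = max 1 (max N (nat \<lceil>16 * C * A / \<delta>\<rceil>))"
  have p: "p > 0" "p \<ge> N" "16 * C * A / \<delta> \<le> real p" unfolding p_def by linarith+
  then have p4: "4 * C * A \<le> \<delta> / 4 * real p" using \<open>\<delta> > 0\<close> by (simp add: field_simps)
  have ex_pat: "\<exists>u. pattern \<delta>1 X (env f X) (blk p j) u" if "X \<in> K_set" for X j
    using N p(2) that unfolding blk_def by blast
  define \<pi> where "\<pi> = (\<lambda>X j. SOME u. pattern \<delta>1 X (env f X) (blk p j) u)"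
  have \<pi>: "pattern \<delta>1 X (env f X) (blk p j) (\<pi> X j)" if "X \<in> K_set" for X j
    unfolding \<pi>_def using ex_pat[OF that] by (rule someI_ex)
  let ?R = "\<lambda>\<epsilon>. tile (- \<epsilon> / 2) (real p * \<epsilon>)"
  define X where "X = (\<lambda>\<epsilon> j. (1 / (real p * \<epsilon>)\<^sup>2) *\<^sub>R (LINT x|\<mu>. indicator (?R \<epsilon> j) x *\<^sub>R Q x))"
  define b where "b = (\<lambda>\<epsilon> i. idx (- \<epsilon> / 2) (real p * \<epsilon>) (\<epsilon> *\<^sub>R i))"
  \<comment> \<open>\<open>b \<epsilon> i\<close> is the block of the site i. The constant spin
    fills the blocks not contained in \<Omega>, and all sites when \<epsilon> is not
    positive.\<close>
  define u where "u = (\<lambda>\<epsilon> i. if \<epsilon> > 0 \<and> ?R \<epsilon> (b \<epsilon> i) \<subseteq> \<Omega> then \<pi> (X \<epsilon> (b \<epsilon> i)) (b \<epsilon> i) i else axis 1 1)"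
  have XK: "X \<epsilon> j \<in> K_set" if "\<epsilon> > 0" "?R \<epsilon> j \<subseteq> \<Omega>" for \<epsilon> j
    unfolding X_def using that p(1) by (intro tile_average(2)[OF Q]) auto
  have uS: "u \<epsilon> i \<in> S1" for \<epsilon> i
    using \<pi>[OF XK[of \<epsilon> "b \<epsilon> i"], of "b \<epsilon> i"] by (auto simp: u_def pattern_def)
  obtain r V where r: "r > 0" and V: "V \<in> lmeasurable" "measure lebesgue V < \<delta>2"
    and layer: "\<And>x y z. y \<in> \<Omega> \<Longrightarrow> z \<notin> \<Omega> \<Longrightarrow> dist x y < r \<Longrightarrow> dist x z < r \<Longrightarrow> x \<in> V"
    using thin_layer[OF bounded_\<Omega> negl_frontier \<delta>2(1)] by metis
  have layer': "\<forall>x y z. y \<in> \<Omega> \<longrightarrow> z \<notin> \<Omega> \<longrightarrow> dist x y < r \<longrightarrow> dist x z < r \<longrightarrow> x \<in> V"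
    using layer by blast
  define G where "G = (\<lambda>\<epsilon>. {j \<in> Z2. ?R \<epsilon> j \<subseteq> \<Omega>})"
  have GZ: "G \<epsilon> \<subseteq> Z2" for \<epsilon> by (auto simp: G_def)
  have fG: "finite (G \<epsilon>)" if "\<epsilon> > 0" for \<epsilon>
  proof -
    have \<eta>: "real p * \<epsilon> > 0" using p(1) that by simp
    have "G \<epsilon> \<subseteq> {j \<in> Z2. ?R \<epsilon> j \<inter> \<Omega> \<noteq> {}}" using tile_nonempty[OF \<eta>] by (fastforce simp: G_def)
    then show ?thesis using finite_tiles[OF bounded_\<Omega> \<eta>] finite_subset by blast
  qed
  have cardG: "real (card (G \<epsilon>)) * (real p * \<epsilon>)\<^sup>2 \<le> A" if "\<epsilon> > 0" for \<epsilon>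
    unfolding A_def using p(1) that fG GZ lmeas_\<Omega> by (intro card_tiles_le[of _ _ "- \<epsilon> / 2"]) (auto simp: G_def)
  have rest: "\<Omega> - (\<Union>j\<in>G \<epsilon>. ?R \<epsilon> j) \<subseteq> V" if "\<epsilon> > 0" "2 * (real p * \<epsilon>) < r" for \<epsilon>
  proof
    fix x assume x: "x \<in> \<Omega> - (\<Union>j\<in>G \<epsilon>. ?R \<epsilon> j)"
    define j where "j = idx (- \<epsilon> / 2) (real p * \<epsilon>) x"
    have xj: "x \<in> ?R \<epsilon> j" unfolding j_def using p(1) that(1) by (intro mem_tile_idx) simp
    then have "\<not> ?R \<epsilon> j \<subseteq> \<Omega>" using x by (auto simp: G_def j_def)
    then show "x \<in> V" using tile_in_layer[OF layer' that(2), of "- \<epsilon> / 2" j] xj x by auto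
  qed
  have pat: "pattern \<delta>1 (X \<epsilon> j) (env f (X \<epsilon> j)) (blk p j) (u \<epsilon>)" if "\<epsilon> > 0" "j \<in> G \<epsilon>" for \<epsilon> j
  proof (rule pattern_cong[OF \<pi>])
    show "X \<epsilon> j \<in> K_set" using that by (intro XK) (auto simp: G_def)
    fix i assume i: "i \<in> blk p j"
    have "b \<epsilon> i = j"
      unfolding b_def using i that p(1) blk_props(2)[of p j] blk_iff(1)[OF that(1), of j i p]
      by (subst tile_iff_idx[symmetric]) (auto simp: G_def)
    then show "u \<epsilon> i = \<pi> (X \<epsilon> j) j i" using that by (simp add: u_def G_def)
  qed (rule uS)
  have Em: "(\<lambda>x. envK (Q x)) \<in> borel_measurable \<mu>" using measurable_compose[OF Q(1) envK_borel] .
  show ?thesis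
  proof (rule that[of u])
    show "u \<epsilon> i \<in> S1" for \<epsilon> i by (rule uS)
    have "\<forall>\<^sub>F \<epsilon> in at_right (0::real). \<epsilon> \<in> {0<..<r / (2 * real p)}"
      using r p(1) by (intro eventually_at_right_real) auto
    then show "\<forall>\<^sub>F \<epsilon> in at_right 0. \<epsilon>\<^sup>2 * energy f (Z_eps \<epsilon> \<Omega>) (u \<epsilon>) \<le> 4 * (LINT x|\<mu>. envK (Q x)) + \<delta>"
    proof eventually_elim
      case (elim \<epsilon>)
      then have \<epsilon>: "\<epsilon> > 0" "2 * (real p * \<epsilon>) < r" using p(1) by (auto simp: field_simps)
      let ?\<eta> = "real p * \<epsilon>" and ?B = "Z_eps \<epsilon> \<Omega>" and ?G = "G \<epsilon>"
      have \<eta>: "?\<eta> > 0" using \<epsilon> p by simp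
      define E where "E = ?B - (\<Union>j\<in>?G. blk p j)"
      define IE where "IE = (\<lambda>j. LINT x|\<mu>. indicator (?R \<epsilon> j) x * envK (Q x))"
      have disj: "disjoint_family_on (blk p) ?G"
        unfolding disjoint_family_on_def
      proof (intro ballI impI)
        fix j j' assume j: "j \<in> ?G" "j' \<in> ?G" "j \<noteq> j'"
        have "i \<in> ?R \<epsilon> k" if "i \<in> {\<epsilon> *\<^sub>R i | i. i \<in> blk p k}" "k \<in> ?G" for i k
          using that blk_iff(1)[OF \<epsilon>(1), of k] blk_props(2)[of p k] GZ by blast
        then show "blk p j \<inter> blk p j' = {}" using tile_disjoint[OF \<eta>, of j j' "- \<epsilon> / 2"] j GZ by blast
      qed
      have sub: "(\<Union>j\<in>?G. blk p j) \<subseteq> ?B"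
      proof clarify
        fix j i assume j: "j \<in> ?G" and i: "i \<in> blk p j"
        have "i \<in> Z2" using i blk_props(2) by blast
        then have "\<epsilon> *\<^sub>R i \<in> ?R \<epsilon> j" using i j blk_iff(1)[OF \<epsilon>(1), of j i p] GZ by auto
        then show "i \<in> ?B" using j \<open>i \<in> Z2\<close> by (auto simp: G_def Z_eps_def)
      qed
      have "energy f ?B (u \<epsilon>) \<le> (\<Sum>j \<in> ?G. energy f (blk p j) (u \<epsilon>)) + C * ((\<Sum>j \<in> ?G. card (outp (blk p j))) + 4 * card E)"
        unfolding E_def using fG \<epsilon> disj finite_Z_eps Z_eps_Z2 sub uS by (intro energy_glue) auto
      also have "\<dots> \<le> (\<Sum>j \<in> ?G. (real p * real p) * (4 * env f (X \<epsilon> j) + \<delta>1)) + C * ((\<Sum>j \<in> ?G. 4 * real p) + 4 * real (card E))"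
      proof (intro add_mono sum_mono mult_left_mono)
        show "energy f (blk p j) (u \<epsilon>) \<le> (real p * real p) * (4 * env f (X \<epsilon> j) + \<delta>1)" if "j \<in> ?G" for j
          using pat[OF \<epsilon>(1) that] by (simp add: pattern_def blk_props)
        have "(\<Sum>j \<in> ?G. real (card (outp (blk p j)))) \<le> (\<Sum>j \<in> ?G. 4 * real p)" by (intro sum_mono blk_props)
        then show "real ((\<Sum>j \<in> ?G. card (outp (blk p j))) + 4 * card E) \<le> (\<Sum>j \<in> ?G. 4 * real p) + 4 * real (card E)"
          by simp
      qed (rule C_nonneg)
      finally have "\<epsilon>\<^sup>2 * energy f ?B (u \<epsilon>) \<le> \<epsilon>\<^sup>2 * ((\<Sum>j \<in> ?G. (real p * real p) * (4 * env f (X \<epsilon> j) + \<delta>1)) + C * ((\<Sum>j \<in> ?G. 4 * real p) + 4 * real (card E)))"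
        by (intro mult_left_mono) auto
      also have "\<dots> = 4 * (\<Sum>j \<in> ?G. env f (X \<epsilon> j) * ?\<eta>\<^sup>2) + \<delta>1 * (real (card ?G) * ?\<eta>\<^sup>2)
        + 4 * C * (real (card ?G) * ?\<eta>\<^sup>2 / real p) + 4 * C * (real (card E) * \<epsilon>\<^sup>2)"
        using p(1) by (simp add: sum.distrib sum_distrib_left sum_distrib_right power2_eq_square algebra_simps)
      \<comment> \<open>The layer is charged twice: 4 C \<delta>2 for the integral outside the
        blocks and 4 C \<delta>2 for the sites outside them. The two \<delta>/4 are for pattern
        tolerance and interfaces.\<close>
      also have "\<dots> \<le> 4 * ((LINT x|\<mu>. envK (Q x)) + C * \<delta>2) + \<delta> / 4 + \<delta> / 4 + 4 * C * \<delta>2"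
      proof (intro add_mono)
        have "(\<Sum>j \<in> ?G. env f (X \<epsilon> j) * ?\<eta>\<^sup>2) \<le> (\<Sum>j \<in> ?G. IE j)"
          unfolding IE_def X_def using \<eta> by (intro sum_mono tile_average(3)[OF Q]) (auto simp: G_def)
        also have "\<dots> \<le> (LINT x|\<mu>. envK (Q x)) + C * measure lebesgue V"
          using integral_tiles[OF lmeas_\<Omega> Em _ fG[OF \<epsilon>(1)] GZ \<eta> V(1) rest[OF \<epsilon>] C_nonneg] envK_bound
          unfolding IE_def by (auto simp: abs_le_iff)
        also have "\<dots> \<le> (LINT x|\<mu>. envK (Q x)) + C * \<delta>2"
          using V(2) C_nonneg by (intro add_left_mono mult_left_mono) auto
        finally show "4 * (\<Sum>j \<in> ?G. env f (X \<epsilon> j) * ?\<eta>\<^sup>2) \<le> 4 * ((LINT x|\<mu>. envK (Q x)) + C * \<delta>2)" by simp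
        have "\<delta>1 * (real (card ?G) * ?\<eta>\<^sup>2) \<le> \<delta>1 * A" using \<delta>1(1) cardG[OF \<epsilon>(1)] by (intro mult_left_mono) auto
        then show "\<delta>1 * (real (card ?G) * ?\<eta>\<^sup>2) \<le> \<delta> / 4" using \<delta>1(2) by simp
        have "4 * C * (real (card ?G) * ?\<eta>\<^sup>2 / real p) \<le> 4 * C * (A / real p)"
          using cardG[OF \<epsilon>(1)] C_nonneg by (intro mult_left_mono divide_right_mono) auto
        also have "\<dots> \<le> \<delta> / 4" using p4 p(1) by (simp add: field_simps)
        finally show "4 * C * (real (card ?G) * ?\<eta>\<^sup>2 / real p) \<le> \<delta> / 4" .
        have "real (card E) * \<epsilon>\<^sup>2 \<le> measure lebesgue V"
        proof (rule card_tiles_le[OF \<epsilon>(1), of E "- \<epsilon> / 2"])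
          show "finite E" using finite_Z_eps[OF \<epsilon>(1)] by (simp add: E_def)
          show "E \<subseteq> Z2" using Z_eps_Z2 by (auto simp: E_def)
          fix i assume i: "i \<in> E"
          then have iB: "i \<in> ?B" "i \<in> Z2" using Z_eps_Z2 by (auto simp: E_def)
          define j where "j = b \<epsilon> i"
          have jZ: "j \<in> Z2" by (simp add: j_def b_def)
          have ij: "\<epsilon> *\<^sub>R i \<in> ?R \<epsilon> j" unfolding j_def b_def by (rule mem_tile_idx[OF \<eta>])
          then have ib: "i \<in> blk p j" using blk_iff(1)[OF \<epsilon>(1) jZ iB(2)] by simp
          then have "j \<notin> ?G" using i by (auto simp: E_def)
          then have "\<not> ?R \<epsilon> j \<subseteq> \<Omega>" using jZ by (simp add: G_def)
          moreover have "?R \<epsilon> j \<inter> \<Omega> \<noteq> {}" using ij iB(1) by (auto simp: Z_eps_def)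
          ultimately have "?R \<epsilon> j \<subseteq> V" by (intro tile_in_layer[OF layer' \<epsilon>(2)])
          then show "tile (- \<epsilon> / 2) \<epsilon> i \<subseteq> V" using blk_iff(2)[OF \<epsilon>(1) jZ iB(2) ib] by blast
        qed (rule V(1))
        then have "real (card E) * \<epsilon>\<^sup>2 \<le> \<delta>2" using V(2) by simp
        then show "4 * C * (real (card E) * \<epsilon>\<^sup>2) \<le> 4 * C * \<delta>2" using C_nonneg by (intro mult_left_mono) auto
      qed
      also have "\<dots> \<le> 4 * (LINT x|\<mu>. envK (Q x)) + \<delta>" using \<delta>2(2) \<open>\<delta> > 0\<close> by (simp add: algebra_simps)
      finally show ?case .
    qed
  next
    fix \<psi> :: "vec2 \<Rightarrow> mat2" and S assume \<psi>: "continuous_on UNIV \<psi>" and S: "\<And>x. norm (\<psi> x) \<le> S"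
    have "S \<ge> 0" using S[of 0] norm_ge_zero order_trans by blast
    define w where "w = \<delta> / (2 * (A + 1))"
    have w: "w > 0" "2 * w * A \<le> \<delta>"
    proof -
      show "w > 0" using \<open>\<delta> > 0\<close> \<open>A \<ge> 0\<close> by (simp add: w_def)
      then have "2 * w * A \<le> 2 * w * (A + 1)" by simp
      also have "\<dots> = \<delta>" using \<open>A \<ge> 0\<close> by (simp add: w_def divide_simps)
      finally show "2 * w * A \<le> \<delta>" .
    qed
    have "uniformly_continuous_on (closure \<Omega>) \<psi>"
      using bounded_\<Omega> continuous_on_subset[OF \<psi>] by (intro compact_uniformly_continuous) auto
    then obtain d where d: "d > 0" "\<And>x y. x \<in> closure \<Omega> \<Longrightarrow> y \<in> closure \<Omega> \<Longrightarrow> dist x y < d \<Longrightarrow> dist (\<psi> x) (\<psi> y) < w"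
      unfolding uniformly_continuous_on_def using w(1) by metis
    have "\<forall>\<^sub>F \<epsilon> in at_right (0::real). \<epsilon> \<in> {0<..<min r d / (2 * real p)}"
      using r d(1) p(1) by (intro eventually_at_right_real) auto
    then show "\<forall>\<^sub>F \<epsilon> in at_right 0. (LINT x|\<mu>. (cell_field \<epsilon> (u \<epsilon>) x - Q x) \<bullet> \<psi> x) \<le> \<delta> * (S + 1)"
    proof eventually_elim
      case (elim \<epsilon>)
      then have "\<epsilon> > 0" "2 * (real p * \<epsilon>) < min r d" using p(1) by (auto simp: field_simps)
      then have \<epsilon>: "\<epsilon> > 0" "2 * (real p * \<epsilon>) < r" "2 * (real p * \<epsilon>) < d" by auto
      let ?\<eta> = "real p * \<epsilon>" and ?G = "G \<epsilon>" and ?P = "cell_field \<epsilon> (u \<epsilon>)"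
      have \<eta>: "?\<eta> > 0" using \<epsilon> p by simp
      note cf = cell_field_props[of \<epsilon> "u \<epsilon>", OF \<epsilon>(1) uS]
      define g where "g = (\<lambda>x. (?P x - Q x) \<bullet> \<psi> x)"
      have PQ: "AE x in \<mu>. norm (?P x - Q x) \<le> 2"
        using Q(2)
      proof eventually_elim
        case (elim x)
        then show ?case using norm_triangle_ineq4[of "?P x" "Q x"] norm_K_le_1[OF elim] norm_S1_tensor[OF cf(4), of x] by linarith
      qed
      have inner_bd: "\<bar>Y \<bullet> Z\<bar> \<le> c * c'" if "norm Y \<le> c" "norm Z \<le> c'" for Y Z :: mat2 and c c'
        using Cauchy_Schwarz_ineq2[of Y Z] mult_mono[OF that] that by (meson norm_ge_zero order_trans)
      have gm: "g \<in> borel_measurable \<mu>"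
        unfolding g_def using cf(1) Q(1) continuous_measurable[OF \<psi>] by (intro borel_measurable_inner borel_measurable_diff)
      have hm: "(\<lambda>x. (?P x - Q x) \<bullet> v) \<in> borel_measurable \<mu>" for v
        using cf(1) Q(1) by (intro borel_measurable_inner borel_measurable_diff) auto
      have gb: "AE x in \<mu>. \<bar>g x\<bar> \<le> 2 * S"
        using PQ by eventually_elim (use S in \<open>simp add: g_def inner_bd\<close>)
      have tile_le: "(LINT x|\<mu>. indicator (?R \<epsilon> j) x * g x) \<le> (\<delta>1 * S + 2 * w) * ?\<eta>\<^sup>2" if j: "j \<in> ?G" for j
      proof -
        have jZ: "j \<in> Z2" and jO: "?R \<epsilon> j \<subseteq> \<Omega>" using j by (auto simp: G_def)
        \<comment> \<open>\<psi> is frozen at the lower left corner, which belongs to the half-open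
          tile. The error is 2 w because the norm of P - Q is at most 2.\<close>
        define y where "y = (\<chi> k. - \<epsilon> / 2 + ?\<eta> * j$k)"
        have y: "y \<in> ?R \<epsilon> j" unfolding y_def by (rule tile_nonempty[OF \<eta>])
        have "(LINT x|\<mu>. indicator (?R \<epsilon> j) x * g x)
          \<le> (LINT x|\<mu>. indicator (?R \<epsilon> j) x * ((?P x - Q x) \<bullet> \<psi> y)) + (2 * w) * ?\<eta>\<^sup>2"
        proof (rule integral_tile_approx[OF lmeas_\<Omega> jO \<eta> gm gb hm])
          show "AE x in \<mu>. \<bar>(?P x - Q x) \<bullet> \<psi> y\<bar> \<le> 2 * S"
            using PQ by eventually_elim (use S in \<open>simp add: inner_bd\<close>)
          show "AE x in \<mu>. x \<in> ?R \<epsilon> j \<longrightarrow> g x \<le> (?P x - Q x) \<bullet> \<psi> y + 2 * w"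
            using PQ
          proof eventually_elim
            case (elim x)
            show ?case
            proof
              assume x: "x \<in> ?R \<epsilon> j"
              have "dist x y < d" using dist_tile[OF x y] \<epsilon>(3) by linarith
              then have "dist (\<psi> x) (\<psi> y) < w" using x y jO closure_subset by (intro d(2)) blast+
              then have "norm (\<psi> x - \<psi> y) \<le> w" by (simp add: dist_norm)
              then have "\<bar>(?P x - Q x) \<bullet> (\<psi> x - \<psi> y)\<bar> \<le> 2 * w" by (rule inner_bd[OF elim])
              then show "g x \<le> (?P x - Q x) \<bullet> \<psi> y + 2 * w" by (simp add: g_def inner_diff_right abs_le_iff)
            qed
          qed
        qed (use \<open>S \<ge> 0\<close> in simp)
        moreover have "(LINT x|\<mu>. indicator (?R \<epsilon> j) x * ((?P x - Q x) \<bullet> \<psi> y)) \<le> \<delta>1 * S * ?\<eta>\<^sup>2"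
        proof -
          have im: "(indicator (?R \<epsilon> j) :: vec2 \<Rightarrow> real) \<in> borel_measurable \<mu>"
            using fmeasurableD[OF tile_lmeasurable] by (intro measurable_restrict_space1) simp
          have i1: "integrable \<mu> (\<lambda>x. indicator (?R \<epsilon> j) x * (?P x \<bullet> \<psi> y))"
          proof (rule bounded_integrable[of _ "S"])
            show "AE x in \<mu>. \<bar>indicator (?R \<epsilon> j) x * (?P x \<bullet> \<psi> y)\<bar> \<le> S"
              using inner_bd[of "?P _" 1 "\<psi> y" S] norm_S1_tensor[OF cf(4)] S \<open>S \<ge> 0\<close> by (intro AE_I2) (auto simp: indicator_def)
          qed (use im cf(1) in \<open>intro borel_measurable_times borel_measurable_inner, auto\<close>)
          have i2: "integrable \<mu> (\<lambda>x. indicator (?R \<epsilon> j) x * (Q x \<bullet> \<psi> y))"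
          proof (rule bounded_integrable[of _ "S"])
            show "AE x in \<mu>. \<bar>indicator (?R \<epsilon> j) x * (Q x \<bullet> \<psi> y)\<bar> \<le> S"
              using Q(2)
            proof eventually_elim
              case (elim x)
              then show ?case using inner_bd[of "Q x" 1 "\<psi> y" S] norm_K_le_1 S \<open>S \<ge> 0\<close> by (auto simp: indicator_def)
            qed
          qed (use im Q(1) in \<open>intro borel_measurable_times borel_measurable_inner, auto\<close>)
          let ?T = "\<Sum>i \<in> blk p j. tensor (u \<epsilon> i) (u \<epsilon> i)"
          have "(LINT x|\<mu>. indicator (?R \<epsilon> j) x * ((?P x - Q x) \<bullet> \<psi> y))
            = (LINT x|\<mu>. indicator (?R \<epsilon> j) x * (?P x \<bullet> \<psi> y) - indicator (?R \<epsilon> j) x * (Q x \<bullet> \<psi> y))"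
            by (simp add: inner_diff_left right_diff_distrib)
          also have "\<dots> = (LINT x|\<mu>. indicator (?R \<epsilon> j) x * (?P x \<bullet> \<psi> y)) - (LINT x|\<mu>. indicator (?R \<epsilon> j) x * (Q x \<bullet> \<psi> y))"
            using i1 i2 by (rule Bochner_Integration.integral_diff)
          also have "(LINT x|\<mu>. indicator (?R \<epsilon> j) x * (?P x \<bullet> \<psi> y)) = \<epsilon>\<^sup>2 * (?T \<bullet> \<psi> y)"
            by (rule integral_cell_field[OF \<epsilon>(1) p(1) jZ jO uS])
          also have "(LINT x|\<mu>. indicator (?R \<epsilon> j) x * (Q x \<bullet> \<psi> y)) = (X \<epsilon> j \<bullet> \<psi> y) * ?\<eta>\<^sup>2"
            unfolding X_def by (rule tile_average(1)[OF Q jO \<eta>])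
          also have "\<epsilon>\<^sup>2 * (?T \<bullet> \<psi> y) - (X \<epsilon> j \<bullet> \<psi> y) * ?\<eta>\<^sup>2 = \<epsilon>\<^sup>2 * ((?T - (real p * real p) *\<^sub>R X \<epsilon> j) \<bullet> \<psi> y)"
            by (simp add: inner_diff_left power2_eq_square algebra_simps)
          also have "\<dots> \<le> \<epsilon>\<^sup>2 * (\<delta>1 * (real p * real p) * S)"
          proof (intro mult_left_mono)
            have "norm (?T - (real p * real p) *\<^sub>R X \<epsilon> j) \<le> \<delta>1 * (real p * real p)"
              using pat[OF \<epsilon>(1) j] by (simp add: pattern_def blk_props)
            from inner_bd[OF this S] show "(?T - (real p * real p) *\<^sub>R X \<epsilon> j) \<bullet> \<psi> y \<le> \<delta>1 * (real p * real p) * S"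
              by (simp add: abs_le_iff)
          qed simp
          also have "\<dots> = \<delta>1 * S * ?\<eta>\<^sup>2" by (simp add: power2_eq_square)
          finally show ?thesis .
        qed
        ultimately show ?thesis by (simp add: algebra_simps)
      qed
      have "\<bar>(LINT x|\<mu>. g x) - (\<Sum>j\<in>?G. LINT x|\<mu>. indicator (?R \<epsilon> j) x * g x)\<bar> \<le> 2 * S * measure lebesgue V"
        using \<open>S \<ge> 0\<close> by (intro integral_tiles[OF lmeas_\<Omega> gm gb fG[OF \<epsilon>(1)] GZ \<eta> V(1) rest[OF \<epsilon>(1,2)]]) simp
      moreover have "2 * S * measure lebesgue V \<le> 2 * S * \<delta>2" using V(2) \<open>S \<ge> 0\<close> by (intro mult_left_mono) auto
      moreover have "(\<Sum>j\<in>?G. LINT x|\<mu>. indicator (?R \<epsilon> j) x * g x) \<le> (\<Sum>j\<in>?G. (\<delta>1 * S + 2 * w) * ?\<eta>\<^sup>2)"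
        by (intro sum_mono tile_le)
      moreover have "(\<Sum>j\<in>?G. (\<delta>1 * S + 2 * w) * ?\<eta>\<^sup>2) = (\<delta>1 * S + 2 * w) * (real (card ?G) * ?\<eta>\<^sup>2)" by simp
      moreover have "(\<delta>1 * S + 2 * w) * (real (card ?G) * ?\<eta>\<^sup>2) \<le> (\<delta>1 * S + 2 * w) * A"
        using cardG[OF \<epsilon>(1)] \<delta>1(1) w(1) \<open>S \<ge> 0\<close> by (intro mult_left_mono) auto
      \<comment> \<open>The term 2 w A, bounded by \<delta>, accounts for the 1 in S + 1; the other
        two terms take S \<delta>/4 each.\<close>
      moreover have "(\<delta>1 * S + 2 * w) * A + 2 * S * \<delta>2 \<le> \<delta> * (S + 1)"
      proof -
        have "S * (\<delta>1 * A) \<le> S * (\<delta> / 4)" "S * (2 * \<delta>2) \<le> S * (\<delta> / 4)"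
          using \<delta>1(2) \<delta>2(3) \<open>S \<ge> 0\<close> by (intro mult_left_mono; simp)+
        moreover have "0 \<le> S * \<delta>" using \<open>S \<ge> 0\<close> \<open>\<delta> > 0\<close> by simp
        ultimately show ?thesis using w(2) by (simp add: algebra_simps)
      qed
      ultimately show ?case unfolding g_def by linarith
    qed
  qed
qed

end

section \<open>Gamma-convergence in the weak* topology\<close>

text \<open>By induction over the generation of the topology: an intersection unites the two finite
  sets of test functions and keeps the smaller tolerance.\<close>

lemma weak_star_nbhd:
  assumes "openin (weak_star \<Omega>) U" "Q \<in> U"
  obtains \<Phi> \<delta> where "finite \<Phi>" "\<Phi> \<subseteq> L1 \<Omega>" "\<delta> > 0"
    "\<forall>P \<in> Linf \<Omega>.
      (\<forall>\<phi> \<in> \<Phi>. \<bar>(LINT x|lebesgue_on \<Omega>. P x \<bullet> \<phi> x) - (LINT x|lebesgue_on \<Omega>. Q x \<bullet> \<phi> x)\<bar> < \<delta>) \<longrightarrow> P \<in> U"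
proof -
  let ?I = "\<lambda>P \<phi>. LINT x|lebesgue_on \<Omega>. P x \<bullet> \<phi> x"
  define S where "S = {{Q \<in> Linf \<Omega>. ?I Q \<phi> \<in> V} |\<phi> V. \<phi> \<in> L1 \<Omega> \<and> open (V :: real set)}"
  have "generate_topology_on S U"
    using assms(1) unfolding weak_star_def S_def openin_topology_generated_by_iff .
  then have "Q \<in> U \<longrightarrow> (\<exists>\<Phi> \<delta>. finite \<Phi> \<and> \<Phi> \<subseteq> L1 \<Omega> \<and> \<delta> > 0 \<and>
    (\<forall>P \<in> Linf \<Omega>. (\<forall>\<phi> \<in> \<Phi>. \<bar>?I P \<phi> - ?I Q \<phi>\<bar> < \<delta>) \<longrightarrow> P \<in> U))"
  proof induction
    case Empty
    then show ?case by simp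
  next
    case (Int a b)
    show ?case
    proof
      assume "Q \<in> a \<inter> b"
      then obtain \<Phi> \<delta> \<Phi>' \<delta>' where *: "finite \<Phi>" "\<Phi> \<subseteq> L1 \<Omega>" "\<delta> > 0" "finite \<Phi>'" "\<Phi>' \<subseteq> L1 \<Omega>" "\<delta>' > 0"
        "\<forall>P \<in> Linf \<Omega>. (\<forall>\<phi> \<in> \<Phi>. \<bar>?I P \<phi> - ?I Q \<phi>\<bar> < \<delta>) \<longrightarrow> P \<in> a"
        "\<forall>P \<in> Linf \<Omega>. (\<forall>\<phi> \<in> \<Phi>'. \<bar>?I P \<phi> - ?I Q \<phi>\<bar> < \<delta>') \<longrightarrow> P \<in> b"
        using Int.IH by blast
      then show "\<exists>\<Phi> \<delta>. finite \<Phi> \<and> \<Phi> \<subseteq> L1 \<Omega> \<and> \<delta> > 0 \<and>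
        (\<forall>P \<in> Linf \<Omega>. (\<forall>\<phi> \<in> \<Phi>. \<bar>?I P \<phi> - ?I Q \<phi>\<bar> < \<delta>) \<longrightarrow> P \<in> a \<inter> b)"
        by (intro exI[of _ "\<Phi> \<union> \<Phi>'"] exI[of _ "min \<delta> \<delta>'"]) auto
    qed
  next
    case (UN K)
    show ?case
    proof
      assume "Q \<in> \<Union> K"
      then obtain k where "k \<in> K" "Q \<in> k" by blast
      then obtain \<Phi> \<delta> where "finite \<Phi>" "\<Phi> \<subseteq> L1 \<Omega>" "\<delta> > 0"
        "\<forall>P \<in> Linf \<Omega>. (\<forall>\<phi> \<in> \<Phi>. \<bar>?I P \<phi> - ?I Q \<phi>\<bar> < \<delta>) \<longrightarrow> P \<in> k"
        using mp[OF UN.IH[OF \<open>k \<in> K\<close>] \<open>Q \<in> k\<close>] by (elim exE conjE) (rule that)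
      then show "\<exists>\<Phi> \<delta>. finite \<Phi> \<and> \<Phi> \<subseteq> L1 \<Omega> \<and> \<delta> > 0 \<and>
        (\<forall>P \<in> Linf \<Omega>. (\<forall>\<phi> \<in> \<Phi>. \<bar>?I P \<phi> - ?I Q \<phi>\<bar> < \<delta>) \<longrightarrow> P \<in> \<Union> K)"
        using \<open>k \<in> K\<close> by (intro exI[of _ \<Phi>] exI[of _ \<delta>]) auto
    qed
  next
    case (Basis s)
    then obtain \<phi> V where s: "s = {Q \<in> Linf \<Omega>. ?I Q \<phi> \<in> V}" "\<phi> \<in> L1 \<Omega>" "open V" by (auto simp: S_def)
    show ?case
    proof
      assume "Q \<in> s"
      then obtain e where "e > 0" "\<And>y. dist y (?I Q \<phi>) < e \<Longrightarrow> y \<in> V" using s(1,3) unfolding open_dist by auto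
      then show "\<exists>\<Phi> \<delta>. finite \<Phi> \<and> \<Phi> \<subseteq> L1 \<Omega> \<and> \<delta> > 0 \<and>
        (\<forall>P \<in> Linf \<Omega>. (\<forall>\<phi> \<in> \<Phi>. \<bar>?I P \<phi> - ?I Q \<phi>\<bar> < \<delta>) \<longrightarrow> P \<in> s)"
        using s by (intro exI[of _ "{\<phi>}"] exI[of _ e]) (auto simp: dist_real_def)
    qed
  qed
  from mp[OF this assms(2)] show ?thesis by (elim exE conjE) (rule that)
qed

lemma openin_weak_star_basic:
  assumes "\<phi> \<in> L1 \<Omega>" "open V"
  shows "openin (weak_star \<Omega>) {Q \<in> Linf \<Omega>. (LINT x|lebesgue_on \<Omega>. Q x \<bullet> \<phi> x) \<in> V}"
  unfolding weak_star_def using assms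
  by (intro topology_generated_by_Basis CollectI exI[of _ \<phi>] exI[of _ V]) simp

lemma Gamma_liminf_le_limsup: "\<F> \<noteq> bot \<Longrightarrow> Gamma_liminf X \<F> F x \<le> Gamma_limsup X \<F> F x"
  unfolding Gamma_liminf_def Gamma_limsup_def by (intro SUP_mono) (auto intro: Liminf_le_Limsup)

section \<open>Test functions, separation from K, and the two Gamma-bounds\<close>

context spin_domain begin

text \<open>\<open>recovery_fields\<close> accepts bounded continuous test functions. Projecting the
  values of \<phi> to a ball of radius n makes it bounded with a small error in the mean, and
  continuous approximations with values in the same ball converge dominatedly.\<close>

lemma L1_continuous_approximation:
  fixes \<phi> :: "vec2 \<Rightarrow> mat2"
  assumes \<phi>: "integrable \<mu> \<phi>" and "e > 0"
  obtains \<psi> S where "continuous_on UNIV \<psi>" "\<And>x. norm (\<psi> x) \<le> S"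
    "(LINT x|\<mu>. norm (\<phi> x - \<psi> x)) < e"
proof -
  have \<phi>m: "\<phi> \<in> borel_measurable \<mu>" using \<phi> by simp
  define cp where "cp = (\<lambda>n::nat. closest_point (cball (0::mat2) (real n)))"
  have cont: "continuous_on UNIV (cp n)" for n unfolding cp_def by (rule continuous_on_closest_point) auto
  have cp_in: "norm (cp n X) \<le> real n" for n X
    unfolding cp_def using closest_point_in_set[of "cball (0::mat2) (real n)" X] by simp
  have cp_le: "norm (cp n X) \<le> norm X" for n X
    using closest_point_lipschitz[of "cball (0::mat2) (real n)" X 0] closest_point_self[of 0 "cball (0::mat2) (real n)"]
    by (simp add: cp_def)
  have cm: "(\<lambda>x. cp n (\<phi> x)) \<in> borel_measurable \<mu>" for n
    using measurable_compose[OF \<phi>m borel_measurable_continuous_onI[OF cont]] .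
  have "(\<lambda>n. LINT x|\<mu>. norm (\<phi> x - cp n (\<phi> x))) \<longlonglongrightarrow> (LINT x|\<mu>. (0::real))"
  proof (rule integral_dominated_convergence[where w = "\<lambda>x. 2 * norm (\<phi> x)"])
    show "AE x in \<mu>. (\<lambda>n. norm (\<phi> x - cp n (\<phi> x))) \<longlonglongrightarrow> 0"
    proof (rule AE_I2)
      fix x
      obtain m where m: "norm (\<phi> x) \<le> real m" using real_arch_simple by blast
      have "\<forall>\<^sub>F n in sequentially. norm (\<phi> x - cp n (\<phi> x)) = 0"
        using eventually_ge_at_top[of m]
      proof eventually_elim
        case (elim n)
        then have "\<phi> x \<in> cball 0 (real n)" using m by simp
        then show ?case by (simp add: cp_def closest_point_self)
      qed
      then show "(\<lambda>n. norm (\<phi> x - cp n (\<phi> x))) \<longlonglongrightarrow> 0" by (rule tendsto_eventually)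
    qed
    show "AE x in \<mu>. norm (norm (\<phi> x - cp n (\<phi> x))) \<le> 2 * norm (\<phi> x)" for n
    proof (rule AE_I2)
      fix x show "norm (norm (\<phi> x - cp n (\<phi> x))) \<le> 2 * norm (\<phi> x)"
        using norm_triangle_ineq4[of "\<phi> x" "cp n (\<phi> x)"] cp_le[of n "\<phi> x"] by simp
    qed
    show "(\<lambda>x. norm (\<phi> x - cp n (\<phi> x))) \<in> borel_measurable \<mu>" for n
      using \<phi>m cm[of n] by measurable
  qed (use \<phi> in auto)
  then have "\<forall>\<^sub>F n in sequentially. (LINT x|\<mu>. norm (\<phi> x - cp n (\<phi> x))) < e / 2"
    using \<open>e > 0\<close> by (intro order_tendstoD(2)) auto
  then obtain n where n: "(LINT x|\<mu>. norm (\<phi> x - cp n (\<phi> x))) < e / 2"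
    using eventually_happens'[OF sequentially_bot] by blast
  obtain g where g: "\<And>k. continuous_on UNIV (g k)" "\<And>k x. g k x \<in> cball 0 (real n)"
    "AE x in \<mu>. (\<lambda>k::nat. g k x) \<longlonglongrightarrow> cp n (\<phi> x)"
  proof (rule continuous_approximation[OF sets_\<Omega> cm[of n], of "cball 0 (real n)"])
    show "AE x in \<mu>. cp n (\<phi> x) \<in> cball 0 (real n)" using cp_in by simp
  qed auto
  have g_le: "norm (g k x) \<le> real n" for k x using g(2)[of k x] by simp
  have "(\<lambda>k. LINT x|\<mu>. norm (cp n (\<phi> x) - g k x)) \<longlonglongrightarrow> (LINT x|\<mu>. (0::real))"
  proof (rule integral_dominated_convergence[where w = "\<lambda>x. 2 * real n"])
    show "AE x in \<mu>. (\<lambda>k. norm (cp n (\<phi> x) - g k x)) \<longlonglongrightarrow> 0"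
      using g(3)
    proof eventually_elim
      case (elim x)
      have "(\<lambda>k. norm (cp n (\<phi> x) - g k x)) \<longlonglongrightarrow> norm (cp n (\<phi> x) - cp n (\<phi> x))" using elim by (intro tendsto_intros)
      then show ?case by simp
    qed
    show "AE x in \<mu>. norm (norm (cp n (\<phi> x) - g k x)) \<le> 2 * real n" for k
    proof (rule AE_I2)
      fix x show "norm (norm (cp n (\<phi> x) - g k x)) \<le> 2 * real n"
        using norm_triangle_ineq4[of "cp n (\<phi> x)" "g k x"] cp_in[of n "\<phi> x"] g_le[of k x] by simp
    qed
    show "(\<lambda>x. norm (cp n (\<phi> x) - g k x)) \<in> borel_measurable \<mu>" for k
      using continuous_measurable[OF g(1)[of k]] cm[of n] by measurable
  qed auto
  then have "\<forall>\<^sub>F k in sequentially. (LINT x|\<mu>. norm (cp n (\<phi> x) - g k x)) < e / 2"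
    using \<open>e > 0\<close> by (intro order_tendstoD(2)) auto
  then obtain k where k: "(LINT x|\<mu>. norm (cp n (\<phi> x) - g k x)) < e / 2"
    using eventually_happens'[OF sequentially_bot] by blast
  have ci: "integrable \<mu> (\<lambda>x. cp n (\<phi> x))" using cm cp_in by (intro integrable_const_bound[where B = "real n"]) auto
  have gi: "integrable \<mu> (g k)" using continuous_measurable[OF g(1)] g_le by (intro integrable_const_bound[where B = "real n"]) auto
  have "(LINT x|\<mu>. norm (\<phi> x - g k x)) \<le> (LINT x|\<mu>. norm (\<phi> x - cp n (\<phi> x)) + norm (cp n (\<phi> x) - g k x))"
  proof (rule integral_mono)
    fix x show "norm (\<phi> x - g k x) \<le> norm (\<phi> x - cp n (\<phi> x)) + norm (cp n (\<phi> x) - g k x)"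
      using norm_triangle_ineq[of "\<phi> x - cp n (\<phi> x)" "cp n (\<phi> x) - g k x"] by simp
  qed (use \<phi> ci gi in auto)
  also have "\<dots> = (LINT x|\<mu>. norm (\<phi> x - cp n (\<phi> x))) + (LINT x|\<mu>. norm (cp n (\<phi> x) - g k x))"
    using \<phi> ci gi by (intro Bochner_Integration.integral_add) auto
  also have "\<dots> < e" using n k by simp
  finally show ?thesis using that[of "g k" "real n"] g(1) g_le by blast
qed

lemma F_lim_eq:
  assumes Q: "Q \<in> borel_measurable \<mu>" "AE x in \<mu>. Q x \<in> K_set"
  shows "F_lim f \<Omega> Q = ereal (4 * (LINT x|\<mu>. envK (Q x)))"
proof -
  let ?L = "\<lambda>x. real_of_ereal (fhat_env f (Q x))"
  have Em: "(\<lambda>x. envK (Q x)) \<in> borel_measurable \<mu>" using measurable_compose[OF Q(1) envK_borel] .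
  have eq: "AE x in \<mu>. envK (Q x) = ?L x"
    using Q(2) by eventually_elim (simp add: envK_def fhat_env_eq)
  \<comment> \<open>The integrand of \<open>F_lim\<close> is compared with \<open>envK (Q x)\<close>
    only almost everywhere; it inherits measurability from completeness of Lebesgue measure, after
    extension by zero to the whole plane.\<close>
  have "(\<lambda>x. if x \<in> \<Omega> then envK (Q x) else 0) \<in> borel_measurable lebesgue"
    using Em sets_\<Omega> by (simp add: borel_measurable_if)
  moreover have "AE x in lebesgue. (if x \<in> \<Omega> then envK (Q x) else 0) = (if x \<in> \<Omega> then ?L x else 0)"
    using eq sets_\<Omega> by (auto simp: AE_restrict_space_iff elim: eventually_mono)
  ultimately have "(\<lambda>x. if x \<in> \<Omega> then ?L x else 0) \<in> borel_measurable lebesgue" by (rule borel_measurable_AE)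
  then have "?L \<in> borel_measurable \<mu>" using sets_\<Omega> by (simp add: borel_measurable_if)
  then have "(LINT x|\<mu>. ?L x) = (LINT x|\<mu>. envK (Q x))"
    using Em eq by (intro integral_cong_AE) (auto elim: eventually_mono)
  then show ?thesis using Q(2) by (simp add: F_lim_def)
qed

lemma Linf_integrable:
  assumes P: "P \<in> Linf \<Omega>" and \<phi>: "integrable \<mu> \<phi>"
  shows "integrable \<mu> (\<lambda>x. P x \<bullet> \<phi> x)"
proof -
  obtain c where c: "AE x in \<mu>. norm (P x) \<le> c" and Pm: "P \<in> borel_measurable \<mu>"
    using P by (auto simp: Linf_def)
  have "integrable \<mu> (\<lambda>x. c * norm (\<phi> x))" using \<phi> by simp
  then show ?thesis
  proof (rule Bochner_Integration.integrable_bound)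
    show "(\<lambda>x. P x \<bullet> \<phi> x) \<in> borel_measurable \<mu>" using Pm \<phi> by (intro borel_measurable_inner) auto
    show "AE x in \<mu>. norm (P x \<bullet> \<phi> x) \<le> norm (c * norm (\<phi> x))"
      using c
    proof eventually_elim
      case (elim x)
      have "\<bar>P x \<bullet> \<phi> x\<bar> \<le> norm (P x) * norm (\<phi> x)" by (rule Cauchy_Schwarz_ineq2)
      also have "\<dots> \<le> c * norm (\<phi> x)" using elim by (intro mult_right_mono) auto
      also have "\<dots> \<le> \<bar>c * norm (\<phi> x)\<bar>" by simp
      finally show ?case by simp
    qed
  qed
qed

text \<open>The test function equals M on the set D where Q violates the inequality and 0 elsewhere.
  Fields with values in K give it at least c times the measure of D, whereas Q gives strictly
  less.\<close>

lemma halfspace_separation: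
  assumes Q: "Q \<in> Linf \<Omega>" and M: "M \<in> sym_mats" "\<And>X. X \<in> K_set \<Longrightarrow> c \<le> X \<bullet> M"
    and not: "\<not> (AE x in \<mu>. c \<le> Q x \<bullet> M)"
  shows "\<exists>U. openin (weak_star \<Omega>) U \<and> Q \<in> U \<and> (\<forall>P \<in> U. \<not> (AE x in \<mu>. P x \<in> K_set))"
proof -
  define D where "D = {x \<in> space \<mu>. Q x \<bullet> M < c}"
  have Qm: "Q \<in> borel_measurable \<mu>" using Q by (simp add: Linf_def)
  have QMm: "(\<lambda>x. Q x \<bullet> M) \<in> borel_measurable \<mu>" using Qm by (intro borel_measurable_inner) auto
  then have Ds: "D \<in> sets \<mu>" unfolding D_def by measurable
  have Di: "integrable \<mu> (indicator D :: vec2 \<Rightarrow> real)"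
    using Ds by (intro integrable_real_indicator) (auto simp: less_top[symmetric])
  define \<phi> where "\<phi> = (\<lambda>x. indicator D x *\<^sub>R M)"
  have \<phi>i: "integrable \<mu> \<phi>" unfolding \<phi>_def using Di by (intro integrable_scaleR_left)
  have sym: "r *\<^sub>R M \<in> sym_mats" for r using M(1) by (simp add: sym_mats_iff)
  have \<phi>: "\<phi> \<in> L1 \<Omega>" using \<phi>i sym by (simp add: L1_def \<phi>_def)
  have ci: "integrable \<mu> (\<lambda>x. indicator D x * c)" using Di by (intro integrable_mult_left)
  define U where "U = {P \<in> Linf \<Omega>. (LINT x|\<mu>. P x \<bullet> \<phi> x) \<in> {..<(LINT x|\<mu>. indicator D x * c)}}"
  have "openin (weak_star \<Omega>) U" unfolding U_def by (rule openin_weak_star_basic[OF \<phi>]) simp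
  moreover have "Q \<in> U"
  proof -
    \<comment> \<open>h is positive on D and zero elsewhere in \<Omega>, so a vanishing integral
      would make D null.\<close>
    define h where "h = (\<lambda>x. indicator D x * c - Q x \<bullet> \<phi> x)"
    have hi: "integrable \<mu> h" unfolding h_def using ci Linf_integrable[OF Q \<phi>i] by simp
    have h0: "0 \<le> h x" for x by (auto simp: h_def \<phi>_def D_def indicator_def)
    have "(LINT x|\<mu>. h x) \<noteq> 0"
    proof
      assume "(LINT x|\<mu>. h x) = 0"
      then have "AE x in \<mu>. h x = 0" using integral_nonneg_eq_0_iff_AE[OF hi] h0 by simp
      then have "AE x in \<mu>. c \<le> Q x \<bullet> M"
        using AE_space
      proof eventually_elim
        case (elim x)
        then show ?case by (cases "x \<in> D") (auto simp: h_def \<phi>_def D_def)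
      qed
      then show False using not by simp
    qed
    moreover have "0 \<le> (LINT x|\<mu>. h x)" using h0 by (intro integral_nonneg_AE) simp
    moreover have "(LINT x|\<mu>. h x) = (LINT x|\<mu>. indicator D x * c) - (LINT x|\<mu>. Q x \<bullet> \<phi> x)"
      unfolding h_def using ci Linf_integrable[OF Q \<phi>i] by (rule Bochner_Integration.integral_diff)
    ultimately show ?thesis using Q by (simp add: U_def)
  qed
  moreover have "\<not> (AE x in \<mu>. P x \<in> K_set)" if "P \<in> U" for P
  proof
    assume PK: "AE x in \<mu>. P x \<in> K_set"
    have "(LINT x|\<mu>. indicator D x * c) \<le> (LINT x|\<mu>. P x \<bullet> \<phi> x)"
    proof (rule integral_mono_AE[OF ci])
      show "integrable \<mu> (\<lambda>x. P x \<bullet> \<phi> x)" using that \<phi>i by (intro Linf_integrable) (simp_all add: U_def)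
      show "AE x in \<mu>. indicator D x * c \<le> P x \<bullet> \<phi> x"
        using PK by eventually_elim (use M(2) in \<open>auto simp: \<phi>_def indicator_def\<close>)
    qed
    then show False using that by (simp add: U_def)
  qed
  ultimately show ?thesis by blast
qed

text \<open>Within the symmetric matrices, K is an intersection of countably many half-spaces: two
  for the trace and one for each vector of a countable dense set. If none of them separates, Q
  satisfies all of them almost everywhere at once.\<close>

lemma not_K_separation:
  assumes Q: "Q \<in> Linf \<Omega>" and not: "\<not> (AE x in \<mu>. Q x \<in> K_set)"
  shows "\<exists>U. openin (weak_star \<Omega>) U \<and> Q \<in> U \<and> (\<forall>P \<in> U. \<not> (AE x in \<mu>. P x \<in> K_set))"
proof (rule ccontr)
  assume no: "\<not> ?thesis"
  have half: "AE x in \<mu>. c \<le> Q x \<bullet> M" if "M \<in> sym_mats" "\<And>X. X \<in> K_set \<Longrightarrow> c \<le> X \<bullet> M" for M c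
    using halfspace_separation[OF Q that] no by blast
  obtain D :: "vec2 set" where D: "countable D" "closure D = UNIV"
    using separable[of "UNIV :: vec2 set"] by (metis UNIV_I subsetI subset_antisym)
  have t: "AE x in \<mu>. 1 \<le> Q x \<bullet> mat 1" by (rule half) (auto simp: K_set_iff sym_mats_iff mat_def)
  have t': "AE x in \<mu>. - 1 \<le> Q x \<bullet> (- mat 1)" by (rule half) (auto simp: K_set_iff sym_mats_iff mat_def)
  have "AE x in \<mu>. 0 \<le> Q x \<bullet> tensor y y" for y by (rule half) (auto simp: K_set_iff sym_mats_iff tensor_def)
  then have p: "AE x in \<mu>. \<forall>y\<in>D. 0 \<le> Q x \<bullet> tensor y y" using D(1) by (simp add: AE_ball_countable)
  have "AE x in \<mu>. Q x \<in> sym_mats" using Q by (simp add: Linf_def)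
  then have "AE x in \<mu>. Q x \<in> K_set"
    using t t' p
  proof eventually_elim
    case (elim x)
    have "0 \<le> y \<bullet> (Q x *v y)" for y
    proof -
      have "closed {y. 0 \<le> y \<bullet> (Q x *v y)}"
        by (intro closed_Collect_le continuous_intros linear_continuous_on) (simp add: matrix_vector_mul_bounded_linear)
      moreover have "D \<subseteq> {y. 0 \<le> y \<bullet> (Q x *v y)}" using elim by (auto simp: inner_tensor)
      ultimately have "closure D \<subseteq> {y. 0 \<le> y \<bullet> (Q x *v y)}" by (rule closure_minimal[rotated])
      then show ?thesis using D(2) by blast
    qed
    then show ?case using elim by (simp add: K_set_def inner_mat_1)
  qed
  then show False using not by simp
qed

lemma Gamma_liminf_ge:
  assumes Q: "Q \<in> Linf \<Omega>"
  shows "F_lim f \<Omega> Q \<le> Gamma_liminf (weak_star \<Omega>) (at_right 0) (F_eps f \<Omega>) Q"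
proof (cases "AE x in \<mu>. Q x \<in> K_set")
  case False
  then obtain U where U: "openin (weak_star \<Omega>) U" "Q \<in> U" "\<And>P. P \<in> U \<Longrightarrow> \<not> (AE x in \<mu>. P x \<in> K_set)"
    using not_K_separation[OF Q] by blast
  have "\<forall>\<^sub>F \<epsilon> in at_right 0. (\<infinity>::ereal) \<le> (INF P \<in> U. F_eps f \<Omega> \<epsilon> P)"
    using eventually_at_right_less[of "0::real"]
  proof eventually_elim
    case (elim \<epsilon>)
    show ?case
    proof (rule INF_greatest)
      fix P assume "P \<in> U"
      have "\<not> (\<exists>u. spin_field \<epsilon> \<Omega> P u)"
      proof
        assume "\<exists>u. spin_field \<epsilon> \<Omega> P u"
        then obtain u where "spin_field \<epsilon> \<Omega> P u" by blast
        then have "AE x in \<mu>. P x \<in> K_set"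
          using spin_field_AE(1)[OF _ elim] S1_tensor_K by (metis (mono_tags, lifting) eventually_mono)
        then show False using U(3)[OF \<open>P \<in> U\<close>] by simp
      qed
      then show "\<infinity> \<le> F_eps f \<Omega> \<epsilon> P" by (simp add: F_eps_infinite)
    qed
  qed
  then have "\<infinity> \<le> Liminf (at_right 0) (\<lambda>\<epsilon>. INF P \<in> U. F_eps f \<Omega> \<epsilon> P)" by (rule Liminf_bounded)
  also have "\<dots> \<le> Gamma_liminf (weak_star \<Omega>) (at_right 0) (F_eps f \<Omega>) Q"
    unfolding Gamma_liminf_def using U by (intro SUP_upper) auto
  finally show ?thesis by (simp add: top_ereal_def[symmetric] top_unique)
next
  case True
  let ?\<Gamma> = "Gamma_liminf (weak_star \<Omega>) (at_right 0) (F_eps f \<Omega>) Q"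
  have Qm: "Q \<in> borel_measurable \<mu>" using Q by (simp add: Linf_def)
  have "ereal y \<le> ?\<Gamma>" if y: "y < 4 * (LINT x|\<mu>. envK (Q x))" for y
  proof -
    define t where "t = (y / 4 + (LINT x|\<mu>. envK (Q x))) / 2"
    have t: "y < 4 * t" "t < (LINT x|\<mu>. envK (Q x))" using y by (auto simp: t_def)
    \<comment> \<open>One e is lost in \<open>energy_liminf\<close>, and four more in passing from Q
      to P inside U.\<close>
    define e where "e = (4 * t - y) / 5"
    have "e > 0" using t by (simp add: e_def)
    obtain p S where p: "continuous_on UNIV p" "\<And>x. p x \<in> affs f" "\<And>x. \<bar>fst (p x)\<bar> + norm (snd (p x)) \<le> S"
      "t < (LINT x|\<mu>. fst (p x) + snd (p x) \<bullet> Q x)"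
      using affine_minorant_field[OF Qm True t(2)] by blast
    define a \<phi> where "a = (\<lambda>x. fst (p x))" and "\<phi> = (\<lambda>x. snd (p x))"
    have am: "a \<in> borel_measurable \<mu>" and \<phi>m: "\<phi> \<in> borel_measurable \<mu>"
      unfolding a_def \<phi>_def using p(1) by (auto intro!: continuous_measurable continuous_intros)
    have bd: "\<bar>a x\<bar> \<le> S" "norm (\<phi> x) \<le> S" for x
      using p(3)[of x] norm_ge_zero[of "snd (p x)"] abs_ge_zero[of "fst (p x)"] unfolding a_def \<phi>_def by linarith+
    have ai: "integrable \<mu> a" using am bd by (intro bounded_integrable[of _ S]) auto
    have \<phi>i: "integrable \<mu> \<phi>" using \<phi>m bd by (intro integrable_const_bound[where B = S]) auto
    have "\<phi> x \<in> sym_mats" for x using p(2)[of x] by (auto simp: affs_def \<phi>_def)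
    then have \<phi>: "\<phi> \<in> L1 \<Omega>" using \<phi>i by (simp add: L1_def)
    have split: "(LINT x|\<mu>. fst (p x) + snd (p x) \<bullet> P x) = (LINT x|\<mu>. a x) + (LINT x|\<mu>. P x \<bullet> \<phi> x)"
      if "P \<in> Linf \<Omega>" for P
      using Bochner_Integration.integral_add[OF ai Linf_integrable[OF that \<phi>i]] by (simp add: a_def \<phi>_def inner_commute)
    \<comment> \<open>Only a lower bound on the linear part of the minorant field is asked for, so
      an open half-space is neighbourhood enough.\<close>
    define U where "U = {P \<in> Linf \<Omega>. (LINT x|\<mu>. P x \<bullet> \<phi> x) \<in> {(LINT x|\<mu>. Q x \<bullet> \<phi> x) - e<..}}"
    have "openin (weak_star \<Omega>) U" unfolding U_def by (rule openin_weak_star_basic[OF \<phi>]) simp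
    moreover have "Q \<in> U" unfolding U_def using Q \<open>e > 0\<close> by simp
    ultimately have U: "openin (weak_star \<Omega>) U" "Q \<in> U" by auto
    have "\<forall>\<^sub>F \<epsilon> in at_right 0. ereal y \<le> (INF P \<in> U. F_eps f \<Omega> \<epsilon> P)"
      using energy_liminf[OF p(1-3) \<open>e > 0\<close>] eventually_at_right_less[of "0::real"]
    proof eventually_elim
      case (elim \<epsilon>)
      show ?case
      proof (rule INF_greatest)
        fix P assume P: "P \<in> U"
        then have PL: "P \<in> Linf \<Omega>" and Pm: "P \<in> borel_measurable \<mu>" by (auto simp: U_def Linf_def)
        show "ereal y \<le> F_eps f \<Omega> \<epsilon> P"
        proof (cases "\<exists>u. spin_field \<epsilon> \<Omega> P u")
          case True
          then obtain u where u: "spin_field \<epsilon> \<Omega> P u" by blast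
          have "4 * (LINT x|\<mu>. fst (p x) + snd (p x) \<bullet> P x) - e \<le> \<epsilon>\<^sup>2 * energy f (Z_eps \<epsilon> \<Omega>) u"
            using elim(1) Pm u by blast
          moreover have "(LINT x|\<mu>. P x \<bullet> \<phi> x) > (LINT x|\<mu>. Q x \<bullet> \<phi> x) - e" using P by (simp add: U_def)
          moreover have "t < (LINT x|\<mu>. a x) + (LINT x|\<mu>. Q x \<bullet> \<phi> x)" using p(4) split[OF Q] by simp
          ultimately have "y \<le> \<epsilon>\<^sup>2 * energy f (Z_eps \<epsilon> \<Omega>) u" unfolding split[OF PL] e_def by argo
          then show ?thesis using F_eps_spin_field[OF u elim(2)] by simp
        next
          case False
          then show ?thesis by (simp add: F_eps_infinite)
        qed
      qed
    qed
    then have "ereal y \<le> Liminf (at_right 0) (\<lambda>\<epsilon>. INF P \<in> U. F_eps f \<Omega> \<epsilon> P)" by (rule Liminf_bounded)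
    also have "\<dots> \<le> ?\<Gamma>" unfolding Gamma_liminf_def using U by (intro SUP_upper) auto
    finally show ?thesis .
  qed
  then have "ereal (4 * (LINT x|\<mu>. envK (Q x))) \<le> ?\<Gamma>"
    by (metis ereal_dense2 less_ereal.simps(1) not_le)
  then show ?thesis by (simp add: F_lim_eq[OF Qm True])
qed

text \<open>Each neighbourhood U and each e may use recovery fields of its own, because the
  Gamma-limsup is tested on neighbourhoods.\<close>

lemma Gamma_limsup_le:
  assumes Q: "Q \<in> Linf \<Omega>"
  shows "Gamma_limsup (weak_star \<Omega>) (at_right 0) (F_eps f \<Omega>) Q \<le> F_lim f \<Omega> Q"
proof (cases "AE x in \<mu>. Q x \<in> K_set")
  case False
  then show ?thesis by (simp add: F_lim_def)
next
  case True
  let ?I = "LINT x|\<mu>. envK (Q x)"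
  have Qm: "Q \<in> borel_measurable \<mu>" using Q by (simp add: Linf_def)
  show ?thesis
    unfolding Gamma_limsup_def
  proof (rule SUP_least)
    fix U assume "U \<in> {U. openin (weak_star \<Omega>) U \<and> Q \<in> U}"
    then have "openin (weak_star \<Omega>) U" "Q \<in> U" by auto
    then obtain \<Phi> \<delta> where \<Phi>: "finite \<Phi>" "\<Phi> \<subseteq> L1 \<Omega>" "\<delta> > 0" and
      inU: "\<forall>P \<in> Linf \<Omega>. (\<forall>\<phi> \<in> \<Phi>. \<bar>(LINT x|\<mu>. P x \<bullet> \<phi> x) - (LINT x|\<mu>. Q x \<bullet> \<phi> x)\<bar> < \<delta>) \<longrightarrow> P \<in> U"
      by (rule weak_star_nbhd) (rule that)
    \<comment> \<open>This error is later multiplied by the norm of P - Q, at most 2, and becomes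
      \<delta>/4.\<close>
    have "\<forall>\<phi> \<in> \<Phi>. \<exists>\<psi> S. continuous_on UNIV \<psi> \<and> (\<forall>x. norm (\<psi> x) \<le> S) \<and> (LINT x|\<mu>. norm (\<phi> x - \<psi> x)) < \<delta> / 8"
    proof
      fix \<phi> assume "\<phi> \<in> \<Phi>"
      then have int: "integrable \<mu> \<phi>" using \<Phi>(2) by (auto simp: L1_def)
      have "\<delta> / 8 > 0" using \<Phi>(3) by simp
      then obtain \<psi> S where "continuous_on UNIV \<psi>" and S: "\<And>x. norm (\<psi> x) \<le> S"
        and "(LINT x|\<mu>. norm (\<phi> x - \<psi> x)) < \<delta> / 8"
        using L1_continuous_approximation[OF int] by blast
      moreover have "\<forall>x. norm (\<psi> x) \<le> S" using S by blast
      ultimately show "\<exists>\<psi> S. continuous_on UNIV \<psi> \<and> (\<forall>x. norm (\<psi> x) \<le> S) \<and> (LINT x|\<mu>. norm (\<phi> x - \<psi> x)) < \<delta> / 8"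
        by blast
    qed
    from bchoice[OF this] obtain \<psi> where "\<forall>\<phi> \<in> \<Phi>. \<exists>S. continuous_on UNIV (\<psi> \<phi>) \<and> (\<forall>x. norm (\<psi> \<phi> x) \<le> S) \<and>
        (LINT x|\<mu>. norm (\<phi> x - \<psi> \<phi> x)) < \<delta> / 8"
      by (elim exE) (rule that)
    from bchoice[OF this] obtain S where "\<forall>\<phi> \<in> \<Phi>. continuous_on UNIV (\<psi> \<phi>) \<and> (\<forall>x. norm (\<psi> \<phi> x) \<le> S \<phi>) \<and>
        (LINT x|\<mu>. norm (\<phi> x - \<psi> \<phi> x)) < \<delta> / 8"
      by (elim exE) (rule that)
    then have \<psi>: "\<And>\<phi>. \<phi> \<in> \<Phi> \<Longrightarrow> continuous_on UNIV (\<psi> \<phi>)" "\<And>\<phi> x. \<phi> \<in> \<Phi> \<Longrightarrow> norm (\<psi> \<phi> x) \<le> S \<phi>"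
      "\<And>\<phi>. \<phi> \<in> \<Phi> \<Longrightarrow> (LINT x|\<mu>. norm (\<phi> x - \<psi> \<phi> x)) < \<delta> / 8" by simp_all
    define S0 where "S0 = (\<Sum>\<phi> \<in> \<Phi>. \<bar>S \<phi>\<bar>)"
    have "S0 \<ge> 0" unfolding S0_def by (intro sum_nonneg) auto
    have S0: "norm (\<psi> \<phi> x) \<le> S0" if "\<phi> \<in> \<Phi>" for \<phi> x
    proof -
      have "norm (\<psi> \<phi> x) \<le> \<bar>S \<phi>\<bar>" using \<psi>(2)[OF that, of x] by linarith
      also have "\<dots> \<le> S0" unfolding S0_def using that \<Phi>(1) by (intro member_le_sum) auto
      finally show ?thesis .
    qed
    have "Limsup (at_right 0) (\<lambda>\<epsilon>. INF P \<in> U. F_eps f \<Omega> \<epsilon> P) \<le> ereal (4 * ?I) + ereal e" if "e > 0" for e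
    proof -
      \<comment> \<open>The bound of \<open>recovery_fields\<close> for a test function of norm at
        most S0 becomes \<delta>/4, which together with the approximation error stays below
        \<delta>.\<close>
      define e' where "e' = min e (\<delta> / (4 * (S0 + 1)))"
      have e': "e' > 0" "e' \<le> e" using \<open>e > 0\<close> \<Phi>(3) \<open>S0 \<ge> 0\<close> by (auto simp: e'_def)
      have "e' * (S0 + 1) \<le> \<delta> / (4 * (S0 + 1)) * (S0 + 1)" using \<open>S0 \<ge> 0\<close> by (intro mult_right_mono) (auto simp: e'_def)
      also have "\<dots> = \<delta> / 4" using \<open>S0 \<ge> 0\<close> by (simp add: divide_simps)
      finally have e'S: "e' * (S0 + 1) \<le> \<delta> / 4" .
      obtain u where u: "\<And>\<epsilon> i. u \<epsilon> i \<in> S1"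
        "\<forall>\<^sub>F \<epsilon> in at_right 0. \<epsilon>\<^sup>2 * energy f (Z_eps \<epsilon> \<Omega>) (u \<epsilon>) \<le> 4 * ?I + e'"
        "\<And>\<psi> S. continuous_on UNIV \<psi> \<Longrightarrow> (\<And>x. norm (\<psi> x) \<le> S) \<Longrightarrow>
          \<forall>\<^sub>F \<epsilon> in at_right 0. (LINT x|\<mu>. (cell_field \<epsilon> (u \<epsilon>) x - Q x) \<bullet> \<psi> x) \<le> e' * (S + 1)"
        using recovery_fields[OF Qm True e'(1)] by blast
      have 1: "\<forall>\<^sub>F \<epsilon> in at_right 0. \<forall>\<phi> \<in> \<Phi>. (LINT x|\<mu>. (cell_field \<epsilon> (u \<epsilon>) x - Q x) \<bullet> \<psi> \<phi> x) \<le> \<delta> / 4"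
        using \<Phi>(1)
      proof (rule eventually_ball_finite, intro ballI)
        fix \<phi> assume \<phi>: "\<phi> \<in> \<Phi>"
        have "\<forall>\<^sub>F \<epsilon> in at_right 0. (LINT x|\<mu>. (cell_field \<epsilon> (u \<epsilon>) x - Q x) \<bullet> \<psi> \<phi> x) \<le> e' * (S0 + 1)"
          by (rule u(3)[OF \<psi>(1)[OF \<phi>] S0[OF \<phi>]])
        then show "\<forall>\<^sub>F \<epsilon> in at_right 0. (LINT x|\<mu>. (cell_field \<epsilon> (u \<epsilon>) x - Q x) \<bullet> \<psi> \<phi> x) \<le> \<delta> / 4"
          by eventually_elim (rule order_trans[OF _ e'S])
      qed
      \<comment> \<open>The estimate of \<open>recovery_fields\<close> is one-sided; the test
        function - \<psi> supplies the other side.\<close>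
      have 2: "\<forall>\<^sub>F \<epsilon> in at_right 0. \<forall>\<phi> \<in> \<Phi>. (LINT x|\<mu>. (cell_field \<epsilon> (u \<epsilon>) x - Q x) \<bullet> - \<psi> \<phi> x) \<le> \<delta> / 4"
        using \<Phi>(1)
      proof (rule eventually_ball_finite, intro ballI)
        fix \<phi> assume \<phi>: "\<phi> \<in> \<Phi>"
        have "\<forall>\<^sub>F \<epsilon> in at_right 0. (LINT x|\<mu>. (cell_field \<epsilon> (u \<epsilon>) x - Q x) \<bullet> - \<psi> \<phi> x) \<le> e' * (S0 + 1)"
          using S0[OF \<phi>] by (intro u(3) continuous_on_minus \<psi>(1)[OF \<phi>]) simp
        then show "\<forall>\<^sub>F \<epsilon> in at_right 0. (LINT x|\<mu>. (cell_field \<epsilon> (u \<epsilon>) x - Q x) \<bullet> - \<psi> \<phi> x) \<le> \<delta> / 4"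
          by eventually_elim (rule order_trans[OF _ e'S])
      qed
      have "\<forall>\<^sub>F \<epsilon> in at_right 0. (INF P \<in> U. F_eps f \<Omega> \<epsilon> P) \<le> ereal (4 * ?I) + ereal e"
        using u(2) 1 2 eventually_at_right_less[of "0::real"]
      proof eventually_elim
        case (elim \<epsilon>)
        let ?P = "cell_field \<epsilon> (u \<epsilon>)"
        note cf = cell_field_props[of \<epsilon> "u \<epsilon>", OF elim(4) u(1)]
        have "?P \<in> U"
        proof (rule mp[OF bspec[OF inU cf(2)]], rule ballI)
          fix \<phi> assume \<phi>: "\<phi> \<in> \<Phi>"
          have \<phi>i: "integrable \<mu> \<phi>" using \<phi> \<Phi>(2) by (auto simp: L1_def)
          have \<psi>i: "integrable \<mu> (\<psi> \<phi>)"
            using continuous_measurable[OF \<psi>(1)[OF \<phi>]] S0[OF \<phi>] by (intro integrable_const_bound[where B = S0]) auto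
          have i: "integrable \<mu> (\<lambda>x. ?P x \<bullet> \<theta> x)" "integrable \<mu> (\<lambda>x. Q x \<bullet> \<theta> x)" if "integrable \<mu> \<theta>" for \<theta>
            using Linf_integrable[OF cf(2) that] Linf_integrable[OF Q that] by simp_all
          have di: "integrable \<mu> (\<lambda>x. (?P x - Q x) \<bullet> \<theta> x)" if "integrable \<mu> \<theta>" for \<theta>
            using i[OF that] by (simp add: inner_diff_left)
          have "(LINT x|\<mu>. ?P x \<bullet> \<phi> x) - (LINT x|\<mu>. Q x \<bullet> \<phi> x) = (LINT x|\<mu>. (?P x - Q x) \<bullet> \<phi> x)"
            using i[OF \<phi>i] by (simp add: inner_diff_left)
          also have "\<dots> = (LINT x|\<mu>. (?P x - Q x) \<bullet> \<psi> \<phi> x + (?P x - Q x) \<bullet> (\<phi> x - \<psi> \<phi> x))"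
            by (simp flip: inner_add_right)
          also have "\<dots> = (LINT x|\<mu>. (?P x - Q x) \<bullet> \<psi> \<phi> x) + (LINT x|\<mu>. (?P x - Q x) \<bullet> (\<phi> x - \<psi> \<phi> x))"
            using di \<phi>i \<psi>i by (intro Bochner_Integration.integral_add) auto
          finally have eq: "(LINT x|\<mu>. ?P x \<bullet> \<phi> x) - (LINT x|\<mu>. Q x \<bullet> \<phi> x)
            = (LINT x|\<mu>. (?P x - Q x) \<bullet> \<psi> \<phi> x) + (LINT x|\<mu>. (?P x - Q x) \<bullet> (\<phi> x - \<psi> \<phi> x))" .
          have "\<bar>LINT x|\<mu>. (?P x - Q x) \<bullet> \<psi> \<phi> x\<bar> \<le> \<delta> / 4"
            using bspec[OF elim(2) \<phi>] bspec[OF elim(3) \<phi>] by (simp add: abs_le_iff)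
          moreover have "\<bar>LINT x|\<mu>. (?P x - Q x) \<bullet> (\<phi> x - \<psi> \<phi> x)\<bar> \<le> 2 * (\<delta> / 8)"
          proof -
            have "\<bar>LINT x|\<mu>. (?P x - Q x) \<bullet> (\<phi> x - \<psi> \<phi> x)\<bar> \<le> (LINT x|\<mu>. \<bar>(?P x - Q x) \<bullet> (\<phi> x - \<psi> \<phi> x)\<bar>)"
              by (rule integral_abs_bound)
            also have "\<dots> \<le> (LINT x|\<mu>. 2 * norm (\<phi> x - \<psi> \<phi> x))"
            proof (rule integral_mono_AE)
              show "AE x in \<mu>. \<bar>(?P x - Q x) \<bullet> (\<phi> x - \<psi> \<phi> x)\<bar> \<le> 2 * norm (\<phi> x - \<psi> \<phi> x)"
                using True
              proof eventually_elim
                case (elim x)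
                have "norm (?P x - Q x) \<le> 2"
                  using norm_triangle_ineq4[of "?P x" "Q x"] norm_K_le_1[OF elim] norm_S1_tensor[OF cf(4), of x] by linarith
                then have "norm (?P x - Q x) * norm (\<phi> x - \<psi> \<phi> x) \<le> 2 * norm (\<phi> x - \<psi> \<phi> x)" by (intro mult_right_mono) auto
                then show ?case using Cauchy_Schwarz_ineq2[of "?P x - Q x" "\<phi> x - \<psi> \<phi> x"] by linarith
              qed
            qed (use di \<phi>i \<psi>i in auto)
            also have "\<dots> \<le> 2 * (\<delta> / 8)" using \<psi>(3)[OF \<phi>] by simp
            finally show ?thesis .
          qed
          ultimately show "\<bar>(LINT x|\<mu>. ?P x \<bullet> \<phi> x) - (LINT x|\<mu>. Q x \<bullet> \<phi> x)\<bar> < \<delta>"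
            unfolding eq using \<Phi>(3) by linarith
        qed
        then have "(INF P \<in> U. F_eps f \<Omega> \<epsilon> P) \<le> F_eps f \<Omega> \<epsilon> ?P" by (rule INF_lower)
        also have "\<dots> = ereal (\<epsilon>\<^sup>2 * energy f (Z_eps \<epsilon> \<Omega>) (u \<epsilon>))" by (rule F_eps_spin_field[OF cf(3) elim(4)])
        also have "\<dots> \<le> ereal (4 * ?I) + ereal e" using elim(1) e'(2) by simp
        finally show ?case .
      qed
      then show ?thesis by (rule Limsup_bounded)
    qed
    then have "Limsup (at_right 0) (\<lambda>\<epsilon>. INF P \<in> U. F_eps f \<Omega> \<epsilon> P) \<le> ereal (4 * ?I)"
      by (rule ereal_le_epsilon2)
    then show "Limsup (at_right 0) (\<lambda>\<epsilon>. INF P \<in> U. F_eps f \<Omega> \<epsilon> P) \<le> F_lim f \<Omega> Q"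
      by (simp add: F_lim_eq[OF Qm True])
  qed
qed

lemma Gamma_convergence: "Gamma_converges (weak_star \<Omega>) (at_right 0) (F_eps f \<Omega>) (F_lim f \<Omega>)"
  unfolding Gamma_converges_def topspace_weak_star
proof
  fix Q assume Q: "Q \<in> Linf \<Omega>"
  have "Gamma_liminf (weak_star \<Omega>) (at_right 0) (F_eps f \<Omega>) Q \<le> Gamma_limsup (weak_star \<Omega>) (at_right 0) (F_eps f \<Omega>) Q"
    by (rule Gamma_liminf_le_limsup) (rule trivial_limit_at_right_real)
  then show "Gamma_liminf (weak_star \<Omega>) (at_right 0) (F_eps f \<Omega>) Q = F_lim f \<Omega> Q \<and>
      Gamma_limsup (weak_star \<Omega>) (at_right 0) (F_eps f \<Omega>) Q = F_lim f \<Omega> Q"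
    using Gamma_liminf_ge[OF Q] Gamma_limsup_le[OF Q] by (meson antisym order_trans)
qed

end

theorem theorem3p11:
  fixes \<Omega> :: "vec2 set" and f :: "vec2 \<Rightarrow> vec2 \<Rightarrow> real"
  assumes "open \<Omega>" and "bounded \<Omega>" and "lipschitz_boundary \<Omega>"
    and "\<exists>C. \<forall>u \<in> S1. \<forall>v \<in> S1. \<bar>f u v\<bar> \<le> C"
    and "\<forall>u \<in> S1. \<forall>v \<in> S1. f u v = f v u"
    and "\<forall>u \<in> S1. \<forall>v \<in> S1. f u v = f u (- v) \<and> f u v = f (- u) v"
  shows "Gamma_converges (weak_star \<Omega>) (at_right 0) (F_eps f \<Omega>) (F_lim f \<Omega>) \<and>
         (\<forall>Q \<in> K_set. fhom_exists f Q \<and> fhom f Q = 4 * fhat_env f Q)"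
proof -
  obtain C where C: "\<forall>u \<in> S1. \<forall>v \<in> S1. \<bar>f u v\<bar> \<le> C" using assms(4) by blast
  interpret spin_domain f C \<Omega>
  proof
    show "\<bar>f u v\<bar> \<le> C" if "u \<in> S1" "v \<in> S1" for u v using C that by blast
    show "f u v = f v u" if "u \<in> S1" "v \<in> S1" for u v using assms(5) that by blast
    show "f u (- v) = f u v" if "u \<in> S1" "v \<in> S1" for u v using assms(6) that by metis
    show "negligible (frontier \<Omega>)" using assms(1,3) by (rule negligible_frontier_lipschitz)
  qed (rule assms(1), rule assms(2))
  show ?thesis using Gamma_convergence fhom_eq by blast
qed

end
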